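(* Let $N\ge 2$, $R>0$, $1\le p<\infty$, $1<\beta<\infty$, $\gamma>0$ and $\alpha\le N-(\beta-1)\gamma$. Then the inequality $$\left(\frac{\beta-1}{p}\gamma\right)^p\int_{B_R}\frac{|u|^p}{|x|^\alpha\left(1-\left(\frac{|x|}{R}\right)^\gamma\right)^\beta}\,dx\le\int_{B_R}\frac{\left|\nabla u\cdot\frac{x}{|x|}\right|^p}{|x|^{\alpha-p}\left(1-\left(\frac{|x|}{R}\right)^\gamma\right)^{\beta-p}}\,dx$$ holds for all $u\in C_c^1(B_R)$. Furthermore, the constant $\left(\frac{\beta-1}{p}\gamma\right)^p$ in this inequality is optimal and is not attained for $u\not\equiv0$ for which the right-hand side is finite.
   Context: $B_R\subset\mathbb{R}^N$ is the ball of radius $R$ centered at $0$. "Optimal" means that the constant cannot be replaced by any larger one; "not attained" means that equality does not hold for any $u\not\equiv0$ for which the right-hand side is finite.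
   Formalization: Non-attainment is stated only when p>1 or α<N-(β-1)γ; for p=1 and α=N-(β-1)γ it is false, since every radially nonincreasing u in C_c^1(B_R) gives equality. The inequality and the optimality of the constant are stated in the full range. *)

theory Defs
  imports "HOL-Analysis.Analysis"
begin

definition gradient :: "('a::real_inner \<Rightarrow> real) \<Rightarrow> 'a \<Rightarrow> 'a" where
  "gradient u x = (THE D. GDERIV u x :> D)"

lemma gradient_eq:
  assumes "GDERIV u x :> D"
  shows "gradient u x = D"
  unfolding gradient_def
proof (rule the_equality)
  fix E assume "GDERIV u x :> E"
  then have "(\<lambda>h. h \<bullet> E) = (\<lambda>h. h \<bullet> D)"
    using assms has_derivative_unique unfolding gderiv_def by blast
  then have "(E - D) \<bullet> E = (E - D) \<bullet> D" by meson
  then have "(E - D) \<bullet> (E - D) = 0" by (simp add: inner_diff_right)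
  then show "E = D" by simp
qed (rule assms)

(* Elements of C_c^1(\<Omega>) are represented by their extension by zero to the whole space. *)
definition C1c :: "'a::euclidean_space set \<Rightarrow> ('a \<Rightarrow> real) set" where
  "C1c \<Omega> = {u. (\<forall>x. u differentiable at x) \<and> continuous_on UNIV (gradient u) \<and>
     compact (closure {x. u x \<noteq> 0}) \<and> closure {x. u x \<noteq> 0} \<subseteq> \<Omega>}"

(* u is in W^{1,1}_loc(\<Omega>) with distributional gradient G. *)
definition has_weak_gradient_on ::
    "('a::euclidean_space \<Rightarrow> real) \<Rightarrow> ('a \<Rightarrow> 'a) \<Rightarrow> 'a set \<Rightarrow> bool" where
  "has_weak_gradient_on u G \<Omega> \<longleftrightarrow>
     (\<forall>K. compact K \<and> K \<subseteq> \<Omega> \<longrightarrow> u absolutely_integrable_on K \<and> G absolutely_integrable_on K) \<and>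
     (\<forall>\<phi>\<in>C1c \<Omega>. (LINT x:\<Omega>|lebesgue. u x *\<^sub>R gradient \<phi> x) = - (LINT x:\<Omega>|lebesgue. \<phi> x *\<^sub>R G x))"

(* The two sides of the inequality, without the constant, as integrals with values in [0,\<infinity>];
   G is the (classical or weak) gradient. The integrands are nonnegative, and the
   conventions for division by zero and 0 powr a affect them only at the null set {0}. *)
definition hardy_lhs ::
    "real \<Rightarrow> real \<Rightarrow> real \<Rightarrow> real \<Rightarrow> real \<Rightarrow> ('a::euclidean_space \<Rightarrow> real) \<Rightarrow> ennreal" where
  "hardy_lhs R p \<alpha> \<beta> \<gamma> u =
     (\<integral>\<^sup>+x\<in>ball 0 R. ennreal (\<bar>u x\<bar> powr p /
        (norm x powr \<alpha> * (1 - (norm x / R) powr \<gamma>) powr \<beta>)) \<partial>lebesgue)"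

definition hardy_rhs ::
    "real \<Rightarrow> real \<Rightarrow> real \<Rightarrow> real \<Rightarrow> real \<Rightarrow> ('a::euclidean_space \<Rightarrow> 'a) \<Rightarrow> ennreal" where
  "hardy_rhs R p \<alpha> \<beta> \<gamma> G =
     (\<integral>\<^sup>+x\<in>ball 0 R. ennreal (\<bar>G x \<bullet> (x /\<^sub>R norm x)\<bar> powr p /
        (norm x powr (\<alpha> - p) * (1 - (norm x / R) powr \<gamma>) powr (\<beta> - p))) \<partial>lebesgue)"

(* Whether the constant is attained is asked for all functions weakly differentiable on the
   punctured ball (not only for C_c^1, for which the right-hand side is always finite);
   "u is not identically zero" then means not almost everywhere zero.

   The pair p = 1, \<alpha> = N - (\<beta>-1)\<gamma> has to be excluded from non-attainment. There, with
   w(r) = r^{N-\<alpha>} (1-(r/R)^\<gamma>)^{1-\<beta>}, one has w(0) = 0 and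
   w'(r) = (\<beta>-1) \<gamma> r^{N-1-\<alpha>} (1-(r/R)^\<gamma>)^{-\<beta>}, so for every radially nonincreasing
   u in C_c^1 both sides equal, up to the area of the unit sphere,
   \<integral> u w' dr = - \<integral> u' w dr, and equality holds. *)
definition hardy_not_attained ::
    "'a::euclidean_space itself \<Rightarrow> real \<Rightarrow> real \<Rightarrow> real \<Rightarrow> real \<Rightarrow> real \<Rightarrow> real \<Rightarrow> bool" where
  "hardy_not_attained _ C R p \<alpha> \<beta> \<gamma> \<longleftrightarrow>
     (\<forall>(u :: 'a \<Rightarrow> real) G. has_weak_gradient_on u G (ball 0 R - {0}) \<and>
        \<not> (AE x in lebesgue. x \<in> ball 0 R \<longrightarrow> u x = 0) \<and>
        hardy_rhs R p \<alpha> \<beta> \<gamma> G < \<infinity> \<longrightarrow>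
        ennreal C * hardy_lhs R p \<alpha> \<beta> \<gamma> u \<noteq> hardy_rhs R p \<alpha> \<beta> \<gamma> G)"

end

theory Submission
  imports Defs
begin

text \<open>
  Write \<open>r = |x|\<close>, \<open>s r = 1 - (r / R)\<^sup>\<gamma>\<close>, \<open>q = (\<beta> - 1) / p\<close> and \<open>c = q \<gamma>\<close>, so that the constant is
  \<open>c\<^sup>p\<close>, and let \<open>g x = \<nabla>u x \<bullet> x\<close>. All three statements concern rays through the origin. Polar
  coordinates are replaced by Tonelli's theorem for \<open>(x, l)\<close> together with the dilations
  \<open>x \<mapsto> l x\<close>, whose effect on Lebesgue measure is a power of \<open>l\<close>.

  The inequality. If \<open>u\<close> tends to 0 at the end of the ray then
  \<open>|u x| \<le> \<integral> |g (l x)| / l dl\<close> over \<open>l > 1\<close>. Let \<open>E r = r\<^sup>c (s r)\<^sup>-\<^sup>q\<close>. The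
  measure with density \<open>d/dl (1 - E r / E (l r))\<close> has mass 1 on \<open>1 < l < R / r\<close>, and Jensen's inequality
  for it bounds \<open>|u x|\<^sup>p\<close> by a weighted integral of \<open>|g (l x)|\<^sup>p\<close>
  (\<open>ray_Hardy\<close>). Integrating over \<open>x\<close> and substituting \<open>y = l x\<close> leaves one
  integral in \<open>l\<close>, which is at most the integral of a derivative exactly because
  \<open>\<alpha> \<le> N - (\<beta> - 1) \<gamma>\<close> (\<open>kernel_mass_le\<close>). The result is \<open>Hardy_of_domination\<close>, stated for functions
  \<open>u\<close> and \<open>g\<close> related only by the domination, so that it serves classical and weak gradients alike.

  No extremals. Suppose that both sides are finite and equal. If \<open>p > 1\<close>, equality in Jensen's
  inequality forces \<open>|g|\<close> to be a multiple of the radial derivative of \<open>1 / E\<close>, up to the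
  factor \<open>r\<close>, on almost every ray, and the
  right-hand side then diverges like \<open>\<integral> 1 / s\<close> unless \<open>u\<close> vanishes. If \<open>\<alpha>\<close> is below the
  critical value, the bound for the integral in \<open>l\<close> is strict (\<open>Hardy_strict\<close>). For a weakly differentiable \<open>u\<close> the
  domination along rays has to be derived: integrating dilated test functions shows that
  \<open>u (l x) - u x\<close> is the integral of \<open>g (t x) / t\<close> over \<open>1 < t < l\<close> for almost every \<open>x\<close>
  (\<open>radial_difference\<close>), and finiteness of the left-hand side makes \<open>u\<close> small along
  a sequence approaching the end of almost every ray, because \<open>\<integral> 1 / s\<close> diverges there
  (\<open>weak_radial_dominated\<close>).

  Optimality. With \<open>W = 1 - (r / R)\<^sup>2\<close>, the function \<open>W\<^sup>k\<close> is smooth at the origin, and for it the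
  integrand on the right is at most \<open>(k \<gamma>)\<^sup>p\<close> times the one on the left. Any constant larger than
  \<open>c\<^sup>p\<close> exceeds \<open>(k \<gamma>)\<^sup>p\<close> for some \<open>k > q\<close>, and cutting \<open>W\<^sup>k\<close> off
  where \<open>\<epsilon> < W < 2 \<epsilon>\<close> costs only a positive power of \<open>\<epsilon>\<close> (\<open>test_rhs_integral_le\<close>).
\<close>

section \<open>Dilations of Euclidean space\<close>

lemma nn_integral_dilation:
  fixes f :: "'a::euclidean_space \<Rightarrow> ennreal"
  assumes [measurable]: "f \<in> borel_measurable borel" and "a > 0"
  shows "(\<integral>\<^sup>+x. f (a *\<^sub>R x) \<partial>lborel) = ennreal (a powr (- real DIM('a))) * (\<integral>\<^sup>+x. f x \<partial>lborel)"
proof -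
  have "(\<integral>\<^sup>+x. f x \<partial>lborel) = ennreal (a ^ DIM('a)) * (\<integral>\<^sup>+x. f (a *\<^sub>R x) \<partial>lborel)"
    using \<open>a > 0\<close>
    by (subst lborel_affine[of a "0::'a"])
       (auto simp: nn_integral_density nn_integral_distr nn_integral_cmult ennreal_power)
  then show ?thesis
    using \<open>a > 0\<close> by (simp add: powr_minus powr_realpow flip: mult.assoc ennreal_mult)
qed

lemma
  fixes f :: "'a::euclidean_space \<Rightarrow> real"
  assumes f: "integrable lborel f" and "a > 0"
  shows integrable_dilation: "integrable lborel (\<lambda>x. f (a *\<^sub>R x))"
    and integral_dilation: "(LINT x|lborel. f (a *\<^sub>R x)) = a powr (- real DIM('a)) * (LINT x|lborel. f x)"
proof -
  have [measurable]: "f \<in> borel_measurable borel"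
    using f by auto
  have eq: "lborel = density (distr lborel borel (\<lambda>x::'a. a *\<^sub>R x)) (\<lambda>_. ennreal (a ^ DIM('a)))"
    using lborel_affine[of a "0::'a"] \<open>a > 0\<close> by (simp add: ennreal_power)
  have "integrable (density (distr lborel borel (\<lambda>x::'a. a *\<^sub>R x)) (\<lambda>_. ennreal (a ^ DIM('a)))) f"
    using f eq by simp
  then have "integrable (distr lborel borel (\<lambda>x::'a. a *\<^sub>R x)) (\<lambda>x. a ^ DIM('a) *\<^sub>R f x)"
    using \<open>a > 0\<close> by (subst (asm) integrable_density) auto
  then have "integrable lborel (\<lambda>x. a ^ DIM('a) *\<^sub>R f (a *\<^sub>R x))"
    by (subst (asm) integrable_distr_eq) auto
  then show "integrable lborel (\<lambda>x. f (a *\<^sub>R x))"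
    using \<open>a > 0\<close> by simp
  have "(LINT x|lborel. f x) = (LINT x|density (distr lborel borel (\<lambda>x::'a. a *\<^sub>R x)) (\<lambda>_. ennreal (a ^ DIM('a))). f x)"
    using eq by simp
  also have "\<dots> = a ^ DIM('a) * (LINT x|lborel. f (a *\<^sub>R x))"
    using \<open>a > 0\<close> by (subst integral_density) (auto simp: integral_distr)
  finally show "(LINT x|lborel. f (a *\<^sub>R x)) = a powr (- real DIM('a)) * (LINT x|lborel. f x)"
    using \<open>a > 0\<close> by (simp add: powr_minus powr_realpow)
qed

section \<open>Integrals of nonnegative functions\<close>

text \<open>
  Used to read off the equality cases of pointwise inequalities from an equality of finite integrals.
\<close>

lemma AE_eq_if_nn_integral_le:
  fixes f g :: "'a \<Rightarrow> ennreal"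
  assumes [measurable]: "f \<in> borel_measurable M" "g \<in> borel_measurable M"
    and le: "AE x in M. f x \<le> g x" and ge: "integral\<^sup>N M g \<le> integral\<^sup>N M f"
    and fin: "integral\<^sup>N M f < \<infinity>"
  shows "AE x in M. f x = g x"
proof (rule ccontr)
  assume "\<not> ?thesis"
  then have "\<not> (AE x in M. g x \<le> f x)"
  proof (rule contrapos_nn)
    assume "AE x in M. g x \<le> f x"
    with le show "AE x in M. f x = g x" by eventually_elim (rule antisym)
  qed
  then have "integral\<^sup>N M f < integral\<^sup>N M g"
    using fin le by (intro nn_integral_less) auto
  with ge show False by simp
qed

text \<open>
  One-sided forms of the fundamental theorem on an interval at whose right end \<open>f\<close> may blow up:
  a lower bound that exhibits divergence, and an upper bound by any upper bound of the antiderivative.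
\<close>

lemma
  fixes f F :: "real \<Rightarrow> real"
  assumes [measurable]: "f \<in> borel_measurable borel"
    and deriv: "\<And>x. a \<le> x \<Longrightarrow> x < b \<Longrightarrow> (F has_real_derivative f x) (at x)"
    and nonneg: "\<And>x. a \<le> x \<Longrightarrow> x < b \<Longrightarrow> 0 \<le> f x"
  shows nn_integral_deriv_lower: "\<And>x. a \<le> x \<Longrightarrow> x < b \<Longrightarrow> ennreal (F x - F a) \<le> (\<integral>\<^sup>+x\<in>{a<..<b}. ennreal (f x) \<partial>lborel)"
    and nn_integral_deriv_upper: "(\<And>x. a \<le> x \<Longrightarrow> x < b \<Longrightarrow> F x \<le> B) \<Longrightarrow> a < b \<Longrightarrow> (\<integral>\<^sup>+x\<in>{a<..<b}. ennreal (f x) \<partial>lborel) \<le> ennreal (B - F a)"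
proof -
  have ftc: "(\<integral>\<^sup>+t\<in>{a..x}. ennreal (f t) \<partial>lborel) = ennreal (F x - F a)" if "a \<le> x" "x < b" for x
    using that deriv nonneg by (intro nn_integral_FTC_Icc) (auto intro: has_field_derivative_at_within)
  have open_eq: "(\<integral>\<^sup>+x\<in>{a<..<b}. ennreal (f x) \<partial>lborel) = (\<integral>\<^sup>+x\<in>{a..<b}. ennreal (f x) \<partial>lborel)"
  proof (rule nn_integral_cong_AE)
    show "AE x in lborel. ennreal (f x) * indicator {a<..<b} x = ennreal (f x) * indicator {a..<b} x"
      using AE_lborel_singleton[of a] by eventually_elim (auto split: split_indicator)
  qed
  show "ennreal (F x - F a) \<le> (\<integral>\<^sup>+x\<in>{a<..<b}. ennreal (f x) \<partial>lborel)" if "a \<le> x" "x < b" for x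
    unfolding open_eq ftc[OF that, symmetric] using that
    by (intro nn_integral_mono) (auto split: split_indicator)
  show "(\<integral>\<^sup>+x\<in>{a<..<b}. ennreal (f x) \<partial>lborel) \<le> ennreal (B - F a)"
    if B: "\<And>x. a \<le> x \<Longrightarrow> x < b \<Longrightarrow> F x \<le> B" and "a < b"
  proof -
    define y where "y n = b - (b - a) / (real n + 1)" for n
    have y: "a \<le> y n" "y n < b" for n
      using \<open>a < b\<close> mult_right_mono[of a b "real n"] by (auto simp: y_def field_simps)
    have "mono y"
      using \<open>a < b\<close> by (auto intro!: monoI divide_left_mono simp: y_def)
    have lim: "y \<longlonglongrightarrow> b"
    proof -
      have "(\<lambda>n. b - (b - a) * inverse (real (Suc n))) \<longlonglongrightarrow> b - (b - a) * 0"
        by (intro tendsto_intros LIMSEQ_inverse_real_of_nat)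
      then show ?thesis by (simp add: y_def[abs_def] divide_inverse add.commute)
    qed
    have ind: "(SUP n. ennreal (f t) * indicator {a..y n} t) = ennreal (f t) * indicator {a..<b} t" for t
    proof (cases "a \<le> t \<and> t < b")
      case True
      then obtain n where "t < y n"
        using order_tendstoD(1)[OF lim, of t] by (auto simp: eventually_sequentially)
      then show ?thesis
        using True by (intro antisym SUP_least SUP_upper2[of n]) (auto split: split_indicator)
    next
      case False
      then have "ennreal (f t) * indicator {a..y n} t = 0" for n
        using y[of n] by (auto split: split_indicator)
      then have "(SUP n. ennreal (f t) * indicator {a..y n} t) = (SUP n::nat. 0)" by presburger
      then show ?thesis using False by (auto split: split_indicator)
    qed
    have "(\<integral>\<^sup>+x\<in>{a..<b}. ennreal (f x) \<partial>lborel) = (\<integral>\<^sup>+t. (SUP n. ennreal (f t) * indicator {a..y n} t) \<partial>lborel)"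
      by (simp add: ind)
    also have "\<dots> = (SUP n. \<integral>\<^sup>+t\<in>{a..y n}. ennreal (f t) \<partial>lborel)"
      using \<open>mono y\<close>
      by (intro nn_integral_monotone_convergence_SUP)
         (auto simp: incseq_def le_fun_def mono_def split: split_indicator intro: order_trans)
    also have "\<dots> \<le> ennreal (B - F a)"
      using y B by (auto intro!: SUP_least ennreal_leI simp: ftc)
    finally show ?thesis unfolding open_eq .
  qed
qed

section \<open>Bernoulli's and Jensen's inequalities for powers\<close>

lemma
  fixes x a :: real
  assumes "0 < l" "l \<le> x" "x \<le> h"
  shows powr_le_sum: "x powr a \<le> l powr a + h powr a"
    and powr_ge_min: "min (l powr a) (h powr a) \<le> x powr a"
proof -
  have "l powr a \<le> x powr a \<and> x powr a \<le> h powr a \<or> h powr a \<le> x powr a \<and> x powr a \<le> l powr a"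
  proof (cases "0 \<le> a")
    case True
    then show ?thesis using assms by (intro disjI1 conjI powr_mono2) auto
  next
    case False
    then show ?thesis using assms by (intro disjI2 conjI powr_mono2') auto
  qed
  moreover have "0 \<le> l powr a" "0 \<le> h powr a" by simp_all
  ultimately show "x powr a \<le> l powr a + h powr a" "min (l powr a) (h powr a) \<le> x powr a"
    by linarith+
qed

lemma powr_Bernoulli_less:
  fixes y p :: real
  assumes "p > 1" "y \<ge> 0" "y \<noteq> 1"
  shows "1 + p * (y - 1) < y powr p"
proof -
  have d: "DERIV (\<lambda>y. y powr p) x :> p * x powr (p - 1)" if "x > 0" for x :: real
    using that by (rule has_real_derivative_powr)
  consider "y = 0" | "0 < y" "y < 1" | "y > 1" using assms by linarith
  then show ?thesis
  proof cases
    case 1 then show ?thesis using assms by simp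
  next
    case 2
    then obtain z where z: "y < z" "z < 1" "1 powr p - y powr p = (1 - y) * (p * z powr (p - 1))"
      using MVT2[of y 1 "\<lambda>y. y powr p" "\<lambda>x. p * x powr (p - 1)"] d by force
    have "z powr (p - 1) < 1 powr (p - 1)"
      using z 2 assms by (intro powr_less_mono2) auto
    then have "(1 - y) * (p * z powr (p - 1)) < (1 - y) * (p * 1)"
      using 2 assms by (intro mult_strict_left_mono) auto
    then show ?thesis using z(3) by (simp add: algebra_simps)
  next
    case 3
    then obtain z where z: "1 < z" "z < y" "y powr p - 1 powr p = (y - 1) * (p * z powr (p - 1))"
      using MVT2[of 1 y "\<lambda>y. y powr p" "\<lambda>x. p * x powr (p - 1)"] d by force
    have "1 powr (p - 1) < z powr (p - 1)"
      using z 3 assms by (intro powr_less_mono2) auto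
    then have "(y - 1) * (p * 1) < (y - 1) * (p * z powr (p - 1))"
      using 3 assms by (intro mult_strict_left_mono) auto
    then show ?thesis using z(3) by (simp add: algebra_simps)
  qed
qed

lemma powr_Bernoulli:
  fixes y p :: real
  assumes "p \<ge> 1" "y \<ge> 0"
  shows "1 + p * (y - 1) \<le> y powr p"
  using powr_Bernoulli_less[of p y] assms by (cases "p = 1"; cases "y = 1") auto

lemma
  fixes k X p :: real
  assumes "p \<ge> 1" "k > 0" "X \<ge> 0"
  shows powr_tangent: "p * k powr (p - 1) * X \<le> (p - 1) * k powr p + X powr p"
    and powr_tangent_eq: "p > 1 \<Longrightarrow> p * k powr (p - 1) * X = (p - 1) * k powr p + X powr p \<Longrightarrow> X = k"
proof -
  have k: "k powr p = k powr (p - 1) * k"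
    using assms by (simp add: powr_diff)
  have X: "X powr p = k powr p * (X / k) powr p"
    using assms by (simp add: powr_divide)
  have kp: "k powr p > 0" using assms by simp
  have 1: "p * k powr (p - 1) * X - (p - 1) * k powr p = k powr p * (1 + p * (X / k - 1))"
    using assms k by (simp add: field_simps)
  show "p * k powr (p - 1) * X \<le> (p - 1) * k powr p + X powr p"
  proof -
    have "k powr p * (1 + p * (X / k - 1)) \<le> k powr p * (X / k) powr p"
      using assms by (intro mult_left_mono powr_Bernoulli) auto
    then show ?thesis using 1 X by linarith
  qed
  show "X = k" if "p > 1" "p * k powr (p - 1) * X = (p - 1) * k powr p + X powr p"
  proof (rule ccontr)
    assume "X \<noteq> k"
    then have "k powr p * (1 + p * (X / k - 1)) < k powr p * (X / k) powr p"
      using assms that by (intro mult_strict_left_mono powr_Bernoulli_less) auto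
    then show False using that 1 X by simp
  qed
qed

text \<open>
  The tangent of \<open>X powr p\<close> is taken at the given real number \<open>k\<close> rather than at the mean of \<open>X\<close>.
  Therefore the mean may be infinite and total mass at most 1 suffices. In the case of
  equality both sides of the tangent inequality have the same finite integral.
\<close>

lemma
  fixes X :: "'a \<Rightarrow> real" and k p :: real
  assumes [measurable]: "X \<in> borel_measurable D" and X: "\<And>x. X x \<ge> 0" and "p \<ge> 1" "k \<ge> 0"
    and mass: "emeasure D (space D) \<le> 1" and mean: "ennreal k \<le> (\<integral>\<^sup>+x. ennreal (X x) \<partial>D)"
  shows Jensen_powr: "ennreal (k powr p) \<le> (\<integral>\<^sup>+x. ennreal (X x powr p) \<partial>D)"
    and Jensen_powr_eq: "p > 1 \<Longrightarrow> (\<integral>\<^sup>+x. ennreal (X x powr p) \<partial>D) \<le> ennreal (k powr p) \<Longrightarrow> AE x in D. X x = k"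
proof -
  let ?I = "\<integral>\<^sup>+x. ennreal (X x powr p) \<partial>D"
  have A: "ennreal (p * k powr p) \<le> (\<integral>\<^sup>+x. ennreal (p * k powr (p - 1) * X x) \<partial>D)" (is "_ \<le> ?A") if "k > 0"
  proof -
    have "ennreal (p * k powr p) = ennreal (p * k powr (p - 1)) * ennreal k"
      using that assms by (simp add: powr_diff flip: ennreal_mult)
    also have "\<dots> \<le> ennreal (p * k powr (p - 1)) * (\<integral>\<^sup>+x. ennreal (X x) \<partial>D)"
      by (intro mult_left_mono mean) auto
    also have "\<dots> = ?A"
      using X assms by (subst nn_integral_cmult[symmetric]) (auto simp: ennreal_mult)
    finally show ?thesis .
  qed
  have B: "(\<integral>\<^sup>+x. ennreal ((p - 1) * k powr p + X x powr p) \<partial>D) \<le> ennreal ((p - 1) * k powr p) + ?I"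
  proof -
    have "(\<integral>\<^sup>+x. ennreal ((p - 1) * k powr p + X x powr p) \<partial>D) = (\<integral>\<^sup>+x. (ennreal ((p - 1) * k powr p) + ennreal (X x powr p)) \<partial>D)"
      using assms by simp
    also have "\<dots> = ennreal ((p - 1) * k powr p) * emeasure D (space D) + ?I"
      by (subst nn_integral_add) auto
    also have "\<dots> \<le> ennreal ((p - 1) * k powr p) * 1 + ?I"
      by (intro add_right_mono mult_left_mono mass) auto
    finally show ?thesis by simp
  qed
  have sum: "ennreal (p * k powr p) = ennreal ((p - 1) * k powr p) + ennreal (k powr p)"
    using assms mult_right_mono[OF \<open>p \<ge> 1\<close>, of "k powr p"]
    by (subst ennreal_plus[symmetric]) (auto simp: left_diff_distrib)
  show "ennreal (k powr p) \<le> ?I"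
  proof (cases "k = 0")
    case False
    then have "k > 0" using assms by simp
    have "ennreal ((p - 1) * k powr p) + ennreal (k powr p) \<le> ?A"
      using A[OF \<open>k > 0\<close>] sum by simp
    also have "\<dots> \<le> (\<integral>\<^sup>+x. ennreal ((p - 1) * k powr p + X x powr p) \<partial>D)"
      using powr_tangent[OF \<open>p \<ge> 1\<close> \<open>k > 0\<close> X] by (intro nn_integral_mono ennreal_leI)
    also note B
    finally show ?thesis
      by (subst (asm) ennreal_add_left_cancel_le) auto
  qed simp
  show "AE x in D. X x = k" if "p > 1" and le: "?I \<le> ennreal (k powr p)"
  proof (cases "k = 0")
    case True
    then have "?I = 0" using le assms by simp
    then have "AE x in D. ennreal (X x powr p) = 0"
      by (subst (asm) nn_integral_0_iff_AE) auto
    then show ?thesis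
      by eventually_elim (use True X in auto)
  next
    case False
    then have "k > 0" using assms by simp
    let ?B = "\<integral>\<^sup>+x. ennreal ((p - 1) * k powr p + X x powr p) \<partial>D"
    have le1: "?A \<le> ?B"
      using powr_tangent[OF \<open>p \<ge> 1\<close> \<open>k > 0\<close> X] by (intro nn_integral_mono ennreal_leI)
    have le2: "?B \<le> ennreal (p * k powr p)"
      using order_trans[OF B add_left_mono[OF le]] sum by simp
    have "AE x in D. ennreal (p * k powr (p - 1) * X x) = ennreal ((p - 1) * k powr p + X x powr p)"
    proof (rule AE_eq_if_nn_integral_le)
      show "AE x in D. ennreal (p * k powr (p - 1) * X x) \<le> ennreal ((p - 1) * k powr p + X x powr p)"
        using powr_tangent[OF \<open>p \<ge> 1\<close> \<open>k > 0\<close> X] by (intro AE_I2 ennreal_leI)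
      show "?B \<le> ?A" using le2 A[OF \<open>k > 0\<close>] by (rule order_trans)
      show "?A < \<infinity>" using order_trans[OF le1 le2] by (auto simp: order_le_less_trans)
    qed auto
    then show ?thesis
    proof eventually_elim
      case (elim x)
      then have "p * k powr (p - 1) * X x = (p - 1) * k powr p + X x powr p"
        using assms X[of x] by (subst (asm) ennreal_inj) auto
      then show ?case
        using powr_tangent_eq[OF \<open>p \<ge> 1\<close> \<open>k > 0\<close> X \<open>p > 1\<close>] by blast
    qed
  qed
qed

section \<open>The weight and its primitives along a ray\<close>

locale hardy_setup =
  fixes dim :: nat and R p \<alpha> \<beta> \<gamma> :: real
  assumes R: "R > 0" and p: "p \<ge> 1" and \<beta>: "\<beta> > 1" and \<gamma>: "\<gamma> > 0"
    and \<alpha>: "\<alpha> \<le> real dim - (\<beta> - 1) * \<gamma>"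
begin

text \<open>
  The substitution \<open>y = l x\<close> in the double integral leaves the factor \<open>l powr (- e - 1)\<close>; the
  hypothesis on \<open>\<alpha>\<close> says \<open>c \<le> e\<close>, with equality in the critical case.
\<close>

definition s :: "real \<Rightarrow> real" where "s r = 1 - (r / R) powr \<gamma>"
definition q :: real where "q = (\<beta> - 1) / p"
definition c :: real where "c = q * \<gamma>"
definition e :: real where "e = real dim - \<alpha> - c * (p - 1)"

abbreviation (input) weight :: "'a::real_normed_vector \<Rightarrow> real" where
  "weight x \<equiv> norm x powr (- \<alpha>) * s (norm x) powr (- \<beta>)"

text \<open>
  The derivative in \<open>l\<close> of \<open>1 - E r / E (l * r)\<close>, where \<open>E r = r powr c * s r powr (- q)\<close> increases
  from 0 to infinity on \<open>(0, R)\<close>. The function \<open>1 / E\<close> is the formal extremal of the inequality along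
  a ray, which is why Jensen's inequality for this law is sharp.
\<close>

abbreviation (input) ray_density :: "real \<Rightarrow> real \<Rightarrow> real" where
  "ray_density r l \<equiv> c * l powr (- c - 1) * (s (l * r) / s r) powr q / s (l * r)"

lemma q_pos: "q > 0" and c_pos: "c > 0" and \<beta>_eq: "\<beta> = p * q + 1"
  using p \<beta> \<gamma> by (auto simp: q_def c_def)

lemma e_ge_c: "c \<le> e"
proof -
  have "c * p = (\<beta> - 1) * \<gamma>"
    using p by (simp add: c_def q_def)
  then show ?thesis
    using \<alpha> by (simp add: e_def algebra_simps)
qed

lemma s_measurable [measurable]: "s \<in> borel_measurable borel"
  unfolding s_def[abs_def] by measurable

lemma s_pos: "0 \<le> r \<Longrightarrow> r < R \<Longrightarrow> 0 < s r"
  using R \<gamma> powr_less_mono2[of \<gamma> "r / R" 1] by (simp add: s_def)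

lemma s_divide_pos:
  assumes "0 < \<rho>" "\<rho> < R" "1 \<le> l"
  shows "0 < s (\<rho> / l)"
proof -
  have "\<rho> / l \<le> \<rho> / 1"
    using assms by (intro divide_left_mono) auto
  then show ?thesis using assms by (intro s_pos) auto
qed

lemma s_le_1: "s r \<le> 1"
  by (simp add: s_def)

lemma s_less_1: "0 < r \<Longrightarrow> s r < 1"
  using R by (simp add: s_def)

lemma s_deriv: "r > 0 \<Longrightarrow> (s has_real_derivative - \<gamma> * (1 - s r) / r) (at r)"
  unfolding s_def[abs_def] using R \<gamma>
  by (auto intro!: derivative_eq_intros simp: powr_diff field_simps)

text \<open>
  The antiderivative is \<open>- E r / E (l * r)\<close>, which is \<open>- 1\<close> at \<open>l = 1\<close> and stays nonpositive.
\<close>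

lemma mass_le_1:
  assumes r: "0 < r" "r < R"
  shows "(\<integral>\<^sup>+l\<in>{1<..<R / r}. ennreal (ray_density r l) \<partial>lborel) \<le> 1"
proof -
  let ?F = "\<lambda>l. - (l powr (- c) * (s (l * r) / s r) powr q)"
  have pos: "0 < l" "0 < s (l * r)" if "1 \<le> l" "l < R / r" for l
    using that r by (auto intro!: s_pos simp: field_simps)
  have s0: "s r > 0" using r by (intro s_pos) auto
  have "(\<integral>\<^sup>+l\<in>{1<..<R / r}. ennreal (ray_density r l) \<partial>lborel) \<le> ennreal (0 - ?F 1)"
  proof (rule nn_integral_deriv_upper)
    fix l assume l: "1 \<le> l" "l < R / r"
    note pos = pos[OF l]
    have D: "((\<lambda>l. s (l * r)) has_real_derivative - \<gamma> * (1 - s (l * r)) / (l * r) * r) (at l)"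
      using pos r by (intro DERIV_chain2[OF s_deriv]) (auto intro!: derivative_eq_intros)
    let ?a = "l powr (- c)" and ?b = "(s (l * r) / s r) powr q"
    have "(?F has_real_derivative - ((- c * l powr (- c - 1)) * ?b +
        ?a * (q * (s (l * r) / s r) powr (q - 1) * (- \<gamma> * (1 - s (l * r)) / (l * r) * r / s r)))) (at l)"
      using pos s0 r by (auto intro!: derivative_eq_intros D)
    also have "l powr (- c - 1) = ?a / l"
      using pos by (simp add: powr_diff)
    also have "(s (l * r) / s r) powr (q - 1) = ?b * s r / s (l * r)"
      using pos s0 by (simp add: powr_diff)
    also have "- ((- c * (?a / l)) * ?b + ?a * (q * (?b * s r / s (l * r)) * (- \<gamma> * (1 - s (l * r)) / (l * r) * r / s r)))
        = c * (?a / l) * ?b / s (l * r)"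
      using pos s0 r by (simp add: c_def field_simps)
    also have "?a / l = l powr (- c - 1)"
      using pos by (simp add: powr_diff)
    finally show "(?F has_real_derivative c * l powr (- c - 1) * ?b / s (l * r)) (at l)" .
    show "0 \<le> c * l powr (- c - 1) * ?b / s (l * r)"
      using pos c_pos by simp
  qed (use r in auto)
  then show ?thesis using s0 by simp
qed

text \<open>
  The integrand is the derivative of \<open>- (l powr (- e) * s (\<rho> / l) powr (- q))\<close>. Its last factor interpolates
  between \<open>c\<close> at the boundary, where \<open>s\<close> vanishes, and \<open>e\<close> at the origin, where \<open>s = 1\<close>.
\<close>

lemma nn_integral_kernel:
  assumes \<rho>: "0 < \<rho>" "\<rho> < R"
  shows "(\<integral>\<^sup>+l\<in>{1<..}. ennreal (l powr (- e - 1) * s (\<rho> / l) powr (- q - 1) * (c + (e - c) * s (\<rho> / l))) \<partial>lborel)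
    = ennreal (s \<rho> powr (- q))"
proof -
  let ?F = "\<lambda>l. - (l powr (- e) * s (\<rho> / l) powr (- q))"
  let ?f = "\<lambda>l. l powr (- e - 1) * s (\<rho> / l) powr (- q - 1) * (c + (e - c) * s (\<rho> / l))"
  have pos: "0 < l" "0 < s (\<rho> / l)" if "1 \<le> l" for l
    using that \<rho> s_divide_pos by auto
  have "(\<integral>\<^sup>+l. ennreal (?f l) * indicator {1..} l \<partial>lborel) = ennreal (0 - ?F 1)"
  proof (rule nn_integral_FTC_atLeast)
    fix l :: real assume l: "1 \<le> l"
    note pos = pos[OF l]
    have D: "((\<lambda>l. s (\<rho> / l)) has_real_derivative - \<gamma> * (1 - s (\<rho> / l)) / (\<rho> / l) * (- (\<rho> / l^2))) (at l)"
      using pos \<rho> by (intro DERIV_chain2[OF s_deriv]) (auto intro!: derivative_eq_intros simp: power2_eq_square)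
    let ?a = "l powr (- e)" and ?b = "s (\<rho> / l) powr (- q)"
    have "(?F has_real_derivative - ((- e * l powr (- e - 1)) * ?b +
        ?a * (- q * s (\<rho> / l) powr (- q - 1) * (- \<gamma> * (1 - s (\<rho> / l)) / (\<rho> / l) * (- (\<rho> / l^2)))))) (at l)"
      using pos \<rho> by (auto intro!: derivative_eq_intros D)
    also have "l powr (- e - 1) = ?a / l"
      using pos by (simp add: powr_diff)
    also have "s (\<rho> / l) powr (- q - 1) = ?b / s (\<rho> / l)"
      using pos by (simp add: powr_diff)
    also have "- ((- e * (?a / l)) * ?b + ?a * (- q * (?b / s (\<rho> / l)) * (- \<gamma> * (1 - s (\<rho> / l)) / (\<rho> / l) * (- (\<rho> / l^2)))))
       = ?a / l * (?b / s (\<rho> / l)) * (c + (e - c) * s (\<rho> / l))"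
      using pos \<rho> by (simp add: c_def field_simps power2_eq_square)
    also have "?b / s (\<rho> / l) = s (\<rho> / l) powr (- q - 1)"
      using pos by (simp add: powr_diff)
    also have "?a / l = l powr (- e - 1)"
      using pos by (simp add: powr_diff)
    finally show "(?F has_real_derivative ?f l) (at l)" .
    show "0 \<le> ?f l"
      using pos c_pos e_ge_c by simp
  next
    have "((\<lambda>l. \<rho> / l) \<longlongrightarrow> 0) at_top"
      by (rule real_tendsto_divide_at_top[OF tendsto_const filterlim_ident])
    then have "((\<lambda>l. 1 - (\<rho> / l / R) powr \<gamma>) \<longlongrightarrow> 1 - (0 / R) powr \<gamma>) at_top"
      using \<rho> R \<gamma>
      by (intro tendsto_intros) (auto intro!: eventually_mono[OF eventually_ge_at_top[of 0]])
    then have "((\<lambda>l. s (\<rho> / l)) \<longlongrightarrow> 1) at_top"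
      by (simp add: s_def)
    moreover have "((\<lambda>l. l powr (- e)) \<longlongrightarrow> 0) at_top"
      using c_pos e_ge_c by (intro tendsto_neg_powr filterlim_ident) auto
    ultimately have "(?F \<longlongrightarrow> - (0 * 1 powr (- q))) at_top"
      by (intro tendsto_intros) auto
    then show "(?F \<longlongrightarrow> 0) at_top" by simp
  qed measurable
  moreover have "(\<integral>\<^sup>+l. ennreal (?f l) * indicator {1..} l \<partial>lborel) = (\<integral>\<^sup>+l. ennreal (?f l) * indicator {1<..} l \<partial>lborel)"
  proof (rule nn_integral_cong_AE)
    show "AE l in lborel. ennreal (?f l) * indicator {1..} l = ennreal (?f l) * indicator {1<..} l"
      using AE_lborel_singleton[of 1] by eventually_elim (auto split: split_indicator)
  qed
  ultimately show ?thesis by simp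
qed

definition kernel_mass :: "real \<Rightarrow> ennreal" where
  "kernel_mass \<rho> = (\<integral>\<^sup>+l\<in>{1<..}. ennreal (l powr (- e - 1) * s (\<rho> / l) powr (- q - 1)) \<partial>lborel)"

text \<open>
  Dropping the nonnegative term with \<open>e - c\<close> from the exact value of the preceding integral
  gives the bound, and this term is positive unless \<open>e = c\<close>.
\<close>

lemma
  assumes \<rho>: "0 < \<rho>" "\<rho> < R"
  shows kernel_mass_le: "ennreal c * kernel_mass \<rho> \<le> ennreal (s \<rho> powr (- q))"
    and kernel_mass_less: "c < e \<Longrightarrow> ennreal c * kernel_mass \<rho> < ennreal (s \<rho> powr (- q))"
proof -
  let ?k = "\<lambda>l. l powr (- e - 1) * s (\<rho> / l) powr (- q - 1)"
  have pos: "0 < s (\<rho> / l)" if "1 < l" for l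
    using that \<rho> s_divide_pos by auto
  have eq: "ennreal c * kernel_mass \<rho> = (\<integral>\<^sup>+l\<in>{1<..}. ennreal (c * ?k l) \<partial>lborel)"
    unfolding kernel_mass_def using c_pos
    by (subst nn_integral_cmult[symmetric]) (auto simp: ennreal_mult mult_ac)
  have split: "(\<integral>\<^sup>+l\<in>{1<..}. ennreal (c * ?k l) \<partial>lborel) + (\<integral>\<^sup>+l\<in>{1<..}. ennreal ((e - c) * s (\<rho> / l) * ?k l) \<partial>lborel)
     = ennreal (s \<rho> powr (- q))"
    unfolding nn_integral_kernel[OF \<rho>, symmetric]
  proof (subst nn_integral_add[symmetric])
    show "(\<integral>\<^sup>+l. (ennreal (c * ?k l) * indicator {1<..} l + ennreal ((e - c) * s (\<rho> / l) * ?k l) * indicator {1<..} l) \<partial>lborel)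
      = (\<integral>\<^sup>+l\<in>{1<..}. ennreal (?k l * (c + (e - c) * s (\<rho> / l))) \<partial>lborel)"
    proof (rule nn_integral_cong)
      fix l :: real
      show "ennreal (c * ?k l) * indicator {1<..} l + ennreal ((e - c) * s (\<rho> / l) * ?k l) * indicator {1<..} l
        = ennreal (?k l * (c + (e - c) * s (\<rho> / l))) * indicator {1<..} l"
      proof (cases "1 < l")
        case True
        have "?k l * (c + (e - c) * s (\<rho> / l)) = c * ?k l + (e - c) * s (\<rho> / l) * ?k l"
          by (simp only: algebra_simps)
        moreover have "0 \<le> c * ?k l" "0 \<le> (e - c) * s (\<rho> / l) * ?k l"
          using c_pos e_ge_c pos[OF True] by auto
        ultimately show ?thesis using True by (simp only: ennreal_plus) simp
      qed simp
    qed
  qed measurable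
  show "ennreal c * kernel_mass \<rho> \<le> ennreal (s \<rho> powr (- q))"
    unfolding eq split[symmetric] by simp
  show "ennreal c * kernel_mass \<rho> < ennreal (s \<rho> powr (- q))" if "c < e"
  proof -
    have fin: "(\<integral>\<^sup>+l\<in>{1<..}. ennreal (c * ?k l) \<partial>lborel) \<noteq> top"
      using split by (metis ennreal_neq_top ennreal_add_eq_top)
    have "(\<integral>\<^sup>+l\<in>{1<..}. ennreal ((e - c) * s (\<rho> / l) * ?k l) \<partial>lborel) \<noteq> 0"
    proof
      assume "(\<integral>\<^sup>+l\<in>{1<..}. ennreal ((e - c) * s (\<rho> / l) * ?k l) \<partial>lborel) = 0"
      then have "AE l in lborel. ennreal ((e - c) * s (\<rho> / l) * ?k l) * indicator {1<..} l = 0"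
        by (subst (asm) nn_integral_0_iff_AE) auto
      then have "AE l in lborel. l \<notin> {1<..<2::real}"
        by eventually_elim (use pos that in \<open>force simp: not_le intro!: mult_pos_pos\<close>)
      then have "emeasure lborel {1<..<2::real} = 0"
        by (subst (asm) AE_iff_measurable[of "{1<..<2}"]) auto
      then show False by simp
    qed
    then have "(\<integral>\<^sup>+l\<in>{1<..}. ennreal (c * ?k l) \<partial>lborel) + 0 <
        (\<integral>\<^sup>+l\<in>{1<..}. ennreal (c * ?k l) \<partial>lborel) + (\<integral>\<^sup>+l\<in>{1<..}. ennreal ((e - c) * s (\<rho> / l) * ?k l) \<partial>lborel)"
      using fin by (subst ennreal_add_left_cancel_less) (simp add: zero_less_iff_neq_zero)
    then show ?thesis
      unfolding eq split by simp
  qed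
qed

text \<open>
  The function \<open>- ln (s (l * r)) / \<gamma>\<close> is unbounded as \<open>l\<close> tends to \<open>R / r\<close>, and its derivative is at most \<open>1 / s (l * r)\<close>. This
  divergence excludes extremals and forces functions with finite left-hand side to
  become small near the boundary.
\<close>

lemma nn_integral_inverse_s:
  assumes r: "0 < r" "r < R" and m: "1 \<le> m" "m < R / r"
  shows "(\<integral>\<^sup>+l\<in>{m<..<R / r}. ennreal (1 / s (l * r)) \<partial>lborel) = \<infinity>"
proof (rule ccontr)
  have pos: "0 < l" "0 < s (l * r)" "1 \<le> l" if "m \<le> l" "l < R / r" for l
    using that r m by (auto intro!: s_pos simp: field_simps)
  let ?F = "\<lambda>l. - ln (s (l * r)) / \<gamma>" and ?f = "\<lambda>l. (1 - s (l * r)) / (l * s (l * r))"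
  assume "\<not> ?thesis"
  then obtain B where B: "B \<ge> 0" "(\<integral>\<^sup>+l\<in>{m<..<R / r}. ennreal (1 / s (l * r)) \<partial>lborel) = ennreal B"
    by (cases "\<integral>\<^sup>+l\<in>{m<..<R / r}. ennreal (1 / s (l * r)) \<partial>lborel" rule: ennreal_cases) auto
  have lower: "?F l - ?F m \<le> B" if l: "m \<le> l" "l < R / r" for l
  proof -
    have "ennreal (?F l - ?F m) \<le> (\<integral>\<^sup>+l\<in>{m<..<R / r}. ennreal (?f l) \<partial>lborel)"
    proof (rule nn_integral_deriv_lower[OF _ _ _ l])
      fix l assume "m \<le> l" "l < R / r"
      note pos = pos[OF this]
      have D: "((\<lambda>l. s (l * r)) has_real_derivative - \<gamma> * (1 - s (l * r)) / (l * r) * r) (at l)"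
        using pos r by (intro DERIV_chain2[OF s_deriv]) (auto intro!: derivative_eq_intros)
      show "(?F has_real_derivative ?f l) (at l)"
        using pos r \<gamma> by (auto intro!: derivative_eq_intros D simp: field_simps)
      show "0 \<le> ?f l"
        using pos s_le_1[of "l * r"] by simp
    qed measurable
    also have "\<dots> \<le> (\<integral>\<^sup>+l\<in>{m<..<R / r}. ennreal (1 / s (l * r)) \<partial>lborel)"
    proof (intro nn_integral_mono)
      fix l
      show "ennreal (?f l) * indicator {m<..<R / r} l \<le> ennreal (1 / s (l * r)) * indicator {m<..<R / r} l"
      proof (cases "m < l \<and> l < R / r")
        case True
        then have "?f l \<le> 1 / s (l * r)"
          using pos[of l] s_le_1[of "l * r"] by (intro frac_le) (auto simp: mult_le_cancel_right)
        then show ?thesis by (auto split: split_indicator intro: ennreal_leI)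
      qed auto
    qed
    finally show ?thesis using B by simp
  qed
  \<comment> \<open>The point where \<open>s\<close> has dropped to \<open>d\<close> makes the primitive exceed its value at \<open>m\<close> by \<open>B + 1\<close>.\<close>
  define d where "d = s (m * r) * exp (- \<gamma> * (B + 1))"
  have sm: "0 < s (m * r)" "s (m * r) < 1"
    using pos[of m] m r s_less_1[of "m * r"] by auto
  have "exp (- \<gamma> * (B + 1)) \<le> 1"
    using \<gamma> B by simp
  then have "s (m * r) * exp (- \<gamma> * (B + 1)) \<le> s (m * r)"
    using sm by (intro mult_left_le) auto
  then have d: "0 < d" "d \<le> s (m * r)" "d < 1"
    using sm by (auto simp only: d_def exp_gt_zero mult_pos_pos)
  define l where "l = R / r * (1 - d) powr (1 / \<gamma>)"
  have "s (l * r) = d"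
    using r R \<gamma> d by (simp add: s_def l_def powr_powr)
  moreover have "l < R / r"
    using r R \<gamma> d powr_less_mono2[of "1 / \<gamma>" "1 - d" 1]
    by (simp add: l_def divide_strict_right_mono)
  moreover have "m \<le> l"
  proof -
    have "m * r / R = ((m * r / R) powr \<gamma>) powr (1 / \<gamma>)"
      using m r R \<gamma> by (simp add: powr_powr)
    also have "\<dots> \<le> (1 - d) powr (1 / \<gamma>)"
      using d \<gamma> by (intro powr_mono2) (auto simp: s_def)
    finally show ?thesis using r R by (simp add: l_def field_simps)
  qed
  ultimately have "- ln d / \<gamma> + ln (s (m * r)) / \<gamma> \<le> B"
    using lower[of l] by simp
  moreover have "ln d = ln (s (m * r)) - \<gamma> * (B + 1)"
    using sm by (simp add: d_def ln_mult)
  ultimately show False using \<gamma> by (simp add: field_simps)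
qed

lemma ray_integral_infinite:
  assumes r: "0 < r" "r < R" and "K > 0"
    and F: "AE l in lborel. 1 < l \<and> l < R / r \<longrightarrow> ennreal (K / s (l * r)) \<le> F l"
  shows "(\<integral>\<^sup>+l\<in>{1<..}. F l \<partial>lborel) = \<infinity>"
proof -
  have "\<infinity> = ennreal K * (\<integral>\<^sup>+l\<in>{1<..<R / r}. ennreal (1 / s (l * r)) \<partial>lborel)"
    using nn_integral_inverse_s[OF r, of 1] r \<open>K > 0\<close> by (simp add: ennreal_mult_top)
  also have "\<dots> = (\<integral>\<^sup>+l\<in>{1<..<R / r}. ennreal (K / s (l * r)) \<partial>lborel)"
    using \<open>K > 0\<close> by (subst nn_integral_cmult[symmetric])
      (auto intro!: nn_integral_cong simp flip: ennreal_mult' split: split_indicator)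
  also have "\<dots> \<le> (\<integral>\<^sup>+l\<in>{1<..}. F l \<partial>lborel)"
  proof (rule nn_integral_mono_AE)
    show "AE l in lborel. ennreal (K / s (l * r)) * indicator {1<..<R / r} l \<le> F l * indicator {1<..} l"
      using F by eventually_elim (auto split: split_indicator)
  qed
  finally show ?thesis by (simp add: top_unique)
qed

end

section \<open>The inequality along a ray\<close>

text \<open>
  The identities between powers below are verified after writing every positive number as an exponential,
  so that they become linear identities between exponents. The parameters are generic real numbers because
  \<open>q\<close>, being defined from \<open>\<beta>\<close>, would make the relation between them a looping rewrite rule.
\<close>

lemma exp_powr: "exp y powr a = exp (a * y)" for y a :: real
  by (simp add: powr_def)

lemma mean_identity:
  fixes q c :: real
  assumes "0 < l" "0 < b" "0 < d"
  shows "l powr (- c - 1) * (b / d) powr q / b * (l powr c * (b / d) powr (- q) * b) = 1 / l"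
proof -
  define l' b' d' where "l' = ln l" "b' = ln b" "d' = ln d"
  then have ex: "l = exp l'" "b = exp b'" "d = exp d'"
    using assms by simp_all
  have "l powr (- c - 1) * (b / d) powr q / b * (l powr c * (b / d) powr (- q) * b)
      = exp ((- c - 1) * l' + q * (b' - d') - b' + (c * l' + (- q) * (b' - d') + b'))"
    unfolding ex exp_diff[symmetric] exp_powr mult_exp_exp ..
  also have "(- c - 1) * l' + q * (b' - d') - b' + (c * l' + (- q) * (b' - d') + b') = - l'"
    by (simp add: algebra_simps)
  finally show ?thesis by (simp add: ex exp_minus inverse_eq_divide)
qed

lemma moment_identity:
  fixes p q c \<beta> m :: real
  assumes "0 < l" "0 < b" "0 < d" "0 < h" "0 < c" and \<beta>: "\<beta> = p * q + 1"
  shows "c * l powr (- c - 1) * (b / d) powr q / b * (l powr c * (b / d) powr (- q) * h * b / c) powr p * (m * d powr (- \<beta>))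
     = c powr (1 - p) * h powr p * b powr ((p - 1) * (1 - q)) * (m * l powr (c * (p - 1) - 1) * d powr (- q - 1))"
proof -
  define l' b' d' h' c' where "l' = ln l" "b' = ln b" "d' = ln d" "h' = ln h" "c' = ln c"
  then have ex: "l = exp l'" "b = exp b'" "d = exp d'" "h = exp h'" and c': "c = exp c'"
    using assms(1-5) by simp_all
  have "c * l powr (- c - 1) * (b / d) powr q / b * (l powr c * (b / d) powr (- q) * h * b / c) powr p * d powr (- \<beta>)
      = exp c' * exp l' powr (- c - 1) * (exp b' / exp d') powr q / exp b' *
          (exp l' powr c * (exp b' / exp d') powr (- q) * exp h' * exp b' / exp c') powr p * exp d' powr (- \<beta>)"
    by (simp only: ex flip: c')
  also have "\<dots> = exp (c' + (- c - 1) * l' + q * (b' - d') - b' + p * (c * l' + (- q) * (b' - d') + h' + b' - c') + (- \<beta>) * d')"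
    unfolding exp_diff[symmetric] exp_powr mult_exp_exp ..
  also have "c' + (- c - 1) * l' + q * (b' - d') - b' + p * (c * l' + (- q) * (b' - d') + h' + b' - c') + (- \<beta>) * d'
      = (1 - p) * c' + p * h' + ((p - 1) * (1 - q)) * b' + ((c * (p - 1) - 1) * l' + (- q - 1) * d')"
    unfolding \<beta> by (simp add: algebra_simps)
  also have "exp \<dots> = exp c' powr (1 - p) * exp h' powr p * exp b' powr ((p - 1) * (1 - q)) *
      (exp l' powr (c * (p - 1) - 1) * exp d' powr (- q - 1))"
    unfolding exp_diff[symmetric] exp_powr mult_exp_exp ..
  also have "\<dots> = c powr (1 - p) * h powr p * b powr ((p - 1) * (1 - q)) * (l powr (c * (p - 1) - 1) * d powr (- q - 1))"
    by (simp only: ex flip: c')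
  finally have "c * l powr (- c - 1) * (b / d) powr q / b * (l powr c * (b / d) powr (- q) * h * b / c) powr p * d powr (- \<beta>)
     = c powr (1 - p) * h powr p * b powr ((p - 1) * (1 - q)) * (l powr (c * (p - 1) - 1) * d powr (- q - 1))" .
  from arg_cong[OF this, of "\<lambda>t. m * t"] show ?thesis by (simp add: mult_ac)
qed

lemma extremal_identity:
  fixes p q c \<alpha> \<beta> :: real
  assumes "0 < l" "0 < b" "0 < d" "0 < h" "0 < z"
    and k: "K = l powr c * (b / d) powr (- q) * h * b" and \<beta>: "\<beta> = p * q + 1"
  shows "K powr p * d powr (- q * p) * z powr (- \<alpha>) * l powr (- c * p - \<alpha>) / b
     = h powr p * ((l * z) powr (- \<alpha>) * b powr (p - \<beta>))"
proof -
  define l' b' d' h' z' where "l' = ln l" "b' = ln b" "d' = ln d" "h' = ln h" "z' = ln z"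
  then have ex: "l = exp l'" "b = exp b'" "d = exp d'" "h = exp h'" "z = exp z'"
    using assms(1-5) by simp_all
  have exponent: "p * (c * l' + (- q) * (b' - d') + h' + b') + - q * p * d' + - \<alpha> * z' + (- c * p - \<alpha>) * l' - b'
    = p * h' + (- \<alpha> * (l' + z') + (p - \<beta>) * b')"
    unfolding \<beta> by (simp add: algebra_simps)
  show ?thesis
    unfolding k ex exp_powr mult_exp_exp exp_diff[symmetric] exponent ..
qed

context hardy_setup
begin

text \<open>
  An upper bound of \<open>|u x|\<close> when \<open>g x = \<nabla>u x \<bullet> x\<close> and \<open>u\<close> vanishes at the end of the ray, since
  \<open>g (l x) / l\<close> is the derivative of \<open>u (l x)\<close> in \<open>l\<close>.
\<close>

definition ray :: "('a::real_normed_vector \<Rightarrow> real) \<Rightarrow> 'a \<Rightarrow> ennreal" where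
  "ray g x = (\<integral>\<^sup>+l\<in>{1<..}. ennreal (\<bar>g (l *\<^sub>R x)\<bar> / l) \<partial>lborel)"

text \<open>
  The weight at \<open>x\<close> times the density of \<open>ray_law\<close> times the \<open>p\<close>-th power of \<open>ray_fun\<close>, with the powers collected.
\<close>

definition kern :: "('a::real_normed_vector \<Rightarrow> real) \<Rightarrow> 'a \<Rightarrow> real \<Rightarrow> real" where
  "kern g x l = c powr (1 - p) * \<bar>g (l *\<^sub>R x)\<bar> powr p * s (l * norm x) powr ((p - 1) * (1 - q)) *
     (norm x powr (- \<alpha>) * l powr (c * (p - 1) - 1) * s (norm x) powr (- q - 1))"

abbreviation (input) kernel_integral :: "('a::real_normed_vector \<Rightarrow> real) \<Rightarrow> 'a \<Rightarrow> ennreal" where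
  "kernel_integral g x \<equiv> (\<integral>\<^sup>+l\<in>{1<..}. ennreal (kern g x l) \<partial>lborel)"

definition ray_law :: "real \<Rightarrow> real measure" where
  "ray_law r = density lborel (\<lambda>l. ennreal (ray_density r l) * indicator {1<..<R / r} l)"

text \<open>
  The quotient of \<open>|g (l x)| / l\<close> by the density of \<open>ray_law\<close>. The absolute value around \<open>s\<close>
  only makes the function nonnegative outside the ball.
\<close>

definition ray_fun :: "('a::real_normed_vector \<Rightarrow> real) \<Rightarrow> 'a \<Rightarrow> real \<Rightarrow> real" where
  "ray_fun g x l = l powr c * (s (l * norm x) / s (norm x)) powr (- q) * \<bar>g (l *\<^sub>R x)\<bar> * \<bar>s (l * norm x)\<bar> / c"

context
  fixes g :: "'a::euclidean_space \<Rightarrow> real" and x :: 'a and k :: real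
  assumes g [measurable]: "g \<in> borel_measurable borel"
    and g0: "\<And>y. R \<le> norm y \<Longrightarrow> g y = 0"
    and x: "0 < norm x" "norm x < R"
begin

lemma s_pos_on_ray: "0 < l" "0 < s (l * norm x)" "0 < s (norm x)" if "1 < l" "l < R / norm x"
  using that x by (auto intro!: s_pos simp: field_simps)

lemma ray_fun_mean:
  "(\<integral>\<^sup>+l. ennreal (ray_fun g x l) \<partial>ray_law (norm x)) = ray g x"
proof -
  have "(\<integral>\<^sup>+l. ennreal (ray_fun g x l) \<partial>ray_law (norm x)) =
      (\<integral>\<^sup>+l. (ennreal (ray_density (norm x) l) * indicator {1<..<R / norm x} l)
        * ennreal (ray_fun g x l) \<partial>lborel)"
    unfolding ray_law_def ray_fun_def by (subst nn_integral_density) auto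
  also have "\<dots> = ray g x"
    unfolding ray_def
  proof (rule nn_integral_cong)
    fix l
    show "(ennreal (ray_density (norm x) l) * indicator {1<..<R / norm x} l)
        * ennreal (ray_fun g x l) = ennreal (\<bar>g (l *\<^sub>R x)\<bar> / l) * indicator {1<..} l"
    proof (cases "1 < l \<and> l < R / norm x")
      case True
      note pos = s_pos_on_ray[of l]
      have "ray_density (norm x) l * ray_fun g x l
        = \<bar>g (l *\<^sub>R x)\<bar> * (l powr (- c - 1) * (s (l * norm x) / s (norm x)) powr q / s (l * norm x) *
            (l powr c * (s (l * norm x) / s (norm x)) powr (- q) * s (l * norm x)))"
        using pos True c_pos by (simp add: ray_fun_def)
      also have "l powr (- c - 1) * (s (l * norm x) / s (norm x)) powr q / s (l * norm x) *
            (l powr c * (s (l * norm x) / s (norm x)) powr (- q) * s (l * norm x)) = 1 / l"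
        using pos True by (intro mean_identity) auto
      finally show ?thesis
        using True pos c_pos by (simp flip: ennreal_mult')
    next
      case False
      then show ?thesis
        using g0[of "l *\<^sub>R x"] x by (auto simp: field_simps split: split_indicator)
    qed
  qed
  finally show ?thesis .
qed

lemma ray_fun_moment:
  "(\<integral>\<^sup>+l. ennreal (ray_fun g x l powr p) \<partial>ray_law (norm x)) * ennreal (weight x)
     = kernel_integral g x"
proof -
  have "(\<integral>\<^sup>+l. ennreal (ray_fun g x l powr p) \<partial>ray_law (norm x)) * ennreal (weight x) =
      (\<integral>\<^sup>+l. (ennreal (ray_density (norm x) l) * indicator {1<..<R / norm x} l)
        * ennreal (ray_fun g x l powr p) * ennreal (weight x) \<partial>lborel)"
    unfolding ray_law_def ray_fun_def by (subst nn_integral_density) (auto simp: nn_integral_multc)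
  also have "\<dots> = kernel_integral g x"
  proof (rule nn_integral_cong)
    fix l
    show "(ennreal (ray_density (norm x) l) * indicator {1<..<R / norm x} l)
        * ennreal (ray_fun g x l powr p) * ennreal (weight x)
        = ennreal (kern g x l) * indicator {1<..} l"
    proof (cases "1 < l \<and> l < R / norm x")
      case True
      note pos = s_pos_on_ray[of l]
      have "ray_density (norm x) l * ray_fun g x l powr p
         * weight x = kern g x l"
      proof (cases "g (l *\<^sub>R x) = 0")
        case True
        then show ?thesis using p by (simp add: ray_fun_def kern_def)
      next
        case False
        then have "ray_density (norm x) l *
            (l powr c * (s (l * norm x) / s (norm x)) powr (- q) * \<bar>g (l *\<^sub>R x)\<bar> * s (l * norm x) / c) powr p
            * weight x =
          c powr (1 - p) * \<bar>g (l *\<^sub>R x)\<bar> powr p * s (l * norm x) powr ((p - 1) * (1 - q)) *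
            (norm x powr (- \<alpha>) * l powr (c * (p - 1) - 1) * s (norm x) powr (- q - 1))"
          using pos True c_pos by (intro moment_identity \<beta>_eq) auto
        then show ?thesis
          using pos True by (simp add: ray_fun_def kern_def)
      qed
      then show ?thesis
        using True pos c_pos by (simp flip: ennreal_mult')
    next
      case False
      then show ?thesis
        using g0[of "l *\<^sub>R x"] x p by (auto simp: kern_def field_simps split: split_indicator)
    qed
  qed
  finally show ?thesis .
qed

lemma ray_law_mass: "emeasure (ray_law (norm x)) (space (ray_law (norm x))) \<le> 1"
  unfolding ray_law_def using mass_le_1[OF x] by (subst emeasure_density) (auto simp: space_density)

text \<open>
  Jensen's inequality for \<open>ray_fun\<close> and \<open>ray_law\<close>, multiplied by the weight at \<open>x\<close>.
\<close>

lemma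
  assumes k: "k \<ge> 0" and le: "ennreal k \<le> ray g x"
  shows ray_Hardy: "ennreal (k powr p * weight x)
      \<le> kernel_integral g x"
    and ray_Hardy_eq: "p > 1 \<Longrightarrow> kernel_integral g x \<le>
        ennreal (k powr p * weight x) \<Longrightarrow>
        AE l in lborel. 1 < l \<and> l < R / norm x \<longrightarrow> ray_fun g x l = k"
proof -
  have X [measurable]: "ray_fun g x \<in> borel_measurable (ray_law (norm x))"
    unfolding ray_law_def ray_fun_def[abs_def] by simp
  have X0: "\<And>l. 0 \<le> ray_fun g x l"
    using c_pos by (simp add: ray_fun_def)
  let ?w = "weight x"
  have w: "?w > 0" using x s_pos[of "norm x"] by simp
  have le': "ennreal k \<le> (\<integral>\<^sup>+l. ennreal (ray_fun g x l) \<partial>ray_law (norm x))"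
    using le unfolding ray_fun_mean .
  note J = Jensen_powr[OF X X0 p k ray_law_mass le'] Jensen_powr_eq[OF X X0 p k ray_law_mass le']
  have eq: "ennreal (k powr p * ?w) = ennreal (k powr p) * ennreal ?w"
    by (subst ennreal_mult) auto
  show "ennreal (k powr p * ?w) \<le> kernel_integral g x"
    unfolding eq ray_fun_moment[symmetric] by (intro mult_right_mono J(1)) auto
  show "AE l in lborel. 1 < l \<and> l < R / norm x \<longrightarrow> ray_fun g x l = k"
    if "p > 1" and le: "kernel_integral g x \<le> ennreal (k powr p * ?w)"
  proof -
    have "ennreal ?w * (\<integral>\<^sup>+l. ennreal (ray_fun g x l powr p) \<partial>ray_law (norm x)) \<le> ennreal ?w * ennreal (k powr p)"
      using le unfolding eq ray_fun_moment[symmetric] by (simp add: mult.commute)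
    then have "(\<integral>\<^sup>+l. ennreal (ray_fun g x l powr p) \<partial>ray_law (norm x)) \<le> ennreal (k powr p)"
      using w by (subst (asm) ennreal_mult_le_mult_iff) auto
    with J(2)[OF \<open>p > 1\<close>] have "AE l in ray_law (norm x). ray_fun g x l = k" by simp
    then have "AE l in lborel. 0 < ennreal (ray_density (norm x) l) * indicator {1<..<R / norm x} l
        \<longrightarrow> ray_fun g x l = k"
      unfolding ray_law_def by (subst (asm) AE_density) auto
    then show ?thesis
    proof eventually_elim
      case (elim l)
      then show ?case using s_pos_on_ray[of l] c_pos by auto
    qed
  qed
qed

text \<open>
  If \<open>ray_fun\<close> equals \<open>k\<close>, the right-hand side integrand at \<open>l x\<close> is a multiple of
  \<open>k powr p * l powr (- c * p - \<alpha>) / s (l |x|)\<close>, whose integral diverges at \<open>l = R / |x|\<close> for \<open>k > 0\<close>.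
\<close>

lemma extremal_ray_eq_0:
  assumes k: "k \<ge> 0"
    and eq: "AE l in lborel. 1 < l \<and> l < R / norm x \<longrightarrow> ray_fun g x l = k"
    and fin: "(\<integral>\<^sup>+l\<in>{1<..}. ennreal (\<bar>g (l *\<^sub>R x)\<bar> powr p * (norm (l *\<^sub>R x) powr (- \<alpha>) * s (norm (l *\<^sub>R x)) powr (p - \<beta>))) \<partial>lborel) < \<infinity>"
  shows "k = 0"
proof (rule ccontr)
  assume "k \<noteq> 0"
  then have "k > 0" using k by simp
  let ?r = "norm x"
  \<comment> \<open>A lower bound for \<open>l powr (- c * p - \<alpha>)\<close> on \<open>1 < l < R / ?r\<close>, whatever the sign of the exponent.\<close>
  define m where "m = min 1 ((R / ?r) powr (- c * p - \<alpha>))"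
  define K where "K = (k * c) powr p * s ?r powr (- q * p) * ?r powr (- \<alpha>) * m"
  have s0: "s ?r > 0" using x by (intro s_pos) auto
  have m: "m > 0" using x R by (simp add: m_def)
  have K: "K > 0" using \<open>k > 0\<close> c_pos s0 x m by (simp add: K_def)
  let ?F = "\<lambda>l. \<bar>g (l *\<^sub>R x)\<bar> powr p * (norm (l *\<^sub>R x) powr (- \<alpha>) * s (norm (l *\<^sub>R x)) powr (p - \<beta>))"
  have "AE l in lborel. 1 < l \<and> l < R / ?r \<longrightarrow> ennreal (K / s (l * ?r)) \<le> ennreal (?F l)"
    using eq
  proof eventually_elim
    case (elim l)
    show ?case
    proof
      assume l: "1 < l \<and> l < R / ?r"
      note pos = s_pos_on_ray[of l]
      have f: "ray_fun g x l = k" using elim l by simp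
      have "m \<le> l powr (- c * p - \<alpha>)"
        using powr_ge_min[of 1 l "R / ?r"] l by (simp add: m_def)
      then have "K / s (l * ?r) \<le> (k * c) powr p * s ?r powr (- q * p) * ?r powr (- \<alpha>) * l powr (- c * p - \<alpha>) / s (l * ?r)"
        unfolding K_def using pos l by (intro divide_right_mono mult_left_mono) auto
      also have "\<dots> = \<bar>g (l *\<^sub>R x)\<bar> powr p * ((l * ?r) powr (- \<alpha>) * s (l * ?r) powr (p - \<beta>))"
      proof -
        have "g (l *\<^sub>R x) \<noteq> 0"
          using f \<open>k > 0\<close> by (auto simp: ray_fun_def)
        moreover have "k * c = l powr c * (s (l * ?r) / s ?r) powr (- q) * \<bar>g (l *\<^sub>R x)\<bar> * s (l * ?r)"
          unfolding f[symmetric] ray_fun_def using c_pos pos l by simp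
        ultimately show ?thesis
          using pos l x by (intro extremal_identity \<beta>_eq) auto
      qed
      finally show "ennreal (K / s (l * ?r)) \<le> ennreal (?F l)"
        using l by (simp add: ennreal_leI)
    qed
  qed
  then have "(\<integral>\<^sup>+l\<in>{1<..}. ennreal (?F l) \<partial>lborel) = \<infinity>"
    by (rule ray_integral_infinite[OF x K])
  then show False using fin by simp
qed

end

end

section \<open>From rays to the ball\<close>

text \<open>
  By Tonelli's theorem the integral over \<open>x\<close> is \<open>\<integral> f\<close> times the integral of \<open>l powr (- N)\<close> over \<open>l > 1\<close>, which
  converges for \<open>N \<ge> 2\<close>.
\<close>

lemma AE_ray_integral_finite:
  fixes f :: "'a::euclidean_space \<Rightarrow> ennreal"
  assumes [measurable]: "f \<in> borel_measurable borel" and dim: "DIM('a) \<ge> 2" and fin: "(\<integral>\<^sup>+x. f x \<partial>lborel) < \<infinity>"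
  shows "AE x in lborel. (\<integral>\<^sup>+l\<in>{1<..}. f (l *\<^sub>R x) \<partial>lborel) < \<infinity>"
proof -
  have "(\<integral>\<^sup>+x. (\<integral>\<^sup>+l\<in>{1<..}. f (l *\<^sub>R x) \<partial>lborel) \<partial>lborel) =
      (\<integral>\<^sup>+l. (\<integral>\<^sup>+x. f (l *\<^sub>R x) * indicator {1<..} l \<partial>lborel) \<partial>lborel)"
    by (rule lborel_pair.Fubini') measurable
  also have "\<dots> = (\<integral>\<^sup>+l\<in>{1<..}. ennreal (l powr (- real DIM('a))) * (\<integral>\<^sup>+x. f x \<partial>lborel) \<partial>lborel)"
    by (intro nn_integral_cong) (auto simp: nn_integral_multc nn_integral_dilation split: split_indicator)
  also have "\<dots> \<le> (\<integral>\<^sup>+l. ennreal (l powr (- 2)) * indicator {1..} l * (\<integral>\<^sup>+x. f x \<partial>lborel) \<partial>lborel)"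
    using dim by (intro nn_integral_mono) (auto intro!: mult_right_mono ennreal_leI powr_mono split: split_indicator)
  also have "\<dots> = (\<integral>\<^sup>+l. ennreal (l powr (- 2)) * indicator {1..} l \<partial>lborel) * (\<integral>\<^sup>+x. f x \<partial>lborel)"
    by (rule nn_integral_multc) auto
  also have "(\<integral>\<^sup>+l. ennreal (l powr (- 2)) * indicator {1..} l \<partial>lborel) = ennreal (0 - (- (1 powr (- 1))))"
  proof (rule nn_integral_FTC_atLeast[where F = "\<lambda>l. - (l powr (- 1))"])
    show "((\<lambda>l. - (l powr (- 1))) has_real_derivative l powr (- 2)) (at l)" if "1 \<le> l" for l :: real
      using DERIV_minus[OF has_real_derivative_powr[of l "- 1"]] that by simp
    have "((\<lambda>l::real. - (l powr (- 1))) \<longlongrightarrow> - 0) at_top"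
      by (intro tendsto_minus tendsto_neg_powr filterlim_ident) auto
    then show "((\<lambda>l::real. - (l powr (- 1))) \<longlongrightarrow> 0) at_top" by simp
  qed auto
  finally have "(\<integral>\<^sup>+x. (\<integral>\<^sup>+l\<in>{1<..}. f (l *\<^sub>R x) \<partial>lborel) \<partial>lborel) \<noteq> \<infinity>"
    using fin by auto
  then have "AE x in lborel. (\<integral>\<^sup>+l\<in>{1<..}. f (l *\<^sub>R x) \<partial>lborel) \<noteq> \<infinity>"
    by (intro nn_integral_PInf_AE) auto
  then show ?thesis
    by eventually_elim (simp add: less_top)
qed

context hardy_setup
begin

definition lhs_density :: "('a::real_normed_vector \<Rightarrow> real) \<Rightarrow> 'a \<Rightarrow> real" where
  "lhs_density u x = \<bar>u x\<bar> powr p * weight x"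

definition rhs_density :: "('a::real_normed_vector \<Rightarrow> real) \<Rightarrow> 'a \<Rightarrow> real" where
  "rhs_density g x = \<bar>g x\<bar> powr p * (norm x powr (- \<alpha>) * s (norm x) powr (p - \<beta>))"

abbreviation (input) lhs_integral :: "('a::euclidean_space \<Rightarrow> real) \<Rightarrow> ennreal" where
  "lhs_integral u \<equiv> (\<integral>\<^sup>+x\<in>ball 0 R. ennreal (lhs_density u x) \<partial>lborel)"

abbreviation (input) rhs_integral :: "('a::euclidean_space \<Rightarrow> real) \<Rightarrow> ennreal" where
  "rhs_integral g \<equiv> (\<integral>\<^sup>+x\<in>ball 0 R. ennreal (rhs_density g x) \<partial>lborel)"

text \<open>
  What remains of the double integral, up to \<open>c powr (1 - p)\<close>, when \<open>kernel_mass\<close> is split off.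
\<close>

definition scaled :: "('a::real_normed_vector \<Rightarrow> real) \<Rightarrow> 'a \<Rightarrow> ennreal" where
  "scaled g y = ennreal (\<bar>g y\<bar> powr p * norm y powr (- \<alpha>) * s (norm y) powr ((p - 1) * (1 - q)))"

lemma rhs_exponent: "(p - 1) * (1 - q) + - q = p - \<beta>"
proof -
  have "p - \<beta> = p - (p * q + 1)" by (simp only: \<beta>_eq[symmetric])
  then show ?thesis by (simp add: algebra_simps)
qed

context
  fixes g :: "'a::euclidean_space \<Rightarrow> real"
  assumes dim: "DIM('a) = dim"
    and g [measurable]: "g \<in> borel_measurable borel"
    and g0: "\<And>y. R \<le> norm y \<Longrightarrow> g y = 0"
begin

text \<open>
  The substitution \<open>y = l x\<close> moves the whole dependence on \<open>l\<close> into \<open>kernel_mass\<close>. The ball may be dropped on the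
  left because \<open>g\<close> vanishes outside it and \<open>l > 1\<close>.
\<close>

lemma double_integral:
  "(\<integral>\<^sup>+x\<in>ball 0 R. kernel_integral g x \<partial>lborel) =
   (\<integral>\<^sup>+y. ennreal (c powr (1 - p) * \<bar>g y\<bar> powr p * norm y powr (- \<alpha>) * s (norm y) powr ((p - 1) * (1 - q)))
      * kernel_mass (norm y) \<partial>lborel)"
proof -
  define H where "H l y = c powr (1 - p) * \<bar>g y\<bar> powr p * s (norm y) powr ((p - 1) * (1 - q)) *
     ((norm y / l) powr (- \<alpha>) * l powr (c * (p - 1) - 1) * s (norm y / l) powr (- q - 1))" for l y
  have [measurable]: "(\<lambda>(l, x). kern g x l) \<in> borel_measurable (borel \<Otimes>\<^sub>M borel)"
    unfolding kern_def by measurable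
  have [measurable]: "(\<lambda>(l, y). H l y) \<in> borel_measurable (borel \<Otimes>\<^sub>M borel)"
    unfolding H_def by measurable
  have kern0: "kern g x l = 0" if "R \<le> norm x" "1 < l" for x l
  proof -
    have "R \<le> l * norm x" using that mult_mono[of 1 l "norm x" "norm x"] R by auto
    then show ?thesis using that g0[of "l *\<^sub>R x"] p by (simp add: kern_def)
  qed
  have kern_H: "kern g x l = H l (l *\<^sub>R x)" if "1 < l" for x l
    using that by (simp add: kern_def H_def)
  have "(\<integral>\<^sup>+x\<in>ball 0 R. kernel_integral g x \<partial>lborel)
      = (\<integral>\<^sup>+x. kernel_integral g x \<partial>lborel)"
  proof (rule nn_integral_cong)
    fix x :: 'a
    show "kernel_integral g x * indicator (ball 0 R) x = kernel_integral g x"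
    proof (cases "norm x < R")
      case False
      then have "kernel_integral g x = (\<integral>\<^sup>+l. 0 \<partial>(lborel :: real measure))"
        by (intro nn_integral_cong) (auto simp: kern0 split: split_indicator)
      then show ?thesis by simp
    qed simp
  qed
  also have "\<dots> = (\<integral>\<^sup>+l. (\<integral>\<^sup>+x. ennreal (kern g x l) * indicator {1<..} l \<partial>lborel) \<partial>lborel)"
    by (rule lborel_pair.Fubini') measurable
  also have "\<dots> = (\<integral>\<^sup>+l. (\<integral>\<^sup>+y. ennreal (l powr (- real dim)) * ennreal (H l y) * indicator {1<..} l \<partial>lborel) \<partial>lborel)"
  proof (rule nn_integral_cong)
    fix l :: real
    show "(\<integral>\<^sup>+x. ennreal (kern g x l) * indicator {1<..} l \<partial>lborel) =
        (\<integral>\<^sup>+y. ennreal (l powr (- real dim)) * ennreal (H l y) * indicator {1<..} l \<partial>lborel)"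
    proof (cases "1 < l")
      case True
      then have "(\<integral>\<^sup>+x. ennreal (kern g x l) * indicator {1<..} l \<partial>lborel) = (\<integral>\<^sup>+x. ennreal (H l (l *\<^sub>R x)) \<partial>lborel)"
        by (simp add: kern_H)
      also have "\<dots> = ennreal (l powr (- real DIM('a))) * (\<integral>\<^sup>+y. ennreal (H l y) \<partial>lborel)"
        using True by (subst nn_integral_dilation) auto
      also have "\<dots> = (\<integral>\<^sup>+y. ennreal (l powr (- real dim)) * ennreal (H l y) \<partial>lborel)"
        unfolding dim by (rule nn_integral_cmult[symmetric]) measurable
      finally show ?thesis using True by simp
    qed simp
  qed
  also have "\<dots> = (\<integral>\<^sup>+y. (\<integral>\<^sup>+l. ennreal (l powr (- real dim)) * ennreal (H l y) * indicator {1<..} l \<partial>lborel) \<partial>lborel)"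
    by (rule lborel_pair.Fubini') measurable
  also have "\<dots> = (\<integral>\<^sup>+y. ennreal (c powr (1 - p) * \<bar>g y\<bar> powr p * norm y powr (- \<alpha>) * s (norm y) powr ((p - 1) * (1 - q)))
      * kernel_mass (norm y) \<partial>lborel)"
  proof (rule nn_integral_cong)
    fix y :: 'a
    let ?A = "c powr (1 - p) * \<bar>g y\<bar> powr p * norm y powr (- \<alpha>) * s (norm y) powr ((p - 1) * (1 - q))"
    have "(\<integral>\<^sup>+l. ennreal (l powr (- real dim)) * ennreal (H l y) * indicator {1<..} l \<partial>lborel)
        = (\<integral>\<^sup>+l. ennreal ?A * (ennreal (l powr (- e - 1) * s (norm y / l) powr (- q - 1)) * indicator {1<..} l) \<partial>lborel)"
    proof (rule nn_integral_cong)
      fix l :: real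
      show "ennreal (l powr (- real dim)) * ennreal (H l y) * indicator {1<..} l
          = ennreal ?A * (ennreal (l powr (- e - 1) * s (norm y / l) powr (- q - 1)) * indicator {1<..} l)"
      proof (cases "1 < l")
        case True
        have "l powr (- e - 1) = l powr (- real dim) * l powr \<alpha> * l powr (c * (p - 1) - 1)"
          unfolding powr_add[symmetric] by (simp add: e_def algebra_simps)
        moreover have "(norm y / l) powr (- \<alpha>) = norm y powr (- \<alpha>) * l powr \<alpha>"
          using True by (simp add: powr_divide powr_minus field_simps)
        ultimately have "l powr (- real dim) * H l y = ?A * (l powr (- e - 1) * s (norm y / l) powr (- q - 1))"
          by (simp add: H_def mult_ac)
        then show ?thesis using True
          by (simp flip: ennreal_mult')
      qed simp
    qed
    also have "\<dots> = ennreal ?A * kernel_mass (norm y)"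
      unfolding kernel_mass_def by (rule nn_integral_cmult) measurable
    finally show "(\<integral>\<^sup>+l. ennreal (l powr (- real dim)) * ennreal (H l y) * indicator {1<..} l \<partial>lborel)
        = ennreal ?A * kernel_mass (norm y)" .
  qed
  finally show ?thesis .
qed

lemma double_integral_scaled:
  "ennreal (c powr p) * (\<integral>\<^sup>+x\<in>ball 0 R. kernel_integral g x \<partial>lborel) =
   (\<integral>\<^sup>+y. scaled g y * (ennreal c * kernel_mass (norm y)) \<partial>lborel)"
proof -
  have [measurable]: "(\<lambda>y::'a. kernel_mass (norm y)) \<in> borel_measurable borel"
    unfolding kernel_mass_def by measurable
  have "ennreal (c powr p) * (ennreal (c powr (1 - p) * \<bar>g y\<bar> powr p * norm y powr (- \<alpha>) * s (norm y) powr ((p - 1) * (1 - q)))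
      * kernel_mass (norm y)) = scaled g y * (ennreal c * kernel_mass (norm y))" for y
  proof -
    have c: "c powr p * c powr (1 - p) = c"
      using c_pos by (simp flip: powr_add)
    have "ennreal (c powr p) * ennreal (c powr (1 - p) * \<bar>g y\<bar> powr p * norm y powr (- \<alpha>) * s (norm y) powr ((p - 1) * (1 - q)))
       = ennreal (c powr p * c powr (1 - p) * (\<bar>g y\<bar> powr p * norm y powr (- \<alpha>) * s (norm y) powr ((p - 1) * (1 - q))))"
      by (simp add: mult.assoc flip: ennreal_mult')
    also have "\<dots> = scaled g y * ennreal c"
      unfolding c scaled_def using c_pos by (simp add: ennreal_mult' mult.commute)
    finally show ?thesis by (simp add: mult.assoc[symmetric])
  qed
  then show ?thesis
    unfolding double_integral by (subst nn_integral_cmult[symmetric]) simp_all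
qed

lemma scaled_measurable [measurable]: "scaled g \<in> borel_measurable borel"
  unfolding scaled_def[abs_def] by measurable

lemma rhs_eq: "rhs_integral g = (\<integral>\<^sup>+y. scaled g y * ennreal (s (norm y) powr (- q)) \<partial>lborel)"
proof (rule nn_integral_cong)
  fix y
  show "ennreal (rhs_density g y) * indicator (ball 0 R) y = scaled g y * ennreal (s (norm y) powr (- q))"
  proof (cases "norm y < R")
    case True
    have "s (norm y) powr (p - \<beta>) = s (norm y) powr ((p - 1) * (1 - q)) * s (norm y) powr (- q)"
      unfolding powr_add[symmetric] rhs_exponent ..
    then show ?thesis using True
      by (simp add: scaled_def rhs_density_def mult_ac flip: ennreal_mult')
  next
    case False
    then show ?thesis using g0[of y] p by (simp add: scaled_def)
  qed
qed

lemma kernel_bound: "scaled g y * (ennreal c * kernel_mass (norm y)) \<le> scaled g y * ennreal (s (norm y) powr (- q))"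
proof (cases "0 < norm y \<and> norm y < R")
  case True
  then show ?thesis by (intro mult_left_mono kernel_mass_le) auto
next
  case False
  then have "scaled g y = 0"
    using g0[of y] p by (cases "y = 0") (auto simp: scaled_def)
  then show ?thesis by simp
qed

lemma double_integral_le:
  "ennreal (c powr p) * (\<integral>\<^sup>+x\<in>ball 0 R. kernel_integral g x \<partial>lborel)
    \<le> rhs_integral g"
  unfolding double_integral_scaled rhs_eq by (intro nn_integral_mono kernel_bound)

context
  fixes u :: "'a \<Rightarrow> real"
  assumes u [measurable]: "u \<in> borel_measurable borel"
    and dominated: "AE x in lborel. norm x < R \<longrightarrow> ennreal \<bar>u x\<bar> \<le> ray g x"
begin

lemma lhs_le_double_integral:
  "AE x in lborel. ennreal (lhs_density u x) * indicator (ball 0 R) x \<le>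
     kernel_integral g x * indicator (ball 0 R) x"
  using dominated AE_lborel_singleton[of 0]
proof eventually_elim
  case (elim x)
  show ?case
  proof (cases "norm x < R")
    case True
    then show ?thesis
      using elim ray_Hardy[OF g g0 _ True, of "\<bar>u x\<bar>"] by (auto simp: lhs_density_def)
  qed simp
qed

lemma Hardy_of_domination:
  "ennreal (c powr p) * lhs_integral u
    \<le> rhs_integral g"
  by (rule order_trans[OF mult_left_mono[OF nn_integral_mono_AE[OF lhs_le_double_integral]] double_integral_le]) simp

text \<open>
  Equality makes both steps of the proof of \<open>Hardy_of_domination\<close> equalities almost everywhere:
  Jensen's inequality, which is strict for \<open>p > 1\<close> unless \<open>ray_fun\<close> is constant, and the bound on
  \<open>kernel_mass\<close>, which is strict for \<open>c < e\<close> wherever \<open>g\<close> does not vanish.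
\<close>

lemma Hardy_strict:
  assumes strict: "p > 1 \<or> c < e" and "dim \<ge> 2"
    and fin: "rhs_integral g < \<infinity>"
    and eq: "ennreal (c powr p) * lhs_integral u
       = rhs_integral g"
  shows "AE x in lborel. norm x < R \<longrightarrow> u x = 0"
proof -
  let ?L = "\<integral>\<^sup>+x\<in>ball 0 R. ennreal (lhs_density u x) \<partial>lborel"
  let ?K = "\<lambda>x. \<integral>\<^sup>+l\<in>{1<..}. ennreal (kern g x l) \<partial>lborel"
  let ?D = "\<integral>\<^sup>+x\<in>ball 0 R. ?K x \<partial>lborel"
  have [measurable]: "(\<lambda>(l, x). kern g x l) \<in> borel_measurable (borel \<Otimes>\<^sub>M borel)"
    unfolding kern_def by measurable
  have [measurable]: "?K \<in> borel_measurable borel"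
    by measurable
  have [measurable]: "lhs_density u \<in> borel_measurable borel" "rhs_density g \<in> borel_measurable borel"
    unfolding lhs_density_def[abs_def] rhs_density_def[abs_def] by measurable
  have [measurable]: "(\<lambda>y::'a. kernel_mass (norm y)) \<in> borel_measurable borel"
    unfolding kernel_mass_def by measurable
  have [measurable]: "Measurable.pred borel (\<lambda>x::'a. x \<in> ball 0 R)"
    by simp
  have C: "c powr p > 0" using c_pos by simp
  have L_fin: "?L < \<infinity>"
    using fin C unfolding eq[symmetric] by (auto simp: ennreal_mult_less_top less_top[symmetric])
  have "ennreal (c powr p) * ?D \<le> ennreal (c powr p) * ?L"
    unfolding eq by (rule double_integral_le)
  then have "?D \<le> ?L"
    using C by (subst (asm) ennreal_mult_le_mult_iff) auto
  moreover have "(\<lambda>x. ennreal (lhs_density u x) * indicator (ball 0 R) x) \<in> borel_measurable lborel"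
    by measurable
  moreover have "(\<lambda>x. ?K x * indicator (ball 0 R) x) \<in> borel_measurable lborel"
    by measurable
  ultimately have tight: "AE x in lborel. ennreal (lhs_density u x) * indicator (ball 0 R) x = ?K x * indicator (ball 0 R) x"
    by (intro AE_eq_if_nn_integral_le[OF _ _ lhs_le_double_integral _ L_fin])
  show ?thesis
  proof (cases "p > 1")
    case True
    have "AE x in lborel. (\<integral>\<^sup>+l\<in>{1<..}. ennreal (rhs_density g (l *\<^sub>R x)) * indicator (ball 0 R) (l *\<^sub>R x) \<partial>lborel) < \<infinity>"
      using fin \<open>dim \<ge> 2\<close> dim by (intro AE_ray_integral_finite) auto
    then show ?thesis
      using dominated tight AE_lborel_singleton[of 0]
    proof eventually_elim
      case (elim x)
      show ?case
      proof
        assume xR: "norm x < R"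
        have x0: "0 < norm x" using elim by simp
        have le: "ennreal \<bar>u x\<bar> \<le> ray g x" using elim xR by simp
        have "AE l in lborel. 1 < l \<and> l < R / norm x \<longrightarrow> ray_fun g x l = \<bar>u x\<bar>"
          using elim xR by (intro ray_Hardy_eq[OF g g0 x0 xR _ le True]) (auto simp: lhs_density_def)
        moreover have "(\<integral>\<^sup>+l\<in>{1<..}. ennreal (rhs_density g (l *\<^sub>R x)) \<partial>lborel) < \<infinity>"
        proof -
          have "ennreal (rhs_density g y) * indicator (ball 0 R) y = ennreal (rhs_density g y)" for y
            using g0[of y] p by (cases "norm y < R") (auto simp: rhs_density_def)
          then show ?thesis using elim by simp
        qed
        ultimately have "\<bar>u x\<bar> = 0"
          by (intro extremal_ray_eq_0[OF g g0 x0 xR]) (auto simp: rhs_density_def)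
        then show "u x = 0" by simp
      qed
    qed
  next
    case False
    then have "c < e" using strict by simp
    have "(\<integral>\<^sup>+y. scaled g y * ennreal (s (norm y) powr (- q)) \<partial>lborel) = ennreal (c powr p) * ?L"
      unfolding eq rhs_eq ..
    also have "\<dots> \<le> ennreal (c powr p) * ?D"
      by (intro mult_left_mono nn_integral_mono_AE lhs_le_double_integral) auto
    also have "\<dots> = (\<integral>\<^sup>+y. scaled g y * (ennreal c * kernel_mass (norm y)) \<partial>lborel)"
      by (rule double_integral_scaled)
    finally have "AE y in lborel. scaled g y * (ennreal c * kernel_mass (norm y)) = scaled g y * ennreal (s (norm y) powr (- q))"
      using fin double_integral_le unfolding rhs_eq double_integral_scaled
      by (intro AE_eq_if_nn_integral_le) (auto simp: kernel_bound)
    then have "AE y in lborel. scaled g y = 0"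
      using AE_lborel_singleton[of 0]
    proof eventually_elim
      case (elim y)
      show ?case
      proof (cases "norm y < R")
        case True
        then have less: "ennreal c * kernel_mass (norm y) < ennreal (s (norm y) powr (- q))"
          using elim by (intro kernel_mass_less \<open>c < e\<close>) auto
        show ?thesis
        proof (rule ccontr)
          assume "scaled g y \<noteq> 0"
          then have "scaled g y * (ennreal c * kernel_mass (norm y)) < scaled g y * ennreal (s (norm y) powr (- q))"
            using less by (intro ennreal_mult_strict_left_mono) (auto simp: scaled_def zero_less_iff_neq_zero)
          with elim show False by simp
        qed
      next
        case False
        then show ?thesis using g0[of y] p by (simp add: scaled_def)
      qed
    qed
    then have "(\<integral>\<^sup>+y. scaled g y * (ennreal c * kernel_mass (norm y)) \<partial>lborel) = 0"
      by (subst nn_integral_0_iff_AE) auto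
    then have "ennreal (c powr p) * ?D = 0"
      unfolding double_integral_scaled .
    then have "?D = 0" using C by simp
    then have "AE x in lborel. ?K x * indicator (ball 0 R) x = 0"
      by (subst (asm) nn_integral_0_iff_AE) auto
    then show ?thesis
      using tight AE_lborel_singleton[of 0]
    proof eventually_elim
      case (elim x)
      show ?case
      proof
        assume xR: "norm x < R"
        then have "lhs_density u x \<le> 0"
          using elim by (auto simp: ennreal_eq_0_iff)
        moreover have "weight x > 0"
          using elim xR s_pos[of "norm x"] by simp
        ultimately show "u x = 0"
          by (auto simp: lhs_density_def mult_le_0_iff)
      qed
    qed
  qed
qed

end

end

end

section \<open>Continuously differentiable functions with compact support\<close>

lemma GDERIV_gradient:
  fixes u :: "'a::euclidean_space \<Rightarrow> real"
  assumes "u differentiable at x"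
  shows "GDERIV u x :> gradient u x"
proof -
  obtain D where D: "(u has_derivative D) (at x)"
    using assms by (auto simp: differentiable_def)
  then interpret D: linear D
    by (rule has_derivative_linear)
  have "D h = h \<bullet> (\<Sum>b\<in>Basis. D b *\<^sub>R b)" for h
  proof -
    have "D h = D (\<Sum>b\<in>Basis. (h \<bullet> b) *\<^sub>R b)" by (simp add: euclidean_representation)
    also have "\<dots> = (\<Sum>b\<in>Basis. (h \<bullet> b) * D b)" by (simp add: D.sum D.scale)
    finally show ?thesis by (simp add: inner_sum_right mult.commute)
  qed
  then have "GDERIV u x :> (\<Sum>b\<in>Basis. D b *\<^sub>R b)"
    using D unfolding gderiv_def by (metis (no_types, lifting) ext)
  then show ?thesis
    using gradient_eq by metis
qed

lemma C1c_GDERIV: "u \<in> C1c \<Omega> \<Longrightarrow> GDERIV u x :> gradient u x"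
  unfolding C1c_def by (auto intro: GDERIV_gradient)

lemma C1c_continuous_gradient: "u \<in> C1c \<Omega> \<Longrightarrow> continuous_on UNIV (gradient u)"
  unfolding C1c_def by auto

lemma C1c_continuous: "u \<in> C1c \<Omega> \<Longrightarrow> continuous_on UNIV u"
  unfolding C1c_def by (auto intro!: differentiable_imp_continuous_on simp: differentiable_on_def differentiable_at_withinI)

lemma C1c_support:
  assumes "u \<in> C1c \<Omega>"
  obtains K where "compact K" "K \<subseteq> \<Omega>" "\<And>x. x \<notin> K \<Longrightarrow> u x = 0" "\<And>x. x \<notin> K \<Longrightarrow> gradient u x = 0"
proof
  let ?K = "closure {x. u x \<noteq> 0}"
  show "compact ?K" "?K \<subseteq> \<Omega>" using assms by (auto simp: C1c_def)
  show 0: "u x = 0" if "x \<notin> ?K" for x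
    using that closure_subset[of "{x. u x \<noteq> 0}"] by auto
  show "gradient u x = 0" if "x \<notin> ?K" for x
  proof (rule gradient_eq)
    have "((\<lambda>x. 0) has_derivative (\<lambda>h. h \<bullet> (0::'a))) (at x)"
      by (simp add: has_derivative_const)
    then show "GDERIV u x :> 0"
      unfolding gderiv_def
    proof (rule has_derivative_transform_within_open[where s = "- ?K"])
      show "0 = u y" if "y \<in> - ?K" for y using 0[of y] that by simp
    qed (use that in auto)
  qed
qed

lemma
  fixes u :: "'a::euclidean_space \<Rightarrow> real"
  assumes D: "\<And>x. GDERIV u x :> D x" and "continuous_on UNIV D"
    and K: "compact K" "K \<subseteq> \<Omega>" "\<And>x. u x \<noteq> 0 \<Longrightarrow> x \<in> K"
  shows C1cI: "u \<in> C1c \<Omega>" and C1c_gradient_eq: "gradient u = D"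
proof -
  show eq: "gradient u = D"
    using D by (intro ext gradient_eq)
  have "closure {x. u x \<noteq> 0} \<subseteq> K"
    using K by (intro closure_minimal compact_imp_closed) auto
  moreover from this have "compact (closure {x. u x \<noteq> 0})"
    using K(1) by (metis closed_closure compact_Int_closed inf.absorb_iff2)
  moreover have "u differentiable at x" for x
    using D[of x] unfolding gderiv_def differentiable_def by blast
  ultimately show "u \<in> C1c \<Omega>"
    using K(2) assms(2) unfolding C1c_def by (auto simp: eq)
qed

lemma GDERIV_along_ray:
  assumes "GDERIV u (l *\<^sub>R x) :> D"
  shows "((\<lambda>l. u (l *\<^sub>R x)) has_real_derivative x \<bullet> D) (at l)"
proof -
  have "((\<lambda>l. u (l *\<^sub>R x)) has_derivative (\<lambda>h. (h *\<^sub>R x) \<bullet> D)) (at l)"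
    using assms unfolding gderiv_def
    by (intro has_derivative_compose[of "\<lambda>l. l *\<^sub>R x" "\<lambda>h. h *\<^sub>R x", where g = u]) (auto intro!: derivative_eq_intros)
  then show ?thesis
    by (simp add: has_field_derivative_def mult.commute[of "x \<bullet> D"] mult_commute_abs)
qed

lemma C1c_borel:
  assumes "u \<in> C1c \<Omega>"
  shows "u \<in> borel_measurable borel" "(\<lambda>x. gradient u x \<bullet> x) \<in> borel_measurable borel"
  using C1c_continuous[OF assms] C1c_continuous_gradient[OF assms]
  by (auto intro!: borel_measurable_continuous_onI continuous_intros)

context hardy_setup
begin

lemma hardy_lhs_eq:
  "hardy_lhs R p \<alpha> \<beta> \<gamma> u = lhs_integral u"
  unfolding hardy_lhs_def nn_integral_completion
  by (simp add: lhs_density_def s_def powr_minus divide_inverse)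

lemma hardy_rhs_eq:
  "hardy_rhs R p \<alpha> \<beta> \<gamma> G = rhs_integral (\<lambda>x. G x \<bullet> x)"
  unfolding hardy_rhs_def nn_integral_completion
proof (rule nn_integral_cong)
  fix x :: 'a
  have "\<bar>G x \<bullet> (x /\<^sub>R norm x)\<bar> powr p / (norm x powr (\<alpha> - p) * (1 - (norm x / R) powr \<gamma>) powr (\<beta> - p))
     = rhs_density (\<lambda>x. G x \<bullet> x) x"
  proof (cases "x = 0")
    case True
    then show ?thesis using p by (simp add: rhs_density_def)
  next
    case False
    then have "\<bar>G x \<bullet> (x /\<^sub>R norm x)\<bar> powr p = \<bar>G x \<bullet> x\<bar> powr p / norm x powr p"
      by (simp add: abs_mult powr_mult powr_divide divide_inverse inverse_powr)
    moreover have "norm x powr (\<alpha> - p) = norm x powr \<alpha> / norm x powr p"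
      using False by (simp add: powr_diff)
    moreover have "s (norm x) powr (p - \<beta>) = inverse (s (norm x) powr (\<beta> - p))"
      by (simp flip: powr_minus)
    ultimately show ?thesis
      using False by (simp add: rhs_density_def powr_minus s_def divide_inverse)
  qed
  then show "ennreal (\<bar>G x \<bullet> (x /\<^sub>R norm x)\<bar> powr p / (norm x powr (\<alpha> - p) * (1 - (norm x / R) powr \<gamma>) powr (\<beta> - p))) *
      indicator (ball 0 R) x = ennreal (rhs_density (\<lambda>x. G x \<bullet> x) x) * indicator (ball 0 R) x"
    by simp
qed

text \<open>
  The fundamental theorem of calculus along the ray, up to the sphere where \<open>u\<close> vanishes.
\<close>

lemma C1c_dominated:
  fixes u :: "'a::euclidean_space \<Rightarrow> real"
  assumes u: "u \<in> C1c (ball 0 R)" and x: "x \<noteq> 0" "norm x < R"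
  shows "ennreal \<bar>u x\<bar> \<le> ray (\<lambda>x. gradient u x \<bullet> x) x"
proof -
  define L where "L = R / norm x"
  have L: "1 \<le> L" using x by (simp add: L_def field_simps)
  obtain K where K: "K \<subseteq> ball 0 R" "\<And>x. x \<notin> K \<Longrightarrow> u x = 0"
    using C1c_support[OF u] by metis
  have "norm (L *\<^sub>R x) = R" using x R by (simp add: L_def)
  then have "L *\<^sub>R x \<notin> K" using K(1) by auto
  then have uL: "u (L *\<^sub>R x) = 0" by (rule K(2))
  let ?f = "\<lambda>l. x \<bullet> gradient u (l *\<^sub>R x)"
  have cont: "isCont ?f l" for l
  proof -
    have "continuous_on UNIV ?f"
      by (intro continuous_intros continuous_on_compose2[OF C1c_continuous_gradient[OF u]]) auto
    then show ?thesis by (simp add: continuous_on_eq_continuous_at)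
  qed
  have "(LINT l|lborel. ?f l * indicator {1..L} l) = u (L *\<^sub>R x) - u (1 *\<^sub>R x)"
    using cont L by (intro integral_FTC_Icc_real GDERIV_along_ray C1c_GDERIV[OF u])
  then have "\<bar>u x\<bar> = norm (LINT l|lborel. ?f l * indicator {1..L} l)"
    using uL by simp
  also have "ennreal \<dots> \<le> (\<integral>\<^sup>+l. norm (?f l * indicator {1..L} l) \<partial>lborel)"
    using borel_integrable_atLeastAtMost[of 1 L ?f] cont
    by (intro integral_norm_bound_ennreal) (simp add: indicator_times_eq_if mult.commute)
  also have "\<dots> = (\<integral>\<^sup>+l. norm (?f l * indicator {1<..L} l) \<partial>lborel)"
  proof (rule nn_integral_cong_AE)
    show "AE l in lborel. ennreal (norm (?f l * indicator {1..L} l)) = ennreal (norm (?f l * indicator {1<..L} l))"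
      using AE_lborel_singleton[of 1] by eventually_elim (auto split: split_indicator)
  qed
  also have "\<dots> \<le> ray (\<lambda>x. gradient u x \<bullet> x) x"
    unfolding ray_def by (intro nn_integral_mono) (auto simp: inner_commute abs_mult split: split_indicator)
  finally show ?thesis .
qed

lemma C1c_gradient_inner_0:
  assumes "u \<in> C1c (ball 0 R)" "R \<le> norm y"
  shows "gradient u y \<bullet> y = 0"
  using C1c_support[OF assms(1)] assms(2) by (metis inner_zero_left mem_ball_0 not_le subset_iff)

theorem Hardy_C1c:
  fixes u :: "'a::euclidean_space \<Rightarrow> real"
  assumes dim: "DIM('a) = dim" and u: "u \<in> C1c (ball 0 R)"
  shows "ennreal (c powr p) * hardy_lhs R p \<alpha> \<beta> \<gamma> u \<le> hardy_rhs R p \<alpha> \<beta> \<gamma> (gradient u)"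
  unfolding hardy_lhs_eq hardy_rhs_eq
proof (rule Hardy_of_domination[OF dim])
  show "AE x in lborel. norm x < R \<longrightarrow> ennreal \<bar>u x\<bar> \<le> ray (\<lambda>x. gradient u x \<bullet> x) x"
    using AE_lborel_singleton[of 0] by eventually_elim (use C1c_dominated[OF u] in auto)
qed (use C1c_borel[OF u] C1c_gradient_inner_0[OF u] in auto)

end

section \<open>A continuously differentiable cut-off\<close>

lemma pred_ball [measurable]: "Measurable.pred borel (\<lambda>x::'a::euclidean_space. x \<in> ball 0 r)"
  by simp

definition pos_sq :: "real \<Rightarrow> real" where "pos_sq y = (max 0 y)\<^sup>2"

lemma pos_sq_deriv: "(pos_sq has_real_derivative 2 * max 0 y) (at y)"
proof -
  consider "y < 0" | "y = 0" | "y > 0" by linarith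
  then show ?thesis
  proof cases
    case 1
    have "((\<lambda>_. 0) has_real_derivative 2 * max 0 y) (at y)" using 1 by simp
    then show ?thesis
      by (rule has_field_derivative_transform_within_open[where S = "{..<0}"]) (use 1 in \<open>auto simp: pos_sq_def\<close>)
  next
    case 2
    have "((\<lambda>h. pos_sq h / h) \<longlongrightarrow> 0) (at 0)"
    proof (rule Lim_null_comparison)
      show "\<forall>\<^sub>F h in at 0. norm (pos_sq h / h) \<le> \<bar>h\<bar>"
        by (rule always_eventually) (auto simp: pos_sq_def power2_eq_square max_def)
      show "((\<lambda>h::real. \<bar>h\<bar>) \<longlongrightarrow> 0) (at 0)"
        using tendsto_rabs_zero[OF tendsto_ident_at] by blast
    qed
    then show ?thesis using 2 by (simp add: has_field_derivative_iff pos_sq_def)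
  next
    case 3
    have "((\<lambda>y. y\<^sup>2) has_real_derivative 2 * max 0 y) (at y)"
      using 3 by (auto intro!: derivative_eq_intros)
    then show ?thesis
      by (rule has_field_derivative_transform_within_open[where S = "{0<..}"]) (use 3 in \<open>auto simp: pos_sq_def\<close>)
  qed
qed

text \<open>
  A continuously differentiable function that is 0 for \<open>v \<le> 0\<close> and 1 for \<open>v \<ge> 1\<close>.
\<close>

definition smooth_step :: "real \<Rightarrow> real" where "smooth_step v = pos_sq (1 - pos_sq (1 - v))"
definition smooth_step' :: "real \<Rightarrow> real" where
  "smooth_step' v = 4 * max 0 (1 - pos_sq (1 - v)) * max 0 (1 - v)"

lemma pos_sq_nonneg: "0 \<le> pos_sq y" by (simp add: pos_sq_def)

lemma smooth_step_deriv: "(smooth_step has_real_derivative smooth_step' v) (at v)"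
proof -
  have 1: "((\<lambda>v. 1 - pos_sq (1 - v)) has_real_derivative 0 - 2 * max 0 (1 - v) * (0 - 1)) (at v)"
    by (intro DERIV_diff DERIV_const DERIV_chain2[OF pos_sq_deriv] DERIV_ident)
  show ?thesis
    unfolding smooth_step_def[abs_def]
    using DERIV_chain2[OF pos_sq_deriv 1] by (simp add: smooth_step'_def mult_ac)
qed

lemma continuous_smooth_step: "continuous_on S smooth_step" and continuous_smooth_step': "continuous_on S smooth_step'"
  unfolding smooth_step_def[abs_def] smooth_step'_def[abs_def] pos_sq_def[abs_def]
  by (intro continuous_intros)+

lemma smooth_step_0: "v \<le> 0 \<Longrightarrow> smooth_step v = 0"
  using power_mono[of 1 "1 - v" 2] by (simp add: smooth_step_def pos_sq_def)

lemma smooth_step'_0: "v \<le> 0 \<Longrightarrow> smooth_step' v = 0"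
  using power_mono[of 1 "1 - v" 2] by (simp add: smooth_step'_def pos_sq_def)

lemma smooth_step_1: "1 \<le> v \<Longrightarrow> smooth_step v = 1" and smooth_step'_1: "1 \<le> v \<Longrightarrow> smooth_step' v = 0"
  by (simp_all add: smooth_step_def smooth_step'_def pos_sq_def)

lemma smooth_step_bounds: "0 \<le> smooth_step v" "smooth_step v \<le> 1"
proof -
  have "max 0 (1 - pos_sq (1 - v)) \<le> 1" using pos_sq_nonneg by simp
  then show "smooth_step v \<le> 1"
    unfolding smooth_step_def pos_sq_def[of "1 - pos_sq (1 - v)"] by (intro power_le_one) auto
qed (simp add: smooth_step_def pos_sq_nonneg)

lemma smooth_step'_bounds: "0 \<le> smooth_step' v" "smooth_step' v \<le> 4"
proof -
  show "0 \<le> smooth_step' v" by (simp add: smooth_step'_def)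
  show "smooth_step' v \<le> 4"
  proof (cases "v \<le> 0")
    case False
    then have "max 0 (1 - pos_sq (1 - v)) * max 0 (1 - v) \<le> 1 * 1"
      using pos_sq_nonneg[of "1 - v"] by (intro mult_mono) auto
    then show ?thesis by (simp add: smooth_step'_def)
  qed (simp add: smooth_step'_0)
qed

section \<open>Test functions\<close>

definition profile :: "real \<Rightarrow> real \<Rightarrow> real \<Rightarrow> real" where
  "profile k \<epsilon> w = w powr k * smooth_step (w / \<epsilon> - 1)"
definition profile' :: "real \<Rightarrow> real \<Rightarrow> real \<Rightarrow> real" where
  "profile' k \<epsilon> w = k * w powr (k - 1) * smooth_step (w / \<epsilon> - 1) + w powr k * (smooth_step' (w / \<epsilon> - 1) / \<epsilon>)"

context
  fixes k \<epsilon> :: real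
  assumes \<epsilon>: "\<epsilon> > 0" and k: "k > 0"
begin

lemma profile_0: "w \<le> \<epsilon> \<Longrightarrow> profile k \<epsilon> w = 0" and profile'_0: "w \<le> \<epsilon> \<Longrightarrow> profile' k \<epsilon> w = 0"
  using \<epsilon> by (auto simp: profile_def profile'_def smooth_step_0 smooth_step'_0)

lemma profile_deriv: "(profile k \<epsilon> has_real_derivative profile' k \<epsilon> w) (at w)"
proof (cases "w < \<epsilon>")
  case True
  have "((\<lambda>_. 0) has_real_derivative profile' k \<epsilon> w) (at w)" using True by (simp add: profile'_0)
  then show ?thesis
    by (rule has_field_derivative_transform_within_open[where S = "{..<\<epsilon>}"]) (use True in \<open>auto simp: profile_0\<close>)
next
  case False
  then have w: "w > 0" using \<epsilon> by simp
  have "((\<lambda>w. smooth_step (w / \<epsilon> - 1)) has_real_derivative smooth_step' (w / \<epsilon> - 1) * (1 / \<epsilon>)) (at w)"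
    using \<epsilon> by (intro DERIV_chain2[OF smooth_step_deriv]) (auto intro!: derivative_eq_intros)
  from DERIV_mult[OF has_real_derivative_powr[OF w, of k] this] show ?thesis
    unfolding profile_def[abs_def] profile'_def by (simp add: mult_ac add.commute)
qed

lemma continuous_profile': "continuous_on UNIV (profile' k \<epsilon>)"
proof -
  have "isCont (profile' k \<epsilon>) w" for w
  proof (cases "w < \<epsilon>")
    case True
    have "\<forall>\<^sub>F v in nhds w. profile' k \<epsilon> v = 0"
      using eventually_nhds_in_open[of "{..<\<epsilon>}" w] True by (auto elim!: eventually_mono simp: profile'_0)
    then show ?thesis by (subst isCont_cong[where g = "\<lambda>_. 0"]) auto
  next
    case False
    then have "continuous_on {0<..} (profile' k \<epsilon>)"
      unfolding profile'_def[abs_def] using \<epsilon>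
      by (intro continuous_intros continuous_on_compose2[OF continuous_smooth_step[of UNIV]]
          continuous_on_compose2[OF continuous_smooth_step'[of UNIV]]) auto
    then show ?thesis using False \<epsilon> by (simp add: continuous_on_eq_continuous_at)
  qed
  then show ?thesis by (simp add: continuous_on_eq_continuous_at)
qed

lemma profile_bounds:
  assumes "0 < w"
  shows "0 \<le> profile k \<epsilon> w" "profile k \<epsilon> w \<le> w powr k"
  using smooth_step_bounds by (auto simp: profile_def mult_left_le)

text \<open>
  On the cut-off region \<open>w / \<epsilon>\<close> is at most 2 and the derivative of the step at most 4, hence the 8.
\<close>

lemma profile'_bound:
  assumes "0 < w"
  shows "w * \<bar>profile' k \<epsilon> w\<bar> \<le> (k + 8) * w powr k"
proof -
  have "w * (smooth_step' (w / \<epsilon> - 1) / \<epsilon>) \<le> 8"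
  proof (cases "w / \<epsilon> - 1 \<le> 1")
    case True
    then have "w / \<epsilon> * smooth_step' (w / \<epsilon> - 1) \<le> 2 * 4"
      using \<epsilon> assms smooth_step'_bounds by (intro mult_mono) auto
    then show ?thesis by simp
  qed (simp add: smooth_step'_1)
  then have "w powr k * (w * (smooth_step' (w / \<epsilon> - 1) / \<epsilon>)) \<le> w powr k * 8"
    by (intro mult_left_mono) auto
  moreover have "k * w powr k * smooth_step (w / \<epsilon> - 1) \<le> k * w powr k * 1"
    using k smooth_step_bounds by (intro mult_left_mono) auto
  moreover have "w * profile' k \<epsilon> w = k * w powr k * smooth_step (w / \<epsilon> - 1) + w powr k * (w * (smooth_step' (w / \<epsilon> - 1) / \<epsilon>))"
    using assms by (simp add: profile'_def powr_diff field_simps)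
  moreover have "0 \<le> profile' k \<epsilon> w"
    using \<epsilon> k smooth_step_bounds smooth_step'_bounds by (simp add: profile'_def)
  ultimately show ?thesis by (simp add: algebra_simps)
qed

lemma profile_eq: "2 * \<epsilon> \<le> w \<Longrightarrow> profile k \<epsilon> w = w powr k"
  and profile'_eq: "2 * \<epsilon> \<le> w \<Longrightarrow> w * \<bar>profile' k \<epsilon> w\<bar> = k * w powr k"
proof -
  assume w: "2 * \<epsilon> \<le> w"
  then have "1 \<le> w / \<epsilon> - 1" using \<epsilon> by (simp add: field_simps)
  then show "profile k \<epsilon> w = w powr k" "w * \<bar>profile' k \<epsilon> w\<bar> = k * w powr k"
    using w \<epsilon> k by (auto simp: profile_def profile'_def smooth_step_1 smooth_step'_1 powr_diff abs_mult)
qed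

end

definition test_fun :: "real \<Rightarrow> real \<Rightarrow> real \<Rightarrow> 'a::euclidean_space \<Rightarrow> real" where
  "test_fun R k \<epsilon> x = profile k \<epsilon> (1 - (norm x / R)\<^sup>2)"

abbreviation (input) test_radial :: "real \<Rightarrow> real \<Rightarrow> real \<Rightarrow> 'a::euclidean_space \<Rightarrow> real" where
  "test_radial R k \<epsilon> \<equiv> \<lambda>x. gradient (test_fun R k \<epsilon>) x \<bullet> x"

lemma
  fixes R k \<epsilon> :: real
  assumes R: "R > 0" and \<epsilon>: "0 < \<epsilon>" and k: "k > 0"
  shows test_fun_C1c: "(test_fun R k \<epsilon> :: 'a::euclidean_space \<Rightarrow> real) \<in> C1c (ball 0 R)"
    and test_fun_gradient: "gradient (test_fun R k \<epsilon>) (x :: 'a) = profile' k \<epsilon> (1 - (norm x / R)\<^sup>2) *\<^sub>R (- (2 / R\<^sup>2)) *\<^sub>R x"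
proof -
  let ?u = "test_fun R k \<epsilon> :: 'a \<Rightarrow> real"
  let ?D = "\<lambda>x::'a. profile' k \<epsilon> (1 - (norm x / R)\<^sup>2) *\<^sub>R (- (2 / R\<^sup>2)) *\<^sub>R x"
  have W: "GDERIV (\<lambda>x::'a. 1 - (norm x / R)\<^sup>2) x :> (- (2 / R\<^sup>2)) *\<^sub>R x" for x
  proof -
    have "(\<lambda>x::'a. 1 - (norm x / R)\<^sup>2) = (\<lambda>x. 1 - 1 / R\<^sup>2 * (x \<bullet> x))"
      by (simp add: power_divide dot_square_norm)
    moreover have "((\<lambda>x. 1 - 1 / R\<^sup>2 * (x \<bullet> x)) has_derivative (\<lambda>h. 0 - 1 / R\<^sup>2 * (x \<bullet> h + h \<bullet> x))) (at x)"
      by (intro has_derivative_diff has_derivative_const has_derivative_mult_right has_derivative_inner has_derivative_ident)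
    moreover have "(\<lambda>h. 0 - 1 / R\<^sup>2 * (x \<bullet> h + h \<bullet> x)) = (\<lambda>h. h \<bullet> (- (2 / R\<^sup>2)) *\<^sub>R x)"
      by (simp add: inner_commute fun_eq_iff)
    ultimately show ?thesis
      unfolding gderiv_def by simp
  qed
  have D: "GDERIV ?u x :> ?D x" for x
    unfolding test_fun_def[abs_def] by (rule GDERIV_DERIV_compose[OF W profile_deriv[OF \<epsilon> k]])
  have cont: "continuous_on UNIV ?D"
    by (intro continuous_intros continuous_on_compose2[OF continuous_profile'[OF \<epsilon> k]]) (use R in auto)
  have sub: "cball 0 (R * sqrt (1 - \<epsilon>)) \<subseteq> (ball 0 R :: 'a set)"
  proof
    fix x :: 'a assume "x \<in> cball 0 (R * sqrt (1 - \<epsilon>))"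
    moreover have "R * sqrt (1 - \<epsilon>) < R * 1" using R \<epsilon> by (intro mult_strict_left_mono) auto
    ultimately show "x \<in> ball 0 R" by simp
  qed
  have supp: "x \<in> cball 0 (R * sqrt (1 - \<epsilon>))" if "?u x \<noteq> 0" for x
  proof -
    have "\<epsilon> < 1 - (norm x / R)\<^sup>2"
      using that profile_0[OF \<epsilon> k] by (force simp: test_fun_def not_le)
    then have "norm x / R \<le> sqrt (1 - \<epsilon>)" by (intro real_le_rsqrt) auto
    then show ?thesis using R by (simp add: field_simps)
  qed
  show "?u \<in> C1c (ball 0 R)" "gradient ?u x = ?D x"
    using C1cI[OF D cont compact_cball sub supp] C1c_gradient_eq[OF D cont compact_cball sub supp] by auto
qed

section \<open>Optimality\<close>

context hardy_setup
begin

lemma s_eq: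
  assumes "0 < r"
  shows "s r = 1 - ((r / R)\<^sup>2) powr (\<gamma> / 2)"
proof -
  have "((r / R)\<^sup>2) powr (\<gamma> / 2) = ((r / R) powr 2) powr (\<gamma> / 2)"
    using assms R by (simp add: powr_numeral)
  also have "\<dots> = (r / R) powr \<gamma>" by (simp add: powr_powr)
  finally show ?thesis by (simp add: s_def)
qed

text \<open>
  This is the reason for the choice \<open>W = 1 - (r / R)\<^sup>2\<close>: with \<open>X = (r / R)\<^sup>2\<close> and \<open>a = \<gamma> / 2\<close> it reads
  \<open>X (1 - X powr a) \<le> a (1 - X)\<close>, which is Bernoulli's inequality for the exponent \<open>1 + a\<close>. It is asymptotically
  an equality at the boundary, so that powers of \<open>W\<close> are as good as powers of \<open>s\<close>.
\<close>

lemma s_upper: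
  assumes "0 < r" "r < R"
  shows "2 * (r / R)\<^sup>2 * s r \<le> \<gamma> * (1 - (r / R)\<^sup>2)"
proof -
  let ?X = "(r / R)\<^sup>2"
  have X: "0 < ?X" using assms R by simp
  have "1 + (1 + \<gamma> / 2) * (?X - 1) \<le> ?X powr (1 + \<gamma> / 2)"
    using \<gamma> by (intro powr_Bernoulli) auto
  also have "\<dots> = ?X * ?X powr (\<gamma> / 2)"
    using X by (simp add: powr_add)
  finally show ?thesis
    unfolding s_eq[OF assms(1)] by (simp add: algebra_simps)
qed

lemma s_lower:
  assumes "0 < r" "r < R"
  shows "min 1 (\<gamma> / 2) * (1 - (r / R)\<^sup>2) \<le> s r"
proof -
  let ?X = "(r / R)\<^sup>2"
  have X: "0 < ?X" "?X < 1" using assms R by (auto simp: power_less_one_iff abs_square_less_1)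
  show ?thesis
  proof (cases "1 \<le> \<gamma> / 2")
    case True
    then have "?X powr (\<gamma> / 2) \<le> ?X powr 1"
      using X by (intro powr_mono') auto
    then show ?thesis using True X by (simp add: s_eq[OF assms(1)] min_def)
  next
    case False
    then have "1 + 1 / (\<gamma> / 2) * (?X powr (\<gamma> / 2) - 1) \<le> (?X powr (\<gamma> / 2)) powr (1 / (\<gamma> / 2))"
      using \<gamma> by (intro powr_Bernoulli) auto
    also have "\<dots> = ?X" using \<gamma> X by (simp add: powr_powr)
    finally have "\<gamma> / 2 * (1 - ?X) \<le> 1 - ?X powr (\<gamma> / 2)"
      using \<gamma> by (simp add: field_simps)
    then show ?thesis using False by (simp add: s_eq[OF assms(1)] min_def)
  qed
qed

text \<open>
  Instead of integrating the singularity at the origin directly, apply the Hardy inequality itself: on the small ball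
  the constant \<open>1/2\<close> is dominated along rays by the indicator function of an annulus, where the weight of the
  right-hand side is bounded.
\<close>

lemma weight_integrable_near_0:
  assumes dim: "DIM('a::euclidean_space) = dim"
  shows "(\<integral>\<^sup>+x\<in>ball (0::'a) (R / 4). ennreal (weight x) \<partial>lborel) < \<infinity>"
proof -
  define u :: "'a \<Rightarrow> real" where "u x = 1 / 2 * indicator (ball 0 (R / 4)) x" for x
  define g :: "'a \<Rightarrow> real" where "g x = indicator (ball 0 (R / 2) - ball 0 (R / 4)) x" for x
  have [measurable]: "u \<in> borel_measurable borel" "g \<in> borel_measurable borel"
  proof -
    have [measurable]: "indicat_real (ball 0 (R / 4)) \<in> borel_measurable (borel :: 'a measure)"
      "indicat_real (ball 0 (R / 2) - ball 0 (R / 4)) \<in> borel_measurable (borel :: 'a measure)"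
      by (auto intro!: borel_measurable_indicator)
    show "u \<in> borel_measurable borel" "g \<in> borel_measurable borel"
      unfolding u_def[abs_def] g_def[abs_def] by measurable
  qed
  have ray: "ennreal \<bar>u x\<bar> \<le> ray g x" if "x \<noteq> 0" for x
  proof (cases "norm x < R / 4")
    case True
    define L where "L = R / (4 * norm x)"
    have L: "1 < L" using True that by (simp add: L_def field_simps)
    have "ennreal \<bar>u x\<bar> = ennreal (1 / (2 * L)) * ennreal (2 * L - L)"
      using True L by (subst ennreal_mult[symmetric]) (auto simp: u_def)
    also have "\<dots> = (\<integral>\<^sup>+l. ennreal (1 / (2 * L)) * indicator {L..<2 * L} l \<partial>lborel)"
      using L by (subst nn_integral_cmult_indicator) auto
    also have "\<dots> \<le> ray g x"
      unfolding ray_def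
    proof (rule nn_integral_mono)
      fix l
      show "ennreal (1 / (2 * L)) * indicator {L..<2 * L} l \<le> ennreal (\<bar>g (l *\<^sub>R x)\<bar> / l) * indicator {1<..} l"
      proof (cases "L \<le> l \<and> l < 2 * L")
        case True
        then have "R / 4 \<le> l * norm x" "l * norm x < R / 2"
          using that by (auto simp: L_def field_simps)
        then have "g (l *\<^sub>R x) = 1" using True L by (auto simp: g_def)
        moreover have "1 / (2 * L) \<le> 1 / l" using True L by (intro divide_left_mono) auto
        ultimately show ?thesis using True L by (auto intro!: ennreal_leI)
      qed auto
    qed
    finally show ?thesis .
  qed (simp add: u_def)
  have "ennreal (c powr p) * lhs_integral u
      \<le> rhs_integral g"
  proof (rule Hardy_of_domination[OF dim])
    show "AE x in lborel. norm x < R \<longrightarrow> ennreal \<bar>u x\<bar> \<le> ray g x"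
      using AE_lborel_singleton[of 0] by eventually_elim (use ray in auto)
    show "g y = 0" if "R \<le> norm y" for y
      using that R by (simp add: g_def)
  qed simp_all
  also have "\<dots> \<le> (\<integral>\<^sup>+x. ennreal (((R / 4) powr (- \<alpha>) + (R / 2) powr (- \<alpha>)) * (s (R / 2) powr (p - \<beta>) + 1 powr (p - \<beta>)))
       * indicator (ball (0::'a) R) x \<partial>lborel)"
  proof (intro nn_integral_mono mult_right_mono ennreal_leI)
    fix x
    show "rhs_density g x \<le> ((R / 4) powr (- \<alpha>) + (R / 2) powr (- \<alpha>)) * (s (R / 2) powr (p - \<beta>) + 1 powr (p - \<beta>))"
    proof (cases "R / 4 \<le> norm x \<and> norm x < R / 2")
      case True
      have sR: "0 < s (R / 2)" using R by (intro s_pos) auto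
      have s_le: "s (R / 2) \<le> s (norm x)"
        unfolding s_def using True R \<gamma> by (auto intro!: powr_mono2 divide_right_mono)
      then show ?thesis
        using True R powr_le_sum[OF sR s_le s_le_1, of "p - \<beta>"] unfolding rhs_density_def
        by (auto simp: g_def intro!: mult_mono powr_le_sum)
    next
      case False
      then show ?thesis using p by (auto simp: rhs_density_def g_def)
    qed
  qed simp
  also have "\<dots> < \<infinity>"
    using emeasure_lborel_ball_finite[of "0::'a" R]
    by (subst nn_integral_cmult_indicator) (auto simp: ennreal_mult_eq_top_iff less_top[symmetric])
  finally have fin: "lhs_integral u < \<infinity>"
    using c_pos by (auto simp: ennreal_mult_less_top less_top[symmetric])
  have "ennreal ((1 / 2) powr p) * (\<integral>\<^sup>+x\<in>ball (0::'a) (R / 4). ennreal (weight x) \<partial>lborel)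
      = (\<integral>\<^sup>+x\<in>ball (0::'a) (R / 4). ennreal (lhs_density u x) \<partial>lborel)"
    by (subst nn_integral_cmult[symmetric])
       (auto intro!: nn_integral_cong simp: lhs_density_def u_def simp flip: ennreal_mult' split: split_indicator)
  also have "\<dots> \<le> lhs_integral u"
    using R by (intro nn_integral_mono) (auto split: split_indicator)
  finally have "ennreal ((1 / 2) powr p) * (\<integral>\<^sup>+x\<in>ball (0::'a) (R / 4). ennreal (weight x) \<partial>lborel) < \<infinity>"
    using fin by (rule order_le_less_trans)
  then show ?thesis
    by (auto simp: ennreal_mult_less_top less_top[symmetric])
qed


lemma emeasure_shell:
  assumes "0 \<le> h" "h \<le> 1"
  shows "emeasure lborel (cball (0::'a::euclidean_space) R - ball 0 (R * (1 - h)))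
    \<le> ennreal (unit_ball_vol (real DIM('a)) * R ^ DIM('a) * (real DIM('a) * h))"
proof -
  have sub: "ball (0::'a) (R * (1 - h)) \<subseteq> cball 0 R"
  proof
    fix x :: 'a assume "x \<in> ball 0 (R * (1 - h))"
    moreover have "R * (1 - h) \<le> R * 1" using assms R by (intro mult_left_mono) auto
    ultimately show "x \<in> cball 0 R" by simp
  qed
  have "emeasure lborel (cball (0::'a) R - ball 0 (R * (1 - h)))
      = emeasure lborel (cball (0::'a) R) - emeasure lborel (ball (0::'a) (R * (1 - h)))"
    using sub emeasure_lborel_ball_finite[of "0::'a" "R * (1 - h)"] by (intro emeasure_Diff) auto
  also have "\<dots> = ennreal (unit_ball_vol (real DIM('a)) * R ^ DIM('a) - unit_ball_vol (real DIM('a)) * (R * (1 - h)) ^ DIM('a))"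
    using assms R by (simp add: emeasure_cball emeasure_ball ennreal_minus)
  also have "\<dots> \<le> ennreal (unit_ball_vol (real DIM('a)) * R ^ DIM('a) * (real DIM('a) * h))"
  proof (rule ennreal_leI)
    have "1 - real DIM('a) * h \<le> (1 - h) ^ DIM('a)"
      using Bernoulli_inequality[of "- h" "DIM('a)"] assms by simp
    then have "unit_ball_vol (real DIM('a)) * R ^ DIM('a) * (1 - real DIM('a) * h) \<le> unit_ball_vol (real DIM('a)) * R ^ DIM('a) * (1 - h) ^ DIM('a)"
      using R by (intro mult_left_mono) auto
    then show "unit_ball_vol (real DIM('a)) * R ^ DIM('a) - unit_ball_vol (real DIM('a)) * (R * (1 - h)) ^ DIM('a)
        \<le> unit_ball_vol (real DIM('a)) * R ^ DIM('a) * (real DIM('a) * h)"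
      unfolding power_mult_distrib by (simp add: right_diff_distrib mult.assoc)
  qed
  finally show ?thesis .
qed

definition shell_const :: "real \<Rightarrow> real" where
  "shell_const k = (\<gamma> * (k + 8)) powr p * (((R / 4) powr (- \<alpha>) + R powr (- \<alpha>)) * min 1 (\<gamma> / 2) powr (- \<beta>))"

context
  fixes k \<epsilon> :: real
  assumes \<epsilon>: "0 < \<epsilon>" "\<epsilon> \<le> 1 / 4" and k: "k > q"
begin

abbreviation (input) W :: "'a::euclidean_space \<Rightarrow> real" where "W x \<equiv> 1 - (norm x / R)\<^sup>2"

lemma k_pos: "k > 0" using k q_pos by simp

lemma W_pos: "norm x < R \<Longrightarrow> 0 < W x" and W_le_1: "W x \<le> 1"
  using R by (auto simp: abs_square_less_1)

text \<open>
  Between \<open>R / 4\<close> and \<open>R\<close> the power of the radius is bounded by its values at the ends, and \<open>s\<close> is at least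
  a multiple of \<open>W\<close>.
\<close>

lemma shell_weight:
  fixes x :: "'a::euclidean_space"
  assumes x: "R / 4 \<le> norm x" "norm x < R"
  shows "weight x \<le> ((R / 4) powr (- \<alpha>) + R powr (- \<alpha>)) * (min 1 (\<gamma> / 2) powr (- \<beta>) * W x powr (- \<beta>))"
proof (intro mult_mono)
  have x0: "0 < norm x" using x R by linarith
  show "norm x powr (- \<alpha>) \<le> (R / 4) powr (- \<alpha>) + R powr (- \<alpha>)"
    using x R by (intro powr_le_sum) auto
  have "s (norm x) powr (- \<beta>) \<le> (min 1 (\<gamma> / 2) * W x) powr (- \<beta>)"
    using s_lower[OF x0 x(2)] W_pos[OF x(2)] \<gamma> \<beta> by (intro powr_mono2') auto
  also have "\<dots> = min 1 (\<gamma> / 2) powr (- \<beta>) * W x powr (- \<beta>)"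
    using W_pos[OF x(2)] \<gamma> by (intro powr_mult)
  finally show "s (norm x) powr (- \<beta>) \<le> min 1 (\<gamma> / 2) powr (- \<beta>) * W x powr (- \<beta>)" .
qed auto

lemma test_rhs_bound:
  fixes x :: "'a::euclidean_space"
  assumes x: "0 < norm x" "norm x < R"
  shows "rhs_density (test_radial R k \<epsilon>) x \<le> (\<gamma> * (W x * \<bar>profile' k \<epsilon> (W x)\<bar>)) powr p * weight x"
proof -
  let ?g = "test_radial R k \<epsilon> x"
  have s0: "0 < s (norm x)" using x by (intro s_pos) auto
  have g: "\<bar>?g\<bar> = 2 * (norm x / R)\<^sup>2 * \<bar>profile' k \<epsilon> (W x)\<bar>"
    by (simp add: test_fun_gradient[OF R \<epsilon>(1) k_pos] abs_mult dot_square_norm power_divide)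
  have "\<bar>?g\<bar> * s (norm x) = 2 * (norm x / R)\<^sup>2 * s (norm x) * \<bar>profile' k \<epsilon> (W x)\<bar>"
    unfolding g by (simp add: mult_ac)
  also have "\<dots> \<le> \<gamma> * W x * \<bar>profile' k \<epsilon> (W x)\<bar>"
    using s_upper[OF x] by (intro mult_right_mono) auto
  finally have "(\<bar>?g\<bar> * s (norm x)) powr p \<le> (\<gamma> * (W x * \<bar>profile' k \<epsilon> (W x)\<bar>)) powr p"
    using p s0 by (intro powr_mono2) (auto simp: mult.assoc)
  then have "(\<bar>?g\<bar> * s (norm x)) powr p * weight x \<le> (\<gamma> * (W x * \<bar>profile' k \<epsilon> (W x)\<bar>)) powr p * weight x"
    by (intro mult_right_mono) auto
  moreover have "s (norm x) powr (p - \<beta>) = s (norm x) powr p * s (norm x) powr (- \<beta>)"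
    by (simp flip: powr_add)
  ultimately show ?thesis
    using s0 by (simp add: rhs_density_def powr_mult mult_ac)
qed

text \<open>
  Outside the shell the pointwise estimate has the constant \<open>(\<gamma> k)\<^sup>p\<close>; inside the shell the
  right-hand side is of order \<open>W powr (p * (k - q) - 1)\<close>.
\<close>

lemma test_rhs_le:
  fixes x :: "'a::euclidean_space"
  assumes x: "0 < norm x" "norm x < R"
  shows "rhs_density (test_radial R k \<epsilon>) x \<le> (\<gamma> * k) powr p * lhs_density (test_fun R k \<epsilon>) x
     + shell_const k * ((2 * \<epsilon>) powr (p * (k - q)) / \<epsilon>) * indicator (cball 0 R - ball 0 (R * (1 - 2 * \<epsilon>))) x" (is "_ \<le> ?A + ?B")
proof -
  note W = W_pos[OF x(2)]
  have AB: "0 \<le> ?A" "0 \<le> ?B"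
    using \<epsilon> \<gamma> by (auto simp: lhs_density_def shell_const_def)
  consider "W x \<le> \<epsilon>" | "\<epsilon> < W x" "W x < 2 * \<epsilon>" | "2 * \<epsilon> \<le> W x" by linarith
  then show ?thesis
  proof cases
    case 1
    then have "profile' k \<epsilon> (W x) = 0" by (rule profile'_0[OF \<epsilon>(1) k_pos])
    then show ?thesis using test_rhs_bound[OF x] AB p by simp
  next
    case 2
    have X: "1 - 2 * \<epsilon> < (norm x / R)\<^sup>2" using 2 by simp
    have "(norm x / R)\<^sup>2 \<le> norm x / R"
      using x R mult_left_le[of "norm x / R" "norm x / R"] by (simp add: power2_eq_square)
    then have "1 - 2 * \<epsilon> < norm x / R"
      using X by linarith
    then have shell: "R * (1 - 2 * \<epsilon>) < norm x"
      using R by (simp add: field_simps)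
    have "1 - 2 * \<epsilon> \<ge> 1 / 4" using \<epsilon> by simp
    then have "R * (1 / 4) \<le> R * (1 - 2 * \<epsilon>)" using R by (intro mult_left_mono) auto
    then have x4: "R / 4 \<le> norm x" using shell by simp
    have ind: "indicator (cball 0 R - ball 0 (R * (1 - 2 * \<epsilon>))) x = (1::real)"
      using x shell by simp
    have "(\<gamma> * (W x * \<bar>profile' k \<epsilon> (W x)\<bar>)) powr p \<le> (\<gamma> * ((k + 8) * W x powr k)) powr p"
      using profile'_bound[OF \<epsilon>(1) k_pos W] \<gamma> W p by (intro powr_mono2 mult_left_mono) auto
    also have "\<dots> = (\<gamma> * (k + 8)) powr p * W x powr (p * k)"
      using \<gamma> k_pos W by (simp add: powr_mult powr_powr mult.commute)
    finally have 1: "(\<gamma> * (W x * \<bar>profile' k \<epsilon> (W x)\<bar>)) powr p \<le> (\<gamma> * (k + 8)) powr p * W x powr (p * k)" .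
    have "W x powr (p * k) * W x powr (- \<beta>) = W x powr (p * (k - q)) / W x"
    proof -
      have "p * k + - \<beta> = p * k + - (p * q + 1)" by (simp only: \<beta>_eq[symmetric])
      then have "p * k + - \<beta> = p * (k - q) - 1" by (simp add: algebra_simps)
      then show ?thesis using W by (simp add: powr_diff flip: powr_add)
    qed
    also have "\<dots> \<le> (2 * \<epsilon>) powr (p * (k - q)) / \<epsilon>"
      using 2 \<epsilon> W p k by (intro frac_le powr_mono2) auto
    finally have 2: "W x powr (p * k) * W x powr (- \<beta>) \<le> (2 * \<epsilon>) powr (p * (k - q)) / \<epsilon>" .
    have "rhs_density (test_radial R k \<epsilon>) x
       \<le> ((\<gamma> * (k + 8)) powr p * W x powr (p * k)) * (((R / 4) powr (- \<alpha>) + R powr (- \<alpha>)) * (min 1 (\<gamma> / 2) powr (- \<beta>) * W x powr (- \<beta>)))"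
      by (rule order_trans[OF test_rhs_bound[OF x] mult_mono[OF 1 shell_weight[OF x4 x(2)]]]) auto
    also have "\<dots> = shell_const k * (W x powr (p * k) * W x powr (- \<beta>))"
      by (simp add: shell_const_def mult_ac)
    also have "\<dots> \<le> shell_const k * ((2 * \<epsilon>) powr (p * (k - q)) / \<epsilon>)"
      using 2 by (intro mult_left_mono) (auto simp: shell_const_def)
    finally show ?thesis using AB ind by simp
  next
    case 3
    have "(\<gamma> * (W x * \<bar>profile' k \<epsilon> (W x)\<bar>)) powr p = (\<gamma> * k) powr p * \<bar>test_fun R k \<epsilon> x\<bar> powr p"
      unfolding profile'_eq[OF \<epsilon>(1) k_pos 3] test_fun_def profile_eq[OF \<epsilon>(1) k_pos 3]
      using \<gamma> k_pos by (simp add: powr_mult mult.assoc[symmetric])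
    then have "rhs_density (test_radial R k \<epsilon>) x \<le> ?A"
      using test_rhs_bound[OF x] by (simp add: lhs_density_def mult.assoc)
    then show ?thesis using AB by linarith
  qed
qed

lemma test_lhs_finite:
  assumes dim: "DIM('a::euclidean_space) = dim"
  shows "lhs_integral (test_fun R k \<epsilon> :: 'a \<Rightarrow> real) < \<infinity>"
proof -
  define B where "B = ((R / 4) powr (- \<alpha>) + R powr (- \<alpha>)) * (min 1 (\<gamma> / 2) powr (- \<beta>) * \<epsilon> powr (- \<beta>))"
  have "lhs_integral (test_fun R k \<epsilon> :: 'a \<Rightarrow> real)
      \<le> (\<integral>\<^sup>+x. (ennreal (weight x) * indicator (ball (0::'a) (R / 4)) x + ennreal B * indicator (ball 0 R) x) \<partial>lborel)"
  proof (rule nn_integral_mono)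
    fix x :: 'a
    show "ennreal (lhs_density (test_fun R k \<epsilon>) x) * indicator (ball 0 R) x \<le>
        ennreal (weight x) * indicator (ball (0::'a) (R / 4)) x + ennreal B * indicator (ball 0 R) x"
    proof (cases "norm x < R")
      case True
      note W = W_pos[OF True]
      have "W x powr k \<le> 1 powr k"
        using W k_pos W_le_1[of x] by (intro powr_mono2) auto
      then have "\<bar>test_fun R k \<epsilon> x\<bar> \<le> 1"
        using profile_bounds[OF \<epsilon>(1) k_pos W] by (simp add: test_fun_def)
      then have "\<bar>test_fun R k \<epsilon> x\<bar> powr p \<le> 1 powr p"
        using p by (intro powr_mono2) auto
      then have "lhs_density (test_fun R k \<epsilon>) x \<le> 1 * weight x"
        unfolding lhs_density_def by (intro mult_right_mono) auto
      then have le: "lhs_density (test_fun R k \<epsilon>) x \<le> weight x" by simp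
      show ?thesis
      proof (cases "norm x < R / 4")
        case True
        then show ?thesis using le R by (simp add: ennreal_leI add_increasing2)
      next
        case False
        have "lhs_density (test_fun R k \<epsilon>) x \<le> B"
        proof (cases "W x \<le> \<epsilon>")
          case True
          then show ?thesis
            using p profile_0[OF \<epsilon>(1) k_pos True] by (simp add: lhs_density_def test_fun_def B_def)
        next
          case W\<epsilon>: False
          have "weight x \<le> ((R / 4) powr (- \<alpha>) + R powr (- \<alpha>)) * (min 1 (\<gamma> / 2) powr (- \<beta>) * W x powr (- \<beta>))"
            using False \<open>norm x < R\<close> by (intro shell_weight) auto
          also have "\<dots> \<le> B"
            unfolding B_def using W\<epsilon> \<epsilon> \<beta> by (intro mult_left_mono powr_mono2') auto
          finally show ?thesis using le by simp
        qed
        then show ?thesis using False True by (simp add: ennreal_leI)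
      qed
    qed simp
  qed
  also have "\<dots> = (\<integral>\<^sup>+x\<in>ball (0::'a) (R / 4). ennreal (weight x) \<partial>lborel) + ennreal B * emeasure lborel (ball (0::'a) R)"
  proof -
    have "(\<integral>\<^sup>+x. (ennreal (weight x) * indicator (ball (0::'a) (R / 4)) x + ennreal B * indicator (ball 0 R) x) \<partial>lborel)
      = (\<integral>\<^sup>+x\<in>ball (0::'a) (R / 4). ennreal (weight x) \<partial>lborel) + (\<integral>\<^sup>+x. ennreal B * indicator (ball (0::'a) R) x \<partial>lborel)"
      by (rule nn_integral_add) measurable
    then show ?thesis by (simp add: nn_integral_cmult_indicator)
  qed
  also have "\<dots> < \<infinity>"
    using weight_integrable_near_0[OF dim] emeasure_lborel_ball_finite[of "0::'a" R]
    by (auto simp: ennreal_mult_eq_top_iff less_top[symmetric])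
  finally show ?thesis .
qed

lemma test_lhs_ge:
  "(\<integral>\<^sup>+x\<in>ball (0::'a::euclidean_space) (R / 2). ennreal (W x powr (p * k) * weight x) \<partial>lborel)
     \<le> lhs_integral (test_fun R k \<epsilon> :: 'a \<Rightarrow> real)"
proof (rule nn_integral_mono)
  fix x :: 'a
  show "ennreal (W x powr (p * k) * weight x) * indicator (ball 0 (R / 2)) x
      \<le> ennreal (lhs_density (test_fun R k \<epsilon>) x) * indicator (ball 0 R) x"
  proof (cases "norm x < R / 2")
    case True
    then have "(norm x / R)\<^sup>2 \<le> (1 / 2)\<^sup>2"
      using R by (intro power_mono) (auto simp: field_simps)
    then have W: "2 * \<epsilon> \<le> W x" using \<epsilon> by (simp add: power2_eq_square)
    have "lhs_density (test_fun R k \<epsilon>) x = W x powr (p * k) * weight x"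
      unfolding lhs_density_def test_fun_def profile_eq[OF \<epsilon>(1) k_pos W] by (simp add: powr_powr mult.commute)
    then show ?thesis using True R by simp
  qed simp
qed

text \<open>
  The shell has volume of order \<open>\<epsilon>\<close>, so that the error is of order \<open>\<epsilon> powr (p * (k - q))\<close>.
\<close>

lemma test_rhs_integral_le:
  "rhs_integral (test_radial R k \<epsilon> :: 'a::euclidean_space \<Rightarrow> real)
    \<le> ennreal ((\<gamma> * k) powr p) * lhs_integral (test_fun R k \<epsilon> :: 'a \<Rightarrow> real)
      + ennreal (shell_const k * (unit_ball_vol (real DIM('a)) * R ^ DIM('a) * real DIM('a) * 2) * (2 * \<epsilon>) powr (p * (k - q)))"
proof -
  let ?S = "cball 0 R - ball 0 (R * (1 - 2 * \<epsilon>)) :: 'a set"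
  let ?K = "shell_const k * ((2 * \<epsilon>) powr (p * (k - q)) / \<epsilon>)"
  have K: "0 \<le> ?K" using \<epsilon> by (simp add: shell_const_def)
  have [measurable]: "test_fun R k \<epsilon> \<in> borel_measurable (borel :: 'a measure)"
    by (rule C1c_borel(1)[OF test_fun_C1c[OF R \<epsilon>(1) k_pos]])
  have [measurable]: "lhs_density (test_fun R k \<epsilon>) \<in> borel_measurable (borel :: 'a measure)"
    unfolding lhs_density_def[abs_def] by measurable
  have "rhs_integral (test_radial R k \<epsilon> :: 'a \<Rightarrow> real)
     \<le> (\<integral>\<^sup>+x. (ennreal ((\<gamma> * k) powr p) * (ennreal (lhs_density (test_fun R k \<epsilon>) x) * indicator (ball (0::'a) R) x) + ennreal ?K * indicator ?S x) \<partial>lborel)"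
  proof (rule nn_integral_mono_AE)
    show "AE x in lborel. ennreal (rhs_density (test_radial R k \<epsilon>) x) * indicator (ball (0::'a) R) x
       \<le> ennreal ((\<gamma> * k) powr p) * (ennreal (lhs_density (test_fun R k \<epsilon>) x) * indicator (ball (0::'a) R) x) + ennreal ?K * indicator ?S x"
      using AE_lborel_singleton[of 0]
    proof eventually_elim
      case (elim x)
      show ?case
      proof (cases "norm x < R")
        case True
        have "ennreal (rhs_density (test_radial R k \<epsilon>) x)
          \<le> ennreal ((\<gamma> * k) powr p * lhs_density (test_fun R k \<epsilon>) x + ?K * indicator ?S x)"
          using elim True by (intro ennreal_leI test_rhs_le) auto
        also have "\<dots> = ennreal ((\<gamma> * k) powr p) * ennreal (lhs_density (test_fun R k \<epsilon>) x) + ennreal ?K * indicator ?S x"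
          using K by (subst ennreal_plus) (auto simp: ennreal_mult' lhs_density_def split: split_indicator)
        finally show ?thesis using True by simp
      qed simp
    qed
  qed
  also have "\<dots> = ennreal ((\<gamma> * k) powr p) * lhs_integral (test_fun R k \<epsilon> :: 'a \<Rightarrow> real)
      + ennreal ?K * emeasure lborel ?S"
  proof -
    have [measurable]: "Measurable.pred borel (\<lambda>x. x \<in> ?S)"
      by simp
    have "(\<integral>\<^sup>+x. (ennreal ((\<gamma> * k) powr p) * (ennreal (lhs_density (test_fun R k \<epsilon>) x) * indicator (ball (0::'a) R) x) + ennreal ?K * indicator ?S x) \<partial>lborel)
      = (\<integral>\<^sup>+x. ennreal ((\<gamma> * k) powr p) * (ennreal (lhs_density (test_fun R k \<epsilon>) x) * indicator (ball (0::'a) R) x) \<partial>lborel)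
        + (\<integral>\<^sup>+x. ennreal ?K * indicator ?S x \<partial>lborel)"
      by (rule nn_integral_add) measurable
    moreover have "(\<integral>\<^sup>+x. ennreal ((\<gamma> * k) powr p) * (ennreal (lhs_density (test_fun R k \<epsilon>) x) * indicator (ball (0::'a) R) x) \<partial>lborel)
      = ennreal ((\<gamma> * k) powr p) * lhs_integral (test_fun R k \<epsilon> :: 'a \<Rightarrow> real)"
      by (rule nn_integral_cmult) measurable
    ultimately show ?thesis by (simp add: nn_integral_cmult_indicator)
  qed
  also have "ennreal ?K * emeasure lborel ?S \<le> ennreal ?K * ennreal (unit_ball_vol (real DIM('a)) * R ^ DIM('a) * (real DIM('a) * (2 * \<epsilon>)))"
    using \<epsilon> by (intro mult_left_mono emeasure_shell) auto
  also have "\<dots> = ennreal (shell_const k * (unit_ball_vol (real DIM('a)) * R ^ DIM('a) * real DIM('a) * 2) * (2 * \<epsilon>) powr (p * (k - q)))"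
    using K \<epsilon> by (subst ennreal_mult'[symmetric]) (auto simp: mult_ac)
  finally show ?thesis by (simp add: add_left_mono)
qed

end

text \<open>
  The exponent \<open>k\<close> is chosen so that \<open>(\<gamma> k)\<^sup>p\<close> lies halfway between the sharp constant and \<open>C'\<close>. A valid
  inequality with \<open>C'\<close> would bound a fixed positive part of the left-hand side by an error that tends to 0.
\<close>

theorem Hardy_constant_optimal:
  assumes dim: "DIM('a::euclidean_space) = dim" and C': "C' > c powr p"
  shows "\<exists>u \<in> C1c (ball (0::'a) R). \<not> ennreal C' * hardy_lhs R p \<alpha> \<beta> \<gamma> u \<le> hardy_rhs R p \<alpha> \<beta> \<gamma> (gradient u)"
proof (rule ccontr)
  assume "\<not> ?thesis"
  then have H: "ennreal C' * hardy_lhs R p \<alpha> \<beta> \<gamma> u \<le> hardy_rhs R p \<alpha> \<beta> \<gamma> (gradient u)" if "u \<in> C1c (ball (0::'a) R)" for u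
    using that by blast
  define C'' where "C'' = (c powr p + C') / 2"
  have C'': "c powr p < C''" "C'' < C'" "0 < C''"
  proof -
    have "0 < c powr p" using c_pos by simp
    then have "0 < C'" using C' by (rule order_less_trans)
    with \<open>0 < c powr p\<close> have "0 < C''" unfolding C''_def by (intro divide_pos_pos add_pos_pos) auto
    then show "c powr p < C''" "C'' < C'" "0 < C''" using C' by (auto simp: C''_def)
  qed
  define k where "k = C'' powr (1 / p) / \<gamma>"
  have kC: "(\<gamma> * k) powr p = C''"
    using p \<gamma> C'' by (simp add: k_def powr_powr)
  have "c = (c powr p) powr (1 / p)" using p c_pos by (simp add: powr_powr)
  also have "\<dots> < C'' powr (1 / p)" using C'' p by (intro powr_less_mono2) auto
  finally have k: "q < k" using \<gamma> by (simp add: k_def c_def field_simps)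
  let ?w = "\<lambda>x::'a. (1 - (norm x / R)\<^sup>2) powr (p * k) * weight x"
  let ?L0 = "\<integral>\<^sup>+x\<in>ball (0::'a) (R / 2). ennreal (?w x) \<partial>lborel"
  have "?L0 \<noteq> 0"
  proof
    assume "?L0 = 0"
    then have "AE x in lborel. ennreal (?w x) * indicator (ball (0::'a) (R / 2)) x = 0"
      by (subst (asm) nn_integral_0_iff_AE) auto
    then have "AE x in lborel. x \<notin> ball (0::'a) (R / 2)"
      using AE_lborel_singleton[of 0]
    proof eventually_elim
      case (elim x)
      show ?case
      proof
        assume x: "x \<in> ball 0 (R / 2)"
        then have "norm x < R" using R by simp
        then have "0 < 1 - (norm x / R)\<^sup>2"
          using R by (simp add: abs_square_less_1)
        then have "0 < (1 - (norm x / R)\<^sup>2) powr (p * k)"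
          by simp
        moreover have "0 < s (norm x)"
          using \<open>norm x < R\<close> by (intro s_pos) auto
        ultimately have "0 < ?w x"
          using elim(2) by (intro mult_pos_pos) auto
        moreover have "?w x \<le> 0"
          using elim(1) x by (simp only: indicator_simps mult_1_right ennreal_eq_0_iff)
        ultimately show False by linarith
      qed
    qed
    then have "emeasure lborel (ball (0::'a) (R / 2)) = 0"
      by (subst (asm) AE_iff_measurable[of "ball 0 (R / 2)"]) auto
    then show False using R unit_ball_vol_pos[of "real DIM('a)"] by (simp add: emeasure_ball)
  qed
  moreover have "?L0 < \<infinity>"
  proof -
    have quarter: "0 < 1 / (4::real)" "1 / (4::real) \<le> 1 / 4" by simp_all
    show ?thesis
      by (rule order_le_less_trans[OF test_lhs_ge[OF quarter k] test_lhs_finite[OF quarter k dim]])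
  qed
  ultimately obtain L0 where L0: "0 < L0" "?L0 = ennreal L0"
    by (cases ?L0 rule: ennreal_cases) (auto simp: less_le)
  define K where "K = shell_const k * (unit_ball_vol (real DIM('a)) * R ^ DIM('a) * real DIM('a) * 2)"
  have K: "0 \<le> K" using R by (auto simp: K_def shell_const_def)
  have small: "(C' - C'') * L0 \<le> K * (2 * \<epsilon>) powr (p * (k - q))" if \<epsilon>: "0 < \<epsilon>" "\<epsilon> \<le> 1 / 4" for \<epsilon>
  proof -
    let ?u = "test_fun R k \<epsilon> :: 'a \<Rightarrow> real"
    let ?L = "\<integral>\<^sup>+x\<in>ball (0::'a) R. ennreal (lhs_density ?u x) \<partial>lborel"
    have "k > 0" using k q_pos by simp
    have "ennreal C' * ?L \<le> ennreal C'' * ?L + ennreal (K * (2 * \<epsilon>) powr (p * (k - q)))"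
      using order_trans[OF H[OF test_fun_C1c[OF R \<epsilon>(1) \<open>k > 0\<close>], unfolded hardy_lhs_eq hardy_rhs_eq] test_rhs_integral_le[OF \<epsilon> k]]
      unfolding kC K_def .
    moreover obtain L where L: "?L = ennreal L" "0 \<le> L"
      using test_lhs_finite[OF \<epsilon> k dim] by (cases ?L rule: ennreal_cases) auto
    ultimately have "C' * L \<le> C'' * L + K * (2 * \<epsilon>) powr (p * (k - q))"
      using C'' K by (simp flip: ennreal_mult' ennreal_plus)
    moreover have "L0 \<le> L"
      using test_lhs_ge[OF \<epsilon> k, where 'a = 'a] L L0 by simp
    then have "(C' - C'') * L0 \<le> (C' - C'') * L"
      using C'' by (intro mult_left_mono) auto
    ultimately show ?thesis by (simp add: algebra_simps)
  qed
  have "((\<lambda>\<epsilon>. K * (2 * \<epsilon>) powr (p * (k - q))) \<longlongrightarrow> K * (2 * 0) powr (p * (k - q))) (at_right 0)"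
    using p k by (intro tendsto_intros) (auto simp: eventually_at_right_less intro!: eventually_mono[OF eventually_at_right_less])
  then have "((\<lambda>\<epsilon>. K * (2 * \<epsilon>) powr (p * (k - q))) \<longlongrightarrow> 0) (at_right 0)"
    by simp
  moreover have "\<forall>\<^sub>F \<epsilon> in at_right 0. (C' - C'') * L0 \<le> K * (2 * \<epsilon>) powr (p * (k - q))"
    using eventually_at_right_real[of 0 "1 / 4"] by (auto elim!: eventually_mono intro!: small)
  ultimately have "(C' - C'') * L0 \<le> 0"
    by (rule tendsto_lowerbound) auto
  then show False using C'' L0 by (simp add: mult_le_0_iff)
qed

end

section \<open>The fundamental lemma of the calculus of variations\<close>

definition C1 :: "('a::euclidean_space \<Rightarrow> real) \<Rightarrow> bool" where
  "C1 f \<longleftrightarrow> (\<exists>D. (\<forall>x. GDERIV f x :> D x) \<and> continuous_on UNIV D)"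

lemma C1I: "(\<And>x. GDERIV f x :> D x) \<Longrightarrow> continuous_on UNIV D \<Longrightarrow> C1 f"
  unfolding C1_def by auto

lemma C1_continuous: "C1 f \<Longrightarrow> continuous_on UNIV f"
  unfolding C1_def gderiv_def continuous_on_eq_continuous_at[OF open_UNIV]
  by (auto intro: has_derivative_continuous)

lemma C1_mult:
  assumes "C1 f" "C1 g" shows "C1 (\<lambda>x. f x * g x)"
proof -
  obtain D E where D: "\<And>x. GDERIV f x :> D x" "continuous_on UNIV D"
    and E: "\<And>x. GDERIV g x :> E x" "continuous_on UNIV E"
    using assms by (auto simp: C1_def)
  have "GDERIV (\<lambda>x. f x * g x) x :> f x *\<^sub>R E x + g x *\<^sub>R D x" for x
    by (rule GDERIV_mult[OF D(1) E(1)])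
  moreover have "continuous_on UNIV (\<lambda>x. f x *\<^sub>R E x + g x *\<^sub>R D x)"
    using C1_continuous[OF assms(1)] C1_continuous[OF assms(2)] D(2) E(2) by (intro continuous_intros)
  ultimately show ?thesis by (rule C1I)
qed

lemma C1_prod:
  assumes "finite I" "\<And>i. i \<in> I \<Longrightarrow> C1 (f i)"
  shows "C1 (\<lambda>x. \<Prod>i\<in>I. f i x)"
  using assms
proof (induction I rule: finite_induct)
  case empty
  have "GDERIV (\<lambda>x. 1 :: real) x :> 0" for x :: 'b
    by (rule GDERIV_const)
  then show ?case by (auto simp: C1_def intro!: exI[of _ "\<lambda>_. 0"])
next
  case (insert i I)
  then show ?case by (simp add: C1_mult)
qed

lemma C1_smooth_step: "C1 (\<lambda>x::'a::euclidean_space. smooth_step (m * (x \<bullet> b) + d))"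
proof -
  have 1: "GDERIV (\<lambda>x. m * (x \<bullet> b) + d) x :> m *\<^sub>R b" for x
  proof -
    have "((\<lambda>x. m * (x \<bullet> b) + d) has_derivative (\<lambda>h. m * (h \<bullet> b) + 0)) (at x)"
      by (intro has_derivative_add has_derivative_mult_right has_derivative_inner_left has_derivative_ident has_derivative_const)
    then show ?thesis by (simp add: gderiv_def)
  qed
  have "GDERIV (\<lambda>x. smooth_step (m * (x \<bullet> b) + d)) x :> smooth_step' (m * (x \<bullet> b) + d) *\<^sub>R m *\<^sub>R b" for x
    by (rule GDERIV_DERIV_compose[OF 1 smooth_step_deriv])
  moreover have "continuous_on UNIV (\<lambda>x. smooth_step' (m * (x \<bullet> b) + d) *\<^sub>R m *\<^sub>R b)"
    by (intro continuous_intros continuous_on_compose2[OF continuous_smooth_step'[of UNIV]]) auto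
  ultimately show ?thesis by (rule C1I)
qed

definition bump :: "'a::euclidean_space \<Rightarrow> 'a \<Rightarrow> nat \<Rightarrow> 'a \<Rightarrow> real" where
  "bump a b n x = (\<Prod>i\<in>Basis. smooth_step (real n * (x \<bullet> i - a \<bullet> i)) * smooth_step (real n * (b \<bullet> i - x \<bullet> i)))"

lemma bump_nonzero: "bump a b n x \<noteq> 0 \<Longrightarrow> x \<in> box a b"
proof -
  assume "bump a b n x \<noteq> 0"
  then have "\<forall>i\<in>Basis. smooth_step (real n * (x \<bullet> i - a \<bullet> i)) \<noteq> 0 \<and> smooth_step (real n * (b \<bullet> i - x \<bullet> i)) \<noteq> 0"
    by (auto simp: bump_def)
  then have "\<forall>i\<in>Basis. 0 < real n * (x \<bullet> i - a \<bullet> i) \<and> 0 < real n * (b \<bullet> i - x \<bullet> i)"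
    using smooth_step_0 by (meson not_le)
  then show "x \<in> box a b"
    by (auto simp: mem_box zero_less_mult_iff)
qed

lemma bump_bounds: "0 \<le> bump a b n x" "bump a b n x \<le> 1"
  unfolding bump_def using smooth_step_bounds
  by (auto intro!: prod_nonneg prod_le_1 mult_le_one)

lemma bump_C1c:
  assumes "cbox a b \<subseteq> \<Omega>"
  shows "bump a b n \<in> C1c \<Omega>"
proof -
  have "C1 (\<lambda>x. smooth_step (real n * (x \<bullet> i - a \<bullet> i)) * smooth_step (real n * (b \<bullet> i - x \<bullet> i)))" for i
    using C1_mult[OF C1_smooth_step[of "real n" i "- (real n * (a \<bullet> i))"] C1_smooth_step[of "- real n" i "real n * (b \<bullet> i)"]]
    by (simp add: algebra_simps)
  then have "C1 (bump a b n)"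
    unfolding bump_def[abs_def] by (intro C1_prod) auto
  then obtain D where "\<And>x. GDERIV (bump a b n) x :> D x" "continuous_on UNIV D"
    by (auto simp: C1_def)
  then show ?thesis
    by (rule C1cI[OF _ _ compact_cbox assms]) (use bump_nonzero box_subset_cbox in blast)
qed

lemma bump_tendsto: "(\<lambda>n. bump a b n x) \<longlonglongrightarrow> indicator (box a b) x"
proof (cases "x \<in> box a b")
  case True
  have "(\<lambda>n. smooth_step (real n * d)) \<longlonglongrightarrow> 1" if "0 < d" for d
  proof (rule tendsto_eventually)
    have "\<forall>\<^sub>F n in sequentially. 1 / d \<le> real n"
      using eventually_ge_at_top[of "nat \<lceil>1 / d\<rceil>"] by eventually_elim linarith
    then show "\<forall>\<^sub>F n in sequentially. smooth_step (real n * d) = 1"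
      by eventually_elim (use that in \<open>auto intro!: smooth_step_1 simp: field_simps\<close>)
  qed
  then have "(\<lambda>n. bump a b n x) \<longlonglongrightarrow> (\<Prod>i\<in>(Basis :: 'a set). 1 * 1)"
    unfolding bump_def using True by (intro tendsto_prod tendsto_mult) (auto simp: mem_box)
  then show ?thesis using True by simp
next
  case False
  then have "bump a b n x = 0" for n using bump_nonzero by blast
  then show ?thesis using False by simp
qed

text \<open>
  Bumps converging to the indicator function of a box show that the integral of \<open>h\<close> over
  every box in \<open>\<Omega>\<close> vanishes, and almost every point is a Lebesgue point.
\<close>

lemma AE_zero_if_C1c_integrals_zero:
  fixes h :: "'a::euclidean_space \<Rightarrow> real"
  assumes "open \<Omega>" and [measurable]: "h \<in> borel_measurable borel"
    and loc: "\<And>K. compact K \<Longrightarrow> K \<subseteq> \<Omega> \<Longrightarrow> integrable lborel (\<lambda>x. indicator K x * h x)"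
    and zero: "\<And>\<phi>. \<phi> \<in> C1c \<Omega> \<Longrightarrow> (LINT x|lborel. h x * \<phi> x) = 0"
  shows "AE x in lborel. x \<in> \<Omega> \<longrightarrow> h x = 0"
proof -
  have box0: "integral (cbox a b) h = 0" if sub: "cbox a b \<subseteq> \<Omega>" for a b
  proof -
    have int: "integrable lborel (\<lambda>x. indicator (cbox a b) x * h x)"
      using sub by (intro loc) auto
    have "(\<lambda>n. LINT x|lborel. h x * bump a b n x) \<longlonglongrightarrow> (LINT x|lborel. h x * indicator (box a b) x)"
    proof (rule integral_dominated_convergence)
      show "integrable lborel (\<lambda>x. \<bar>indicator (cbox a b) x * h x\<bar>)" using int by simp
      show "(\<lambda>x. h x * bump a b n x) \<in> borel_measurable lborel" for n
        using C1c_borel(1)[OF bump_C1c[OF sub]] by measurable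
      show "AE x in lborel. (\<lambda>n. h x * bump a b n x) \<longlonglongrightarrow> h x * indicator (box a b) x"
        by (intro AE_I2 tendsto_mult tendsto_const bump_tendsto)
      show "AE x in lborel. norm (h x * bump a b n x) \<le> \<bar>indicator (cbox a b) x * h x\<bar>" for n
      proof (intro AE_I2)
        fix x
        show "norm (h x * bump a b n x) \<le> \<bar>indicator (cbox a b) x * h x\<bar>"
        proof (cases "bump a b n x = 0")
          case False
          then have "x \<in> cbox a b" using bump_nonzero box_subset_cbox by blast
          then show ?thesis using bump_bounds[of a b n x] by (simp add: abs_mult mult_left_le)
        qed simp
      qed
    qed measurable
    then have "(LINT x|lborel. h x * indicator (box a b) x) = 0"
      unfolding zero[OF bump_C1c[OF sub]] by (simp add: LIMSEQ_const_iff)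
    moreover have int': "integrable lborel (\<lambda>x. h x * indicator (box a b) x)"
    proof (rule Bochner_Integration.integrable_bound[OF int])
      show "AE x in lborel. norm (h x * indicator (box a b) x) \<le> norm (indicator (cbox a b) x * h x)"
        using box_subset_cbox by (intro AE_I2) (auto split: split_indicator)
    qed measurable
    ultimately have "integral UNIV (\<lambda>x. h x * indicator (box a b) x) = 0"
      using integral_lborel[OF int'] by simp
    moreover have "(\<lambda>x. h x * indicator (box a b) x) = (\<lambda>x. if x \<in> box a b then h x else 0)"
      by auto
    ultimately have "integral (box a b) h = 0"
      by (simp only: integral_restrict_UNIV)
    then show ?thesis by (simp add: integral_open_interval)
  qed
  have cell: "AE x in lborel. x \<in> cbox c d \<longrightarrow> h x = 0" if sub: "cbox c d \<subseteq> \<Omega>" for c d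
  proof -
    let ?f = "\<lambda>x. indicator (cbox c d) x * h x"
    have int: "integrable lborel ?f" using sub by (intro loc) auto
    then have "?f integrable_on UNIV" by (rule integrable_on_lborel)
    then have fi: "?f integrable_on cbox a b" for a b
      by (rule integrable_on_subcbox) auto
    obtain N where N: "negligible N" "\<And>x e. x \<notin> N \<Longrightarrow> 0 < e \<Longrightarrow>
        \<exists>\<delta>>0. \<forall>t. 0 < t \<and> t < \<delta> \<longrightarrow> norm (integral (cbox x (x + t *\<^sub>R One)) ?f /\<^sub>R t ^ DIM('a) - ?f x) < e"
    proof (rule integrable_ccontinuous_explicit[OF fi])
      fix N assume "negligible N" and N: "\<And>x e. x \<notin> N \<Longrightarrow> 0 < e \<Longrightarrow>
        \<exists>\<delta>>0. \<forall>t. 0 < t \<and> t < \<delta> \<longrightarrow> norm (integral (cbox x (x + t *\<^sub>R One)) ?f /\<^sub>R t ^ DIM('a) - ?f x) < e"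
      then show thesis
        by (intro that[of N]) (assumption, rule N)
    qed
    have N0: "AE x in lborel. x \<notin> N"
    proof -
      have "AE x in lebesgue. x \<notin> N"
        using N(1) by (intro AE_not_in) (simp add: negligible_iff_null_sets)
      then show ?thesis by (simp add: AE_completion_iff)
    qed
    have "AE x in lborel. x \<notin> cbox c d - box c d"
    proof -
      have "AE x in lebesgue. x \<notin> cbox c d - box c d"
        using negligible_frontier_interval[of c d] by (intro AE_not_in) (simp add: negligible_iff_null_sets)
      then show ?thesis by (simp add: AE_completion_iff)
    qed
    then show ?thesis
      using N0
    proof eventually_elim
      case (elim x)
      show ?case
      proof
        assume "x \<in> cbox c d"
        then have x: "x \<in> box c d" using elim by simp
        have "norm (?f x) < e" if e: "0 < e" for e
        proof -
          obtain \<delta> where \<delta>: "\<delta> > 0" "\<And>t. 0 < t \<Longrightarrow> t < \<delta> \<Longrightarrow>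
              norm (integral (cbox x (x + t *\<^sub>R One)) ?f /\<^sub>R t ^ DIM('a) - ?f x) < e"
            using N(2)[OF elim(2) e] by blast
          define m where "m = Min ((\<lambda>i. d \<bullet> i - x \<bullet> i) ` Basis)"
          have m: "m > 0" "\<And>i. i \<in> Basis \<Longrightarrow> m \<le> d \<bullet> i - x \<bullet> i"
            using x by (auto simp: m_def mem_box)
          define t where "t = min (\<delta> / 2) m"
          have t: "0 < t" "t < \<delta>" "t \<le> m" using \<delta>(1) m(1) by (auto simp: t_def)
          have sub': "cbox x (x + t *\<^sub>R One) \<subseteq> cbox c d"
          proof
            fix y assume y: "y \<in> cbox x (x + t *\<^sub>R One)"
            show "y \<in> cbox c d"
              unfolding mem_box
            proof
              fix i :: 'a assume i: "i \<in> Basis"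
              have "x \<bullet> i \<le> y \<bullet> i" "y \<bullet> i \<le> x \<bullet> i + t" "c \<bullet> i < x \<bullet> i"
                using y x i by (auto simp: mem_box inner_add_left)
              then show "c \<bullet> i \<le> y \<bullet> i \<and> y \<bullet> i \<le> d \<bullet> i"
                using m(2)[OF i] t by linarith
            qed
          qed
          have "integral (cbox x (x + t *\<^sub>R One)) ?f = integral (cbox x (x + t *\<^sub>R One)) h"
            using sub' by (intro integral_cong) auto
          also have "\<dots> = 0" using sub sub' by (intro box0) auto
          finally show ?thesis using \<delta>(2)[OF t(1,2)] by simp
        qed
        from this[of "norm (?f x)"] have "?f x = 0" by auto
        then show "h x = 0" using \<open>x \<in> cbox c d\<close> by simp
      qed
    qed
  qed
  obtain \<D> where \<D>: "countable \<D>" "\<And>X. X \<in> \<D> \<Longrightarrow> X \<subseteq> \<Omega>" "\<And>X. X \<in> \<D> \<Longrightarrow> \<exists>a b. X = cbox a b" "\<Union>\<D> = \<Omega>"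
    using open_countable_Union_open_cbox[OF \<open>open \<Omega>\<close>] by (metis PowD subset_iff)
  have "AE x in lborel. \<forall>X\<in>\<D>. x \<in> X \<longrightarrow> h x = 0"
  proof (subst AE_ball_countable[OF \<D>(1)], intro ballI)
    fix X assume X: "X \<in> \<D>"
    then obtain a b where "X = cbox a b" using \<D>(3) by blast
    then show "AE x in lborel. x \<in> X \<longrightarrow> h x = 0" using cell \<D>(2)[OF X] by auto
  qed
  then show ?thesis
    by eventually_elim (use \<D>(4) in auto)
qed

section \<open>Weak gradients\<close>

lemma integrable_bounded_mult:
  fixes f g :: "'a \<Rightarrow> real"
  assumes f: "integrable M f" and [measurable]: "g \<in> borel_measurable M" and B: "\<And>x. \<bar>g x\<bar> \<le> B"
  shows "integrable M (\<lambda>x. f x * g x)"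
proof (rule Bochner_Integration.integrable_bound)
  show "integrable M (\<lambda>x. B * f x)" using f by simp
  show "AE x in M. norm (f x * g x) \<le> norm (B * f x)"
  proof (intro AE_I2)
    fix x
    have "\<bar>f x\<bar> * \<bar>g x\<bar> \<le> \<bar>f x\<bar> * \<bar>B\<bar>" using B[of x] by (intro mult_left_mono) auto
    then show "norm (f x * g x) \<le> norm (B * f x)" by (simp add: abs_mult mult.commute)
  qed
qed (use f in measurable)

lemma bounded_if_compact_support:
  fixes f :: "'a::metric_space \<Rightarrow> real"
  assumes "continuous_on UNIV f" "compact K" "\<And>x. x \<notin> K \<Longrightarrow> f x = 0"
  obtains B where "\<And>x. \<bar>f x\<bar> \<le> B"
proof -
  have "bounded (f ` K)"
    using assms by (intro compact_imp_bounded compact_continuous_image) (auto intro: continuous_on_subset)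
  then obtain B where B: "\<And>x. x \<in> K \<Longrightarrow> \<bar>f x\<bar> \<le> B"
    by (auto simp: bounded_iff)
  show ?thesis
  proof (rule that)
    fix x show "\<bar>f x\<bar> \<le> max B 0"
      using B[of x] assms(3)[of x] by (cases "x \<in> K") auto
  qed
qed

lemma compact_annulus: "compact (cball (0::'a::euclidean_space) b - ball 0 a)"
  by (intro compact_diff) auto

lemma compact_subset_annulus:
  fixes K :: "'a::euclidean_space set"
  assumes K: "compact K" "K \<subseteq> ball 0 \<rho> - {0}" and "\<rho> > 0"
  obtains a b where "0 < a" "0 \<le> b" "b < \<rho>" "K \<subseteq> cball 0 b - ball 0 a"
proof (cases "K = {}")
  case True
  show ?thesis by (rule that[of 1 0]) (use True \<open>\<rho> > 0\<close> in auto)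
next
  case False
  have cont: "continuous_on K norm" by (intro continuous_intros)
  obtain y where y: "y \<in> K" "\<And>x. x \<in> K \<Longrightarrow> norm x \<le> norm y"
    using continuous_attains_sup[OF K(1) False cont] by blast
  obtain z where z: "z \<in> K" "\<And>x. x \<in> K \<Longrightarrow> norm z \<le> norm x"
    using continuous_attains_inf[OF K(1) False cont] by blast
  show ?thesis
  proof (rule that[of "norm z" "norm y"])
    show "0 < norm z" "norm y < \<rho>" using y(1) z(1) K(2) by auto
    show "K \<subseteq> cball 0 (norm y) - ball 0 (norm z)" using y(2) z(2) by (force simp: not_less)
  qed simp
qed

text \<open>
  The scalar form of weak differentiability that the argument needs: \<open>g\<close> stands for \<open>\<nabla>u x \<bullet> x\<close>, and
  \<open>N \<phi> + \<nabla>\<phi> \<bullet> x\<close> is the divergence of \<open>\<phi> x\<close>. Both functions are Borel measurable on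
  the whole space, so that they can be composed with dilations in Tonelli's theorem, which would fail for
  functions that are only Lebesgue measurable.
\<close>

definition weak_radial :: "real \<Rightarrow> ('a::euclidean_space \<Rightarrow> real) \<Rightarrow> ('a \<Rightarrow> real) \<Rightarrow> bool" where
  "weak_radial R u g \<longleftrightarrow>
     u \<in> borel_measurable borel \<and> g \<in> borel_measurable borel \<and>
     (\<forall>x. x \<notin> ball 0 R - {0} \<longrightarrow> u x = 0 \<and> g x = 0) \<and>
     (\<forall>K. compact K \<longrightarrow> K \<subseteq> ball 0 R - {0} \<longrightarrow>
        integrable lborel (\<lambda>x. indicator K x * u x) \<and> integrable lborel (\<lambda>x. indicator K x * g x)) \<and>
     (\<forall>\<phi>\<in>C1c (ball 0 R - {0}).
        (LINT x|lborel. u x * (real DIM('a) * \<phi> x + gradient \<phi> x \<bullet> x)) = - (LINT x|lborel. g x * \<phi> x))"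

text \<open>
  Exhausting the punctured ball by closed annuli gives measurability on the whole of it.
\<close>

lemma borel_version_on:
  fixes f :: "'a::euclidean_space \<Rightarrow> real"
  assumes "R > 0" and f: "\<forall>K. compact K \<longrightarrow> K \<subseteq> ball 0 R - {0} \<longrightarrow> set_integrable lebesgue K f"
  shows "\<exists>f'. f' \<in> borel_measurable borel \<and> (\<forall>x. x \<notin> ball 0 R - {0} \<longrightarrow> f' x = 0) \<and>
    (AE x in lborel. x \<in> ball 0 R - {0} \<longrightarrow> f x = f' x) \<and>
    (\<forall>K. compact K \<longrightarrow> K \<subseteq> ball 0 R - {0} \<longrightarrow> integrable lborel (\<lambda>x. indicator K x * f' x)) \<and>
    (\<lambda>x. indicator (ball 0 R - {0}) x * f x) \<in> borel_measurable lebesgue"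
proof -
  let ?\<Omega> = "ball 0 R - {0} :: 'a set"
  define K where "K n = cball 0 (R - R / real (n + 2)) - ball (0::'a) (R / real (n + 2))" for n :: nat
  have K: "compact (K n)" "K n \<subseteq> ?\<Omega>" for n
  proof -
    show "compact (K n)" unfolding K_def by (rule compact_annulus)
    have "0 < R / real (n + 2)" using \<open>R > 0\<close> by simp
    then show "K n \<subseteq> ?\<Omega>" unfolding K_def by auto
  qed
  have leb: "(\<lambda>x. indicator ?\<Omega> x * f x) \<in> borel_measurable lebesgue"
  proof (rule borel_measurable_LIMSEQ_real)
    show "(\<lambda>x. indicator (K n) x * f x) \<in> borel_measurable lebesgue" for n
      using f K[of n] by (auto simp: set_integrable_def dest: borel_measurable_integrable)
    fix x :: 'a
    show "(\<lambda>n. indicator (K n) x * f x) \<longlonglongrightarrow> indicator ?\<Omega> x * f x"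
    proof (cases "x \<in> ?\<Omega>")
      case True
      define d where "d = min (norm x) (R - norm x)"
      have d: "d > 0" using True by (auto simp: d_def)
      have "\<forall>\<^sub>F n in sequentially. R / d \<le> real n"
        using eventually_ge_at_top[of "nat \<lceil>R / d\<rceil>"] by eventually_elim linarith
      then have "\<forall>\<^sub>F n in sequentially. x \<in> K n"
      proof eventually_elim
        case (elim n)
        then have "R \<le> d * real (n + 2)" using d by (simp add: field_simps)
        then have "R / real (n + 2) \<le> d" by (simp add: field_simps)
        then show ?case by (auto simp: K_def d_def)
      qed
      then have "\<forall>\<^sub>F n in sequentially. indicator (K n) x * f x = indicator ?\<Omega> x * f x"
        by eventually_elim (use True in simp)
      then show ?thesis by (rule tendsto_eventually)
    next
      case False
      then have "x \<notin> K n" for n using K(2) by blast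
      then show ?thesis using False by simp
    qed
  qed
  from leb obtain f1 where f1: "f1 \<in> borel_measurable borel" "AE x in lborel. indicator ?\<Omega> x * f x = f1 x"
    using completion_ex_borel_measurable_real[of _ lborel] by auto
  define f' where "f' x = indicator ?\<Omega> x * f1 x" for x
  have meas: "f' \<in> borel_measurable borel"
    unfolding f'_def[abs_def] using f1(1) by (intro borel_measurable_times borel_measurable_indicator) auto
  have ae: "AE x in lborel. x \<in> ?\<Omega> \<longrightarrow> f x = f' x"
    using f1(2) by eventually_elim (auto simp: f'_def)
  have int: "integrable lborel (\<lambda>x. indicator L x * f' x)" if L: "compact L" "L \<subseteq> ?\<Omega>" for L
  proof -
    have [measurable]: "(\<lambda>x. indicator L x * f' x) \<in> borel_measurable lborel"
      using meas compact_imp_closed[OF L(1)] by (intro borel_measurable_times borel_measurable_indicator) auto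
    have "integrable lebesgue (\<lambda>x. indicator L x * f x)"
      using f L by (simp add: set_integrable_def)
    moreover have "AE x in lebesgue. indicator L x * f x = indicator L x * f' x"
      using ae unfolding AE_completion_iff
      by eventually_elim (use L(2) in \<open>auto split: split_indicator\<close>)
    ultimately have "integrable lebesgue (\<lambda>x. indicator L x * f' x)"
      by (subst integrable_cong_AE[symmetric]) (auto intro: measurable_completion)
    then show ?thesis by (subst (asm) integrable_completion) auto
  qed
  show ?thesis
    using meas ae int leb by (intro exI[of _ f'] conjI) (auto simp: f'_def)
qed

lemma C1c_mult_coordinate:
  fixes \<phi> :: "'a::euclidean_space \<Rightarrow> real"
  assumes \<phi>: "\<phi> \<in> C1c \<Omega>"
  shows "(\<lambda>x. \<phi> x * (x \<bullet> b)) \<in> C1c \<Omega>"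
    and "gradient (\<lambda>x. \<phi> x * (x \<bullet> b)) = (\<lambda>x. \<phi> x *\<^sub>R b + (x \<bullet> b) *\<^sub>R gradient \<phi> x)"
proof -
  obtain K where K: "compact K" "K \<subseteq> \<Omega>" "\<And>x. x \<notin> K \<Longrightarrow> \<phi> x = 0"
    using C1c_support[OF \<phi>] by metis
  have "GDERIV (\<lambda>x. x \<bullet> b) x :> b" for x
    unfolding gderiv_def by (intro has_derivative_inner_left has_derivative_ident)
  then have D: "GDERIV (\<lambda>x. \<phi> x * (x \<bullet> b)) x :> \<phi> x *\<^sub>R b + (x \<bullet> b) *\<^sub>R gradient \<phi> x" for x
    by (rule GDERIV_mult[OF C1c_GDERIV[OF \<phi>]])
  have cont: "continuous_on UNIV (\<lambda>x. \<phi> x *\<^sub>R b + (x \<bullet> b) *\<^sub>R gradient \<phi> x)"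
    by (intro continuous_intros C1c_continuous[OF \<phi>] C1c_continuous_gradient[OF \<phi>])
  have supp: "x \<in> K" if "\<phi> x * (x \<bullet> b) \<noteq> 0" for x
    using that K(3) by force
  show "(\<lambda>x. \<phi> x * (x \<bullet> b)) \<in> C1c \<Omega>"
    and "gradient (\<lambda>x. \<phi> x * (x \<bullet> b)) = (\<lambda>x. \<phi> x *\<^sub>R b + (x \<bullet> b) *\<^sub>R gradient \<phi> x)"
    using C1cI[OF D cont K(1,2) supp] C1c_gradient_eq[OF D cont K(1,2) supp] by auto
qed

text \<open>
  Test with \<open>\<phi> x * (x \<bullet> b)\<close>, take the component in direction \<open>b\<close>, and sum over the basis.
\<close>

lemma weak_gradient_scalar_identity:
  fixes u :: "'a::euclidean_space \<Rightarrow> real"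
  assumes W: "has_weak_gradient_on u G \<Omega>" and \<phi>: "\<phi> \<in> C1c \<Omega>"
  shows "(LINT x:\<Omega>|lebesgue. u x * (real DIM('a) * \<phi> x + gradient \<phi> x \<bullet> x)) = - (LINT x:\<Omega>|lebesgue. (G x \<bullet> x) * \<phi> x)"
proof -
  obtain K where K: "compact K" "K \<subseteq> \<Omega>" "\<And>x. x \<notin> K \<Longrightarrow> \<phi> x = 0" "\<And>x. x \<notin> K \<Longrightarrow> gradient \<phi> x = 0"
    using C1c_support[OF \<phi>] by metis
  have u: "integrable lebesgue (\<lambda>x. indicator K x * u x)" and G: "integrable lebesgue (\<lambda>x. indicator K x *\<^sub>R G x)"
    using W K(1,2) by (auto simp: has_weak_gradient_on_def set_integrable_def)
  have cont_meas: "f \<in> borel_measurable lebesgue" if "continuous_on UNIV f" for f :: "'a \<Rightarrow> real"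
    using that by (intro measurable_completion) (simp add: borel_measurable_continuous_onI)
  note c\<phi> = C1c_continuous[OF \<phi>] C1c_continuous_gradient[OF \<phi>]
  have u_int: "integrable lebesgue (\<lambda>x. indicator K x * u x * \<psi> x)"
    if \<psi>: "continuous_on UNIV \<psi>" "\<And>x. x \<notin> K \<Longrightarrow> \<psi> x = 0" for \<psi>
  proof -
    obtain B where "\<And>x. \<bar>\<psi> x\<bar> \<le> B" using bounded_if_compact_support[OF \<psi>(1) K(1) \<psi>(2)] by blast
    then show ?thesis by (rule integrable_bounded_mult[OF u cont_meas[OF \<psi>(1)]])
  qed
  have G_int: "integrable lebesgue (\<lambda>x. indicator K x * (G x \<bullet> b) * \<psi> x)"
    if \<psi>: "continuous_on UNIV \<psi>" "\<And>x. x \<notin> K \<Longrightarrow> \<psi> x = 0" for \<psi> b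
  proof -
    obtain B where "\<And>x. \<bar>\<psi> x\<bar> \<le> B" using bounded_if_compact_support[OF \<psi>(1) K(1) \<psi>(2)] by blast
    moreover have "integrable lebesgue (\<lambda>x. indicator K x * (G x \<bullet> b))"
    proof -
      have "integrable lebesgue (\<lambda>x. (indicator K x *\<^sub>R G x) \<bullet> b)"
        using G by (rule integrable_inner_left)
      then show ?thesis by simp
    qed
    ultimately show ?thesis by (rule integrable_bounded_mult[OF _ cont_meas[OF \<psi>(1)], rotated])
  qed
  have component: "(LINT x|lebesgue. indicator K x * u x * (\<phi> x + (x \<bullet> b) * (gradient \<phi> x \<bullet> b)))
      = - (LINT x|lebesgue. indicator K x * (G x \<bullet> b) * (\<phi> x * (x \<bullet> b)))" if b: "b \<in> Basis" for b
  proof -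
    let ?\<phi> = "\<lambda>x. \<phi> x * (x \<bullet> b)"
    let ?A = "\<lambda>x. indicator \<Omega> x *\<^sub>R u x *\<^sub>R gradient ?\<phi> x" and ?B = "\<lambda>x. indicator \<Omega> x *\<^sub>R ?\<phi> x *\<^sub>R G x"
    have id: "(LINT x|lebesgue. ?A x) = - (LINT x|lebesgue. ?B x)"
      using W C1c_mult_coordinate(1)[OF \<phi>, of b] by (simp add: has_weak_gradient_on_def set_lebesgue_integral_def)
    have A: "?A x \<bullet> b' = indicator K x * u x * (\<phi> x * (b \<bullet> b') + (x \<bullet> b) * (gradient \<phi> x \<bullet> b'))" for x b'
      using K(2) K(3,4)[of x] unfolding C1c_mult_coordinate(2)[OF \<phi>]
      by (cases "x \<in> K") (auto simp: inner_add_left)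
    have B: "?B x \<bullet> b' = indicator K x * (G x \<bullet> b') * (\<phi> x * (x \<bullet> b))" for x b'
      using K(2) K(3)[of x] by (cases "x \<in> K") auto
    have vector_int: "integrable lebesgue F" if "\<And>b'. integrable lebesgue (\<lambda>x. F x \<bullet> b')" for F :: "'a \<Rightarrow> 'a"
    proof -
      have "integrable lebesgue (\<lambda>x. \<Sum>b'\<in>Basis. (F x \<bullet> b') *\<^sub>R b')"
        using that by (intro Bochner_Integration.integrable_sum integrable_scaleR_left)
      then show ?thesis by (simp add: euclidean_representation)
    qed
    have A_int: "integrable lebesgue ?A"
    proof (rule vector_int)
      show "integrable lebesgue (\<lambda>x. ?A x \<bullet> b')" for b'
        unfolding A using K(3,4) c\<phi> by (intro u_int continuous_intros) auto
    qed
    have B_int: "integrable lebesgue ?B"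
    proof (rule vector_int)
      show "integrable lebesgue (\<lambda>x. ?B x \<bullet> b')" for b'
        unfolding B using K(3) c\<phi> by (intro G_int continuous_intros) auto
    qed
    have "(LINT x|lebesgue. ?A x \<bullet> b) = - (LINT x|lebesgue. ?B x \<bullet> b)"
    proof -
      have "(LINT x|lebesgue. ?A x \<bullet> b) = (LINT x|lebesgue. ?A x) \<bullet> b"
        using A_int by (intro integral_inner_left)
      moreover have "(LINT x|lebesgue. ?B x \<bullet> b) = (LINT x|lebesgue. ?B x) \<bullet> b"
        using B_int by (intro integral_inner_left)
      ultimately show ?thesis by (simp only: id inner_minus_left)
    qed
    then show ?thesis
      unfolding A B using b by (simp add: inner_Basis)
  qed
  have "(LINT x:\<Omega>|lebesgue. u x * (real DIM('a) * \<phi> x + gradient \<phi> x \<bullet> x))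
      = (LINT x|lebesgue. (\<Sum>b\<in>Basis. indicator K x * u x * (\<phi> x + (x \<bullet> b) * (gradient \<phi> x \<bullet> b))))"
    unfolding set_lebesgue_integral_def
  proof (rule Bochner_Integration.integral_cong[OF refl])
    fix x
    have "gradient \<phi> x \<bullet> x = (\<Sum>b\<in>Basis. (x \<bullet> b) * (gradient \<phi> x \<bullet> b))"
      by (subst euclidean_inner) (simp add: mult.commute)
    then have "(\<Sum>b\<in>Basis. indicator K x * u x * (\<phi> x + (x \<bullet> b) * (gradient \<phi> x \<bullet> b)))
        = indicator K x * u x * (real DIM('a) * \<phi> x + gradient \<phi> x \<bullet> x)"
      by (simp add: sum_distrib_left[symmetric] sum.distrib)
    then show "indicator \<Omega> x *\<^sub>R (u x * (real DIM('a) * \<phi> x + gradient \<phi> x \<bullet> x))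
        = (\<Sum>b\<in>Basis. indicator K x * u x * (\<phi> x + (x \<bullet> b) * (gradient \<phi> x \<bullet> b)))"
      using K(2) K(3,4)[of x] by (cases "x \<in> K") auto
  qed
  also have "\<dots> = (\<Sum>b\<in>Basis. LINT x|lebesgue. indicator K x * u x * (\<phi> x + (x \<bullet> b) * (gradient \<phi> x \<bullet> b)))"
    using K(3,4) c\<phi> by (intro Bochner_Integration.integral_sum u_int continuous_intros) auto
  also have "\<dots> = - (\<Sum>b\<in>Basis. LINT x|lebesgue. indicator K x * (G x \<bullet> b) * (\<phi> x * (x \<bullet> b)))"
    by (simp add: component sum_negf)
  also have "(\<Sum>b\<in>Basis. LINT x|lebesgue. indicator K x * (G x \<bullet> b) * (\<phi> x * (x \<bullet> b)))
      = (LINT x|lebesgue. (\<Sum>b\<in>Basis. indicator K x * (G x \<bullet> b) * (\<phi> x * (x \<bullet> b))))"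
    using K(3) c\<phi> by (intro Bochner_Integration.integral_sum[symmetric] G_int continuous_intros) auto
  also have "\<dots> = (LINT x:\<Omega>|lebesgue. (G x \<bullet> x) * \<phi> x)"
    unfolding set_lebesgue_integral_def
  proof (rule Bochner_Integration.integral_cong[OF refl])
    fix x
    have "G x \<bullet> x = (\<Sum>b\<in>Basis. (G x \<bullet> b) * (x \<bullet> b))"
      by (rule euclidean_inner)
    then have "(\<Sum>b\<in>Basis. indicator K x * (G x \<bullet> b) * (\<phi> x * (x \<bullet> b))) = indicator K x * ((G x \<bullet> x) * \<phi> x)"
      by (simp add: sum_distrib_left sum_distrib_right mult_ac)
    then show "(\<Sum>b\<in>Basis. indicator K x * (G x \<bullet> b) * (\<phi> x * (x \<bullet> b))) = indicator \<Omega> x *\<^sub>R ((G x \<bullet> x) * \<phi> x)"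
      using K(2) K(3)[of x] by (cases "x \<in> K") auto
  qed
  finally show ?thesis .
qed

theorem weak_gradient_radial_representative:
  fixes u :: "'a::euclidean_space \<Rightarrow> real"
  assumes "R > 0" and W: "has_weak_gradient_on u G (ball 0 R - {0})"
  obtains u' g' where "weak_radial R u' g'"
    "AE x in lborel. x \<in> ball 0 R - {0} \<longrightarrow> u x = u' x"
    "AE x in lborel. x \<in> ball 0 R - {0} \<longrightarrow> G x \<bullet> x = g' x"
proof -
  let ?\<Omega> = "ball 0 R - {0} :: 'a set"
  have u: "set_integrable lebesgue K u" and G: "set_integrable lebesgue K G" if "compact K" "K \<subseteq> ?\<Omega>" for K
    using W that by (auto simp: has_weak_gradient_on_def)
  have Gx: "set_integrable lebesgue K (\<lambda>x. G x \<bullet> x)" if K: "compact K" "K \<subseteq> ?\<Omega>" for K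
    unfolding set_integrable_def
  proof (rule Bochner_Integration.integrable_bound)
    have int: "integrable lebesgue (\<lambda>x. indicator K x *\<^sub>R G x)"
      using G[OF K] by (simp add: set_integrable_def)
    then show "integrable lebesgue (\<lambda>x. norm (indicator K x *\<^sub>R G x) * R)"
      by (intro integrable_mult_left integrable_norm)
    have "(\<lambda>x::'a. x) \<in> borel_measurable lebesgue"
      by (rule measurable_completion) simp
    then have "(\<lambda>x. (indicator K x *\<^sub>R G x) \<bullet> x) \<in> borel_measurable lebesgue"
      using int by (intro borel_measurable_inner) auto
    then show "(\<lambda>x. indicator K x *\<^sub>R (G x \<bullet> x)) \<in> borel_measurable lebesgue" by simp
    show "AE x in lebesgue. norm (indicator K x *\<^sub>R (G x \<bullet> x)) \<le> norm (norm (indicator K x *\<^sub>R G x) * R)"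
    proof (intro AE_I2)
      fix x
      show "norm (indicator K x *\<^sub>R (G x \<bullet> x)) \<le> norm (norm (indicator K x *\<^sub>R G x) * R)"
      proof (cases "x \<in> K")
        case True
        then have "norm x \<le> R" using K(2) by auto
        then have "norm (G x) * norm x \<le> norm (G x) * R" by (intro mult_left_mono) auto
        then show ?thesis using True Cauchy_Schwarz_ineq2[of "G x" x] \<open>R > 0\<close> by simp
      qed simp
    qed
  qed
  obtain u' where u': "u' \<in> borel_measurable borel" "\<forall>x. x \<notin> ?\<Omega> \<longrightarrow> u' x = 0"
      "AE x in lborel. x \<in> ?\<Omega> \<longrightarrow> u x = u' x"
      "\<forall>K. compact K \<longrightarrow> K \<subseteq> ?\<Omega> \<longrightarrow> integrable lborel (\<lambda>x. indicator K x * u' x)"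
      "(\<lambda>x. indicator ?\<Omega> x * (u x)) \<in> borel_measurable lebesgue"
    using borel_version_on[OF \<open>R > 0\<close>, of u] u by blast
  obtain g' where g': "g' \<in> borel_measurable borel" "\<forall>x. x \<notin> ?\<Omega> \<longrightarrow> g' x = 0"
      "AE x in lborel. x \<in> ?\<Omega> \<longrightarrow> G x \<bullet> x = g' x"
      "\<forall>K. compact K \<longrightarrow> K \<subseteq> ?\<Omega> \<longrightarrow> integrable lborel (\<lambda>x. indicator K x * g' x)"
      "(\<lambda>x. indicator ?\<Omega> x * (G x \<bullet> x)) \<in> borel_measurable lebesgue"
    using borel_version_on[OF \<open>R > 0\<close>, of "\<lambda>x. G x \<bullet> x"] Gx by blast
  have switch: "(LINT x:?\<Omega>|lebesgue. f x * \<psi> x) = (LINT x|lborel. f' x * \<psi> x)"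
    if f': "f' \<in> borel_measurable borel" "\<forall>x. x \<notin> ?\<Omega> \<longrightarrow> f' x = 0" "AE x in lborel. x \<in> ?\<Omega> \<longrightarrow> f x = f' x"
      and leb: "(\<lambda>x. indicator ?\<Omega> x * f x) \<in> borel_measurable lebesgue" and \<psi>: "continuous_on UNIV \<psi>"
    for f f' \<psi> :: "'a \<Rightarrow> real"
  proof -
    have m: "(\<lambda>x. f' x * \<psi> x) \<in> borel_measurable lborel"
      using f'(1) \<psi> by (intro borel_measurable_times) (auto intro: borel_measurable_continuous_onI)
    have ae: "AE x in lborel. indicator ?\<Omega> x *\<^sub>R (f x * \<psi> x) = f' x * \<psi> x"
      using f'(3) by eventually_elim (use f'(2) in \<open>auto split: split_indicator\<close>)
    have "AE x in lebesgue. indicator ?\<Omega> x *\<^sub>R (f x * \<psi> x) = f' x * \<psi> x"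
      using ae by (simp add: AE_completion_iff)
    moreover have m': "(\<lambda>x. f' x * \<psi> x) \<in> borel_measurable lebesgue"
      using m by (rule measurable_completion)
    moreover have "(\<lambda>x. indicator ?\<Omega> x *\<^sub>R (f x * \<psi> x)) \<in> borel_measurable lebesgue"
    proof -
      have "(\<lambda>x. (indicator ?\<Omega> x * f x) * \<psi> x) \<in> borel_measurable lebesgue"
      proof (rule borel_measurable_times[OF leb])
        have "\<psi> \<in> borel_measurable lborel"
          using \<psi> by (simp add: borel_measurable_continuous_onI)
        then show "\<psi> \<in> borel_measurable lebesgue" by (rule measurable_completion)
      qed
      then show ?thesis by (simp add: mult.assoc)
    qed
    ultimately have "(LINT x:?\<Omega>|lebesgue. f x * \<psi> x) = (LINT x|lebesgue. f' x * \<psi> x)"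
      using m' unfolding set_lebesgue_integral_def by (intro integral_cong_AE)
    then show ?thesis by (simp add: integral_completion[OF m])
  qed
  have "weak_radial R u' g'"
    unfolding weak_radial_def
  proof (intro conjI ballI)
    fix \<phi> :: "'a \<Rightarrow> real" assume \<phi>: "\<phi> \<in> C1c ?\<Omega>"
    have "(LINT x|lborel. u' x * (real DIM('a) * \<phi> x + gradient \<phi> x \<bullet> x)) = (LINT x:?\<Omega>|lebesgue. u x * (real DIM('a) * \<phi> x + gradient \<phi> x \<bullet> x))"
      by (intro switch[OF u'(1-3,5), symmetric] continuous_intros C1c_continuous[OF \<phi>] C1c_continuous_gradient[OF \<phi>])
    also have "\<dots> = - (LINT x:?\<Omega>|lebesgue. (G x \<bullet> x) * \<phi> x)"
      by (rule weak_gradient_scalar_identity[OF W \<phi>])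
    also have "(LINT x:?\<Omega>|lebesgue. (G x \<bullet> x) * \<phi> x) = (LINT x|lborel. g' x * \<phi> x)"
      by (intro switch[OF g'(1-3,5)] C1c_continuous[OF \<phi>])
    finally show "(LINT x|lborel. u' x * (real DIM('a) * \<phi> x + gradient \<phi> x \<bullet> x)) = - (LINT x|lborel. g' x * \<phi> x)" .
  qed (use u' g' in auto)
  then show ?thesis by (rule that[OF _ u'(3) g'(3)])
qed

section \<open>Increments along rays\<close>

lemma C1c_dilate:
  fixes \<phi> :: "'a::euclidean_space \<Rightarrow> real"
  assumes \<phi>: "\<phi> \<in> C1c U" and a: "a > 0" and sub: "\<And>x. x \<in> U \<Longrightarrow> x /\<^sub>R a \<in> \<Omega>"
  shows "(\<lambda>x. \<phi> (a *\<^sub>R x)) \<in> C1c \<Omega>"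
    and "gradient (\<lambda>x. \<phi> (a *\<^sub>R x)) = (\<lambda>x. a *\<^sub>R gradient \<phi> (a *\<^sub>R x))"
proof -
  obtain K where K: "compact K" "K \<subseteq> U" "\<And>x. x \<notin> K \<Longrightarrow> \<phi> x = 0"
    using C1c_support[OF \<phi>] by metis
  have D: "GDERIV (\<lambda>x. \<phi> (a *\<^sub>R x)) x :> a *\<^sub>R gradient \<phi> (a *\<^sub>R x)" for x
  proof -
    have "((\<lambda>x. a *\<^sub>R x) has_derivative (\<lambda>h. a *\<^sub>R h)) (at x)"
      by (intro has_derivative_scaleR_right has_derivative_ident)
    moreover have "(\<phi> has_derivative (\<lambda>h. h \<bullet> gradient \<phi> (a *\<^sub>R x))) (at (a *\<^sub>R x))"
      using C1c_GDERIV[OF \<phi>] by (simp add: gderiv_def)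
    ultimately have "((\<lambda>x. \<phi> (a *\<^sub>R x)) has_derivative (\<lambda>h. (a *\<^sub>R h) \<bullet> gradient \<phi> (a *\<^sub>R x))) (at x)"
      by (rule has_derivative_compose)
    then show ?thesis by (simp add: gderiv_def)
  qed
  have cont: "continuous_on UNIV (\<lambda>x. a *\<^sub>R gradient \<phi> (a *\<^sub>R x))"
    by (intro continuous_intros continuous_on_compose2[OF C1c_continuous_gradient[OF \<phi>]]) auto
  have comp: "compact ((\<lambda>x. x /\<^sub>R a) ` K)"
    using K(1) by (rule compact_scaling)
  have sub': "(\<lambda>x. x /\<^sub>R a) ` K \<subseteq> \<Omega>" using sub K(2) by auto
  have supp: "x \<in> (\<lambda>x. x /\<^sub>R a) ` K" if "\<phi> (a *\<^sub>R x) \<noteq> 0" for x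
    using that K(3) a by (intro image_eqI[of _ _ "a *\<^sub>R x"]) auto
  show "(\<lambda>x. \<phi> (a *\<^sub>R x)) \<in> C1c \<Omega>"
    and "gradient (\<lambda>x. \<phi> (a *\<^sub>R x)) = (\<lambda>x. a *\<^sub>R gradient \<phi> (a *\<^sub>R x))"
    using C1cI[OF D cont comp sub' supp] C1c_gradient_eq[OF D cont comp sub' supp] by auto
qed

abbreviation (input) ray_integrand :: "real \<Rightarrow> ('a::euclidean_space \<Rightarrow> real) \<Rightarrow> 'a \<Rightarrow> real \<Rightarrow> real" where
  "ray_integrand L g x t \<equiv> indicator {1..L} t * (g (t *\<^sub>R x) / t)"

definition increment :: "real \<Rightarrow> ('a::euclidean_space \<Rightarrow> real) \<Rightarrow> 'a \<Rightarrow> real" where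
  "increment L g x = (LINT t|lborel. ray_integrand L g x t)"

context
  fixes R L :: real and u g :: "'a::euclidean_space \<Rightarrow> real"
  assumes R: "R > 0" and L: "L > 1" and W: "weak_radial R u g"
begin

lemma u_meas [measurable]: "u \<in> borel_measurable borel" and g_meas [measurable]: "g \<in> borel_measurable borel"
  using W by (auto simp: weak_radial_def)

lemma local_int: "compact K \<Longrightarrow> K \<subseteq> ball 0 R - {0} \<Longrightarrow> integrable lborel (\<lambda>x. indicator K x * u x)"
  "compact K \<Longrightarrow> K \<subseteq> ball 0 R - {0} \<Longrightarrow> integrable lborel (\<lambda>x. indicator K x * g x)"
  using W by (auto simp: weak_radial_def)

lemma increment_measurable [measurable]: "increment L g \<in> borel_measurable borel"
  unfolding increment_def[abs_def] by measurable

text \<open>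
  The dilates of \<open>K\<close> by factors in \<open>[1, L]\<close> stay in one compact set, on which \<open>u\<close> and \<open>g\<close> are integrable.
\<close>

lemma swept_annulus:
  assumes K: "compact K" "K \<subseteq> ball 0 (R / L) - {0}"
  obtains K' :: "'a set" where "compact K'" "K' \<subseteq> ball 0 R - {0}"
    "\<And>x t. x \<in> K \<Longrightarrow> 1 \<le> t \<Longrightarrow> t \<le> L \<Longrightarrow> t *\<^sub>R x \<in> K'"
proof -
  obtain a b where ab: "0 < a" "0 \<le> b" "b < R / L" "K \<subseteq> cball 0 b - ball 0 a"
    using compact_subset_annulus[OF K] R L by (metis divide_pos_pos less_trans zero_less_one)
  show ?thesis
  proof (rule that[of "cball 0 (L * b) - ball 0 a"])
    show "compact (cball 0 (L * b) - ball 0 a :: 'a set)" by (rule compact_annulus)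
    have "L * b < R" using ab(3) L by (simp add: field_simps)
    then show "cball 0 (L * b) - ball 0 a \<subseteq> (ball 0 R - {0} :: 'a set)" using ab(1) by auto
    fix x t assume x: "x \<in> K" "1 \<le> t" "t \<le> L"
    then have n: "a \<le> norm x" "norm x \<le> b" using ab(4) by (auto simp: not_less)
    have "norm x \<le> t * norm x"
      using mult_right_mono[of 1 t "norm x"] x by simp
    moreover have "t * norm x \<le> L * b"
      using x n L by (intro mult_mono) auto
    ultimately have n': "a \<le> t * norm x" "t * norm x \<le> L * b" using n by auto
    then show "t *\<^sub>R x \<in> cball 0 (L * b) - ball 0 a"
      using n' x(2) by auto
  qed
qed

lemma integrable_strip:
  assumes f: "integrable lborel (f :: 'a \<Rightarrow> real)"
  shows "integrable (lborel \<Otimes>\<^sub>M lborel) (\<lambda>(x, t). f x * indicator {1..L} t)"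
proof (rule integrableI_bounded)
  have [measurable]: "f \<in> borel_measurable borel" using f by auto
  show "(\<lambda>(x, t). f x * indicator {1..L} t) \<in> borel_measurable (lborel \<Otimes>\<^sub>M lborel)" by measurable
  have "(\<integral>\<^sup>+z. norm (case z of (x, t) \<Rightarrow> f x * indicator {1..L} t) \<partial>(lborel \<Otimes>\<^sub>M lborel))
      = (\<integral>\<^sup>+t. (\<integral>\<^sup>+x. norm (f x * indicator {1..L} t) \<partial>lborel) \<partial>lborel)"
    by (subst lborel_pair.nn_integral_snd[symmetric]) simp_all
  also have "\<dots> = (\<integral>\<^sup>+t. (\<integral>\<^sup>+x. norm (f x) \<partial>lborel) * indicator {1..L} t \<partial>lborel)"
    by (intro nn_integral_cong) (auto split: split_indicator)
  also have "\<dots> = (\<integral>\<^sup>+x. norm (f x) \<partial>lborel) * ennreal (L - 1)"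
    using L by (subst nn_integral_cmult_indicator) auto
  also have "\<dots> < \<infinity>"
    using f by (simp add: integrable_iff_bounded ennreal_mult_less_top)
  finally show "(\<integral>\<^sup>+z. norm (case z of (x, t) \<Rightarrow> f x * indicator {1..L} t) \<partial>(lborel \<Otimes>\<^sub>M lborel)) < \<infinity>" .
qed

lemma integrable_increment_strip:
  assumes K: "compact K" "K \<subseteq> ball 0 (R / L) - {0}"
  shows "integrable (lborel \<Otimes>\<^sub>M lborel) (\<lambda>(x, t). indicator K x * (ray_integrand L g x t))"
proof (rule integrableI_bounded)
  have [measurable]: "indicat_real K \<in> borel_measurable borel"
    using compact_imp_closed[OF K(1)] by (intro borel_measurable_indicator) auto
  show "(\<lambda>(x, t). indicator K x * (ray_integrand L g x t)) \<in> borel_measurable (lborel \<Otimes>\<^sub>M lborel)" by measurable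
  obtain K' :: "'a set" where K': "compact K'" "K' \<subseteq> ball 0 R - {0}"
    "\<And>x t. x \<in> K \<Longrightarrow> 1 \<le> t \<Longrightarrow> t \<le> L \<Longrightarrow> t *\<^sub>R x \<in> K'"
    using swept_annulus[OF K] by metis
  have [measurable]: "indicat_real K' \<in> borel_measurable borel"
    using compact_imp_closed[OF K'(1)] by (intro borel_measurable_indicator) auto
  let ?J = "\<integral>\<^sup>+y. ennreal \<bar>indicator K' y * g y\<bar> \<partial>lborel"
  have "(\<integral>\<^sup>+z. norm (case z of (x, t) \<Rightarrow> indicator K x * (ray_integrand L g x t)) \<partial>(lborel \<Otimes>\<^sub>M lborel))
      = (\<integral>\<^sup>+t. (\<integral>\<^sup>+x. norm (indicator K x * (ray_integrand L g x t)) \<partial>lborel) \<partial>lborel)"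
    by (subst lborel_pair.nn_integral_snd[symmetric]) simp_all
  also have "\<dots> \<le> (\<integral>\<^sup>+t. ?J * indicator {1..L} t \<partial>lborel)"
  proof (rule nn_integral_mono)
    fix t :: real
    show "(\<integral>\<^sup>+x. norm (indicator K x * (ray_integrand L g x t)) \<partial>lborel) \<le> ?J * indicator {1..L} t"
    proof (cases "1 \<le> t \<and> t \<le> L")
      case True
      have "(\<integral>\<^sup>+x. norm (indicator K x * (ray_integrand L g x t)) \<partial>lborel)
          \<le> (\<integral>\<^sup>+x. ennreal \<bar>indicator K' (t *\<^sub>R x) * g (t *\<^sub>R x)\<bar> \<partial>lborel)"
      proof (intro nn_integral_mono ennreal_leI)
        fix x
        show "norm (indicator K x * (ray_integrand L g x t)) \<le> \<bar>indicator K' (t *\<^sub>R x) * g (t *\<^sub>R x)\<bar>"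
        proof (cases "x \<in> K")
          case xK: True
          have "\<bar>g (t *\<^sub>R x)\<bar> / t \<le> \<bar>g (t *\<^sub>R x)\<bar> / 1" using True by (intro divide_left_mono) auto
          then show ?thesis using True xK K'(3)[OF xK, of t] by (simp add: abs_mult)
        qed simp
      qed
      also have "\<dots> = ennreal (t powr - real DIM('a)) * ?J"
        using True by (subst nn_integral_dilation) auto
      also have "\<dots> \<le> 1 * ?J"
        using True powr_mono[of "- real DIM('a)" 0 t] by (intro mult_right_mono) (auto simp: ennreal_le_1)
      finally show ?thesis using True by simp
    qed simp
  qed
  also have "\<dots> = ?J * ennreal (L - 1)"
    using L by (subst nn_integral_cmult_indicator) auto
  also have "\<dots> < \<infinity>"
    using local_int(2)[OF K'(1,2)] by (simp add: integrable_iff_bounded ennreal_mult_less_top)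
  finally show "(\<integral>\<^sup>+z. norm (case z of (x, t) \<Rightarrow> indicator K x * (ray_integrand L g x t)) \<partial>(lborel \<Otimes>\<^sub>M lborel)) < \<infinity>" .
qed

lemma integrable_increment:
  assumes "compact K" "K \<subseteq> ball 0 (R / L) - {0}"
  shows "integrable lborel (\<lambda>x. indicator K x * increment L g x)"
proof -
  have "(\<lambda>x. indicator K x * increment L g x) = (\<lambda>x. LINT t|lborel. indicator K x * (ray_integrand L g x t))"
    unfolding increment_def by (subst integral_mult_right_zero) (rule refl)
  then show ?thesis
    using lborel_pair.integrable_fst[OF integrable_increment_strip[OF assms]] by simp
qed

lemma integrable_dilated:
  assumes K: "compact K" "K \<subseteq> ball 0 (R / L) - {0}"
  shows "integrable lborel (\<lambda>x. indicator K x * u (L *\<^sub>R x))"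
proof -
  obtain K' :: "'a set" where K': "compact K'" "K' \<subseteq> ball 0 R - {0}"
    "\<And>x t. x \<in> K \<Longrightarrow> 1 \<le> t \<Longrightarrow> t \<le> L \<Longrightarrow> t *\<^sub>R x \<in> K'"
    using swept_annulus[OF K] by metis
  have "integrable lborel (\<lambda>x. indicator K' (L *\<^sub>R x) * u (L *\<^sub>R x))"
    using local_int(1)[OF K'(1,2)] L by (intro integrable_dilation[where f = "\<lambda>x. indicator K' x * u x"]) auto
  moreover have "K \<in> sets lborel" using compact_imp_closed[OF K(1)] by auto
  ultimately have "integrable lborel (\<lambda>x. indicator K x *\<^sub>R (indicator K' (L *\<^sub>R x) * u (L *\<^sub>R x)))"
    by (intro integrable_mult_indicator)
  also have "(\<lambda>x. indicator K x *\<^sub>R (indicator K' (L *\<^sub>R x) * u (L *\<^sub>R x))) = (\<lambda>x. indicator K x * u (L *\<^sub>R x))"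
    using K'(3) L by (auto simp: fun_eq_iff split: split_indicator)
  finally show ?thesis .
qed

lemma subset_smaller_ball: "K \<subseteq> ball 0 (R / L) - {0} \<Longrightarrow> K \<subseteq> ball 0 R - {0}"
proof -
  have "R / L \<le> R / 1" using R L by (intro divide_left_mono) auto
  then show "K \<subseteq> ball 0 (R / L) - {0} \<Longrightarrow> K \<subseteq> ball 0 R - {0}" by force
qed

text \<open>
  For fixed \<open>t\<close>, dilation and the weak identity for \<open>y \<mapsto> \<phi> (y / t)\<close> turn \<open>\<integral> \<phi> x * g (t x)\<close> into an
  integral of \<open>u\<close> against \<open>- t powr (- N) * \<psi> (y / t)\<close>. After Fubini's theorem the integral over \<open>t\<close> is elementary,
  since \<open>- t powr (- N - 1) * \<psi> (y / t)\<close> is the derivative of \<open>t powr (- N) * \<phi> (y / t)\<close>.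
\<close>

lemma increment_test:
  assumes \<phi>: "\<phi> \<in> C1c (ball 0 (R / L) - {0})"
  shows "(LINT x|lborel. increment L g x * \<phi> x) = (LINT x|lborel. u (L *\<^sub>R x) * \<phi> x) - (LINT x|lborel. u x * \<phi> x)"
proof -
  let ?n = "real DIM('a)"
  define \<psi> where "\<psi> z = ?n * \<phi> z + gradient \<phi> z \<bullet> z" for z
  let ?T = "\<lambda>y t. indicator {1..L} t * (t powr (- ?n - 1) * \<psi> (y /\<^sub>R t))"
  obtain K where K: "compact K" "K \<subseteq> ball 0 (R / L) - {0}" "\<And>x. x \<notin> K \<Longrightarrow> \<phi> x = 0" "\<And>x. x \<notin> K \<Longrightarrow> gradient \<phi> x = 0"
    using C1c_support[OF \<phi>] by metis
  obtain K' :: "'a set" where K': "compact K'" "K' \<subseteq> ball 0 R - {0}"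
    "\<And>x t. x \<in> K \<Longrightarrow> 1 \<le> t \<Longrightarrow> t \<le> L \<Longrightarrow> t *\<^sub>R x \<in> K'"
    using swept_annulus[OF K(1,2)] by metis
  have K'_mem: "y \<in> K'" if "y /\<^sub>R t \<in> K" "1 \<le> t" "t \<le> L" for y t
    using K'(3)[OF that] that by simp
  note c\<phi> = C1c_continuous[OF \<phi>] C1c_continuous_gradient[OF \<phi>]
  have [measurable]: "\<phi> \<in> borel_measurable borel"
    using c\<phi>(1) by (rule borel_measurable_continuous_onI)
  have c\<psi>: "continuous_on UNIV \<psi>"
    unfolding \<psi>_def[abs_def] by (intro continuous_intros c\<phi>)
  then have [measurable]: "\<psi> \<in> borel_measurable borel"
    by (rule borel_measurable_continuous_onI)
  have \<psi>0: "\<psi> z = 0" if "z \<notin> K" for z using K(3,4)[OF that] by (simp add: \<psi>_def)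
  obtain B where B: "\<And>x. \<bar>\<phi> x\<bar> \<le> B" using bounded_if_compact_support[OF c\<phi>(1) K(1,3)] by blast
  obtain B' where B': "\<And>x. \<bar>\<psi> x\<bar> \<le> B'" using bounded_if_compact_support[OF c\<psi> K(1) \<psi>0] by blast
  have slice: "(LINT x|lborel. \<phi> x * g (t *\<^sub>R x)) = - (t powr - ?n * (LINT y|lborel. u y * \<psi> (y /\<^sub>R t)))"
    if t: "1 \<le> t" "t \<le> L" for t
  proof -
    have "integrable lborel (\<lambda>y. (indicator K' y * g y) * \<phi> (y /\<^sub>R t))"
      by (rule integrable_bounded_mult[OF local_int(2)[OF K'(1,2)] _ B]) measurable
    also have "(\<lambda>y. (indicator K' y * g y) * \<phi> (y /\<^sub>R t)) = (\<lambda>y. g y * \<phi> (y /\<^sub>R t))"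
    proof
      fix y
      show "(indicator K' y * g y) * \<phi> (y /\<^sub>R t) = g y * \<phi> (y /\<^sub>R t)"
        using K(3)[of "y /\<^sub>R t"] K'_mem[of t y] t by (cases "y /\<^sub>R t \<in> K") auto
    qed
    finally have int: "integrable lborel (\<lambda>y. g y * \<phi> (y /\<^sub>R t))" .
    have "(LINT x|lborel. \<phi> x * g (t *\<^sub>R x)) = (LINT x|lborel. g (t *\<^sub>R x) * \<phi> ((t *\<^sub>R x) /\<^sub>R t))"
      using t by (simp add: mult.commute)
    also have "\<dots> = t powr - ?n * (LINT y|lborel. g y * \<phi> (y /\<^sub>R t))"
      using t by (intro integral_dilation[OF int]) auto
    also have "(LINT y|lborel. g y * \<phi> (y /\<^sub>R t)) = - (LINT y|lborel. u y * \<psi> (y /\<^sub>R t))"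
    proof -
      have sub: "x /\<^sub>R inverse t \<in> ball 0 R - {0}" if "x \<in> ball 0 (R / L) - {0}" for x :: 'a
      proof -
        have "t * norm x \<le> L * norm x" using t by (intro mult_right_mono) auto
        also have "\<dots> < R" using that L by (auto simp: field_simps)
        finally show ?thesis using that t by simp
      qed
      have inv: "0 < inverse t" using t by simp
      have grad: "gradient (\<lambda>y. \<phi> (inverse t *\<^sub>R y)) = (\<lambda>y. inverse t *\<^sub>R gradient \<phi> (inverse t *\<^sub>R y))"
        by (rule C1c_dilate(2)[OF \<phi> inv]) (rule sub)
      have "(LINT y|lborel. u y * (?n * \<phi> (inverse t *\<^sub>R y) + gradient (\<lambda>y. \<phi> (inverse t *\<^sub>R y)) y \<bullet> y)) = - (LINT y|lborel. g y * \<phi> (inverse t *\<^sub>R y))"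
        using W C1c_dilate(1)[OF \<phi> inv sub] by (simp add: weak_radial_def)
      then show ?thesis
        unfolding grad by (simp add: \<psi>_def)
    qed
    finally show ?thesis by simp
  qed
  have "integrable (lborel \<Otimes>\<^sub>M lborel) (\<lambda>z. (case z of (x, t) \<Rightarrow> indicator K x * (ray_integrand L g x t)) * \<phi> (fst z))"
    by (rule integrable_bounded_mult[OF integrable_increment_strip[OF K(1,2)] _ B]) measurable
  also have "(\<lambda>z. (case z of (x, t) \<Rightarrow> indicator K x * (ray_integrand L g x t)) * \<phi> (fst z))
      = (\<lambda>(x, t). ray_integrand L g x t * \<phi> x)"
    using K(3) by (auto simp: fun_eq_iff indicator_def)
  finally have int1: "integrable (lborel \<Otimes>\<^sub>M lborel) (\<lambda>(x, t). ray_integrand L g x t * \<phi> x)" .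
  have "integrable (lborel \<Otimes>\<^sub>M lborel) (\<lambda>z. (case z of (y, t) \<Rightarrow> (indicator K' y * u y) * indicator {1..L} t) *
      (case z of (y, t) \<Rightarrow> indicator {1..L} t * t powr (- ?n - 1) * \<psi> (y /\<^sub>R t)))"
  proof (rule integrable_bounded_mult[OF integrable_strip[OF local_int(1)[OF K'(1,2)]]])
    show "(\<lambda>z. case z of (y, t) \<Rightarrow> indicator {1..L} t * t powr (- ?n - 1) * \<psi> (y /\<^sub>R t)) \<in> borel_measurable (lborel \<Otimes>\<^sub>M lborel)"
      by measurable
    fix z :: "'a \<times> real"
    obtain y t where z: "z = (y, t)" by (cases z)
    show "\<bar>case z of (y, t) \<Rightarrow> indicator {1..L} t * t powr (- ?n - 1) * \<psi> (y /\<^sub>R t)\<bar> \<le> B'"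
    proof (cases "1 \<le> t \<and> t \<le> L")
      case True
      then have "t powr (- ?n - 1) \<le> 1" using powr_mono[of "- ?n - 1" 0 t] by simp
      then have "t powr (- ?n - 1) * \<bar>\<psi> (y /\<^sub>R t)\<bar> \<le> 1 * B'" using B' by (intro mult_mono) auto
      then show ?thesis using True by (simp add: z abs_mult)
    next
      case False
      then show ?thesis using B'[of 0] by (auto simp: z split: split_indicator)
    qed
  qed
  also have "(\<lambda>z. (case z of (y, t) \<Rightarrow> (indicator K' y * u y) * indicator {1..L} t) *
      (case z of (y, t) \<Rightarrow> indicator {1..L} t * t powr (- ?n - 1) * \<psi> (y /\<^sub>R t)))
      = (\<lambda>(y, t). u y * (?T y t))"
  proof (intro ext, clarify)
    fix y t
    show "((indicator K' y * u y) * indicator {1..L} t) * (indicator {1..L} t * t powr (- ?n - 1) * \<psi> (y /\<^sub>R t))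
      = u y * (?T y t)"
    proof (cases "1 \<le> t \<and> t \<le> L")
      case True
      then show ?thesis using \<psi>0[of "y /\<^sub>R t"] K'_mem[of t y] by (cases "y /\<^sub>R t \<in> K") auto
    next
      case False
      then show ?thesis by (auto split: split_indicator)
    qed
  qed
  finally have int2: "integrable (lborel \<Otimes>\<^sub>M lborel) (\<lambda>(y, t). u y * (?T y t))" .
  have ray_ftc: "(LINT t|lborel. ?T y t) = \<phi> y - L powr - ?n * \<phi> (y /\<^sub>R L)" for y
  proof -
    have "(LINT t|lborel. (t powr (- ?n - 1) * \<psi> (y /\<^sub>R t)) * indicator {1..L} t)
        = - (L powr - ?n * \<phi> (inverse L *\<^sub>R y)) - (- (1 powr - ?n * \<phi> (inverse 1 *\<^sub>R y)))"
    proof (rule integral_FTC_Icc_real[where F = "\<lambda>t. - (t powr - ?n * \<phi> (inverse t *\<^sub>R y))"])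
      fix t :: real assume t: "1 \<le> t" "t \<le> L"
      have d1: "((\<lambda>l. \<phi> (l *\<^sub>R y)) has_real_derivative y \<bullet> gradient \<phi> (inverse t *\<^sub>R y)) (at (inverse t))"
        by (rule GDERIV_along_ray[OF C1c_GDERIV[OF \<phi>]])
      have d2: "(inverse has_real_derivative - (inverse t * inverse t)) (at t)"
        using DERIV_inverse[of t UNIV] t by (simp add: power2_eq_square)
      have d3: "((\<lambda>t. t powr - ?n) has_real_derivative - ?n * t powr (- ?n - 1)) (at t)"
        using t by (intro has_real_derivative_powr) auto
      have "t powr - ?n = t powr (- ?n - 1) * t"
        using t by (simp add: powr_diff)
      then have "- (- ?n * t powr (- ?n - 1) * \<phi> (inverse t *\<^sub>R y) + y \<bullet> gradient \<phi> (inverse t *\<^sub>R y) * - (inverse t * inverse t) * t powr - ?n)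
          = t powr (- ?n - 1) * \<psi> (y /\<^sub>R t)"
        using t by (simp add: \<psi>_def inner_commute algebra_simps)
      then show "((\<lambda>t. - (t powr - ?n * \<phi> (inverse t *\<^sub>R y))) has_real_derivative t powr (- ?n - 1) * \<psi> (y /\<^sub>R t)) (at t)"
        using DERIV_minus[OF DERIV_mult[OF d3 DERIV_chain2[OF d1 d2]]] by simp
      have "isCont \<psi> (y /\<^sub>R t)" using c\<psi> by (simp add: continuous_on_eq_continuous_at)
      moreover have "isCont (\<lambda>t. y /\<^sub>R t) t" using t by (intro continuous_intros) auto
      ultimately have "isCont (\<lambda>t. \<psi> (y /\<^sub>R t)) t" by - (rule isCont_o2[where f = "\<lambda>t. y /\<^sub>R t" and g = \<psi>]; assumption)
      then show "isCont (\<lambda>t. t powr (- ?n - 1) * \<psi> (y /\<^sub>R t)) t"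
        using t by (intro continuous_intros) auto
    qed (use L in auto)
    then show ?thesis by (simp add: mult.commute)
  qed
  have u\<phi>: "integrable lborel (\<lambda>y. u y * \<phi> y)" and u\<phi>L: "integrable lborel (\<lambda>y. u y * \<phi> (y /\<^sub>R L))"
  proof -
    have "integrable lborel (\<lambda>y. (indicator K' y * u y) * \<phi> y)"
      by (rule integrable_bounded_mult[OF local_int(1)[OF K'(1,2)] _ B]) measurable
    also have "(\<lambda>y. (indicator K' y * u y) * \<phi> y) = (\<lambda>y. u y * \<phi> y)"
      using K(3) K'(3)[of _ 1] L by (auto simp: fun_eq_iff indicator_def)
    finally show "integrable lborel (\<lambda>y. u y * \<phi> y)" .
    have "integrable lborel (\<lambda>y. (indicator K' y * u y) * \<phi> (y /\<^sub>R L))"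
      by (rule integrable_bounded_mult[OF local_int(1)[OF K'(1,2)] _ B]) measurable
    also have "(\<lambda>y. (indicator K' y * u y) * \<phi> (y /\<^sub>R L)) = (\<lambda>y. u y * \<phi> (y /\<^sub>R L))"
    proof
      fix y
      show "(indicator K' y * u y) * \<phi> (y /\<^sub>R L) = u y * \<phi> (y /\<^sub>R L)"
        using K(3)[of "y /\<^sub>R L"] K'_mem[of L y] L by (cases "y /\<^sub>R L \<in> K") auto
    qed
    finally show "integrable lborel (\<lambda>y. u y * \<phi> (y /\<^sub>R L))" .
  qed
  have "(LINT x|lborel. increment L g x * \<phi> x) = (LINT x|lborel. (LINT t|lborel. ray_integrand L g x t * \<phi> x))"
    by (simp only: increment_def integral_mult_left_zero)
  also have "\<dots> = (LINT t|lborel. (LINT x|lborel. ray_integrand L g x t * \<phi> x))"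
    by (rule lborel_pair.Fubini_integral[OF int1, symmetric])
  also have "\<dots> = (LINT t|lborel. - (LINT y|lborel. u y * (?T y t)))"
  proof (rule Bochner_Integration.integral_cong[OF refl])
    fix t :: real
    show "(LINT x|lborel. ray_integrand L g x t * \<phi> x) = - (LINT y|lborel. u y * (?T y t))"
    proof (cases "1 \<le> t \<and> t \<le> L")
      case True
      have "(LINT x|lborel. ray_integrand L g x t * \<phi> x) = (LINT x|lborel. (1 / t) * (\<phi> x * g (t *\<^sub>R x)))"
        using True by (simp add: mult.commute)
      also have "\<dots> = 1 / t * - (t powr - ?n * (LINT y|lborel. u y * \<psi> (y /\<^sub>R t)))"
        using slice[of t] True by simp
      also have "\<dots> = - (LINT y|lborel. t powr (- ?n - 1) * (u y * \<psi> (y /\<^sub>R t)))"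
        using True by (simp add: powr_diff)
      also have "(\<lambda>y. t powr (- ?n - 1) * (u y * \<psi> (y /\<^sub>R t))) = (\<lambda>y. u y * (?T y t))"
        using True by (simp add: fun_eq_iff mult_ac)
      finally show ?thesis .
    next
      case False
      then have "indicator {1..L} t = (0::real)" by simp
      then show ?thesis by simp
    qed
  qed
  also have "\<dots> = - (LINT y|lborel. (LINT t|lborel. u y * (?T y t)))"
    using lborel_pair.Fubini_integral[OF int2] by simp
  also have "\<dots> = - (LINT y|lborel. u y * \<phi> y - L powr - ?n * (u y * \<phi> (y /\<^sub>R L)))"
    by (simp only: integral_mult_right_zero ray_ftc right_diff_distrib mult.left_commute)
  also have "\<dots> = L powr - ?n * (LINT y|lborel. u y * \<phi> (y /\<^sub>R L)) - (LINT y|lborel. u y * \<phi> y)"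
    using u\<phi> u\<phi>L by (subst Bochner_Integration.integral_diff) auto
  also have "L powr - ?n * (LINT y|lborel. u y * \<phi> (y /\<^sub>R L)) = (LINT x|lborel. u (L *\<^sub>R x) * \<phi> x)"
    using integral_dilation[OF u\<phi>L, of L] L by simp
  finally show ?thesis .
qed

text \<open>
  The preceding identity says that the difference of the two sides is orthogonal to all test functions.
\<close>

lemma radial_difference:
  "AE x in lborel. x \<in> ball 0 (R / L) - {0} \<longrightarrow> u (L *\<^sub>R x) - u x = increment L g x"
proof -
  let ?U = "ball 0 (R / L) - {0} :: 'a set"
  have "AE x in lborel. x \<in> ?U \<longrightarrow> u (L *\<^sub>R x) - u x - increment L g x = 0"
  proof (rule AE_zero_if_C1c_integrals_zero)
    show "open ?U" by (intro open_Diff) auto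
    have int: "integrable lborel (\<lambda>x. indicator K x * u (L *\<^sub>R x))" "integrable lborel (\<lambda>x. indicator K x * u x)"
      "integrable lborel (\<lambda>x. indicator K x * increment L g x)" if "compact K" "K \<subseteq> ?U" for K
      using integrable_dilated[OF that] local_int(1)[OF that(1) subset_smaller_ball[OF that(2)]] integrable_increment[OF that] by auto
    show "integrable lborel (\<lambda>x. indicator K x * (u (L *\<^sub>R x) - u x - increment L g x))" if "compact K" "K \<subseteq> ?U" for K
      using int[OF that] by (simp add: right_diff_distrib)
    fix \<phi> :: "'a \<Rightarrow> real" assume \<phi>: "\<phi> \<in> C1c ?U"
    obtain K where K: "compact K" "K \<subseteq> ?U" "\<And>x. x \<notin> K \<Longrightarrow> \<phi> x = 0"
      using C1c_support[OF \<phi>] by metis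
    obtain B where B: "\<And>x. \<bar>\<phi> x\<bar> \<le> B"
      using bounded_if_compact_support[OF C1c_continuous[OF \<phi>] K(1,3)] by blast
    have "integrable lborel (\<lambda>x. f x * \<phi> x)" if "integrable lborel (\<lambda>x. indicator K x * f x)" for f :: "'a \<Rightarrow> real"
    proof -
      have "integrable lborel (\<lambda>x. (indicator K x * f x) * \<phi> x)"
        using C1c_borel(1)[OF \<phi>] by (intro integrable_bounded_mult[OF that _ B]) simp
      also have "(\<lambda>x. (indicator K x * f x) * \<phi> x) = (\<lambda>x. f x * \<phi> x)"
        using K(3) by (auto simp: fun_eq_iff indicator_def)
      finally show ?thesis .
    qed
    note this[OF int(1)[OF K(1,2)]] this[OF int(2)[OF K(1,2)]] this[OF int(3)[OF K(1,2)]]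
    then show "(LINT x|lborel. (u (L *\<^sub>R x) - u x - increment L g x) * \<phi> x) = 0"
      using increment_test[OF \<phi>] by (simp add: left_diff_distrib)
  qed measurable
  then show ?thesis by eventually_elim auto
qed

end

section \<open>The constant is not attained\<close>

context hardy_setup
begin

abbreviation (input) ray_lhs :: "('a::euclidean_space \<Rightarrow> real) \<Rightarrow> 'a \<Rightarrow> ennreal" where
  "ray_lhs u x \<equiv> (\<integral>\<^sup>+l\<in>{1<..}. ennreal (lhs_density u (l *\<^sub>R x)) * indicator (ball 0 R) (l *\<^sub>R x) \<partial>lborel)"

text \<open>
  Near the boundary \<open>s powr (- \<beta>)\<close> is at least \<open>1 / s\<close>, whose integral along the ray diverges.
\<close>

lemma ray_lhs_infinite:
  fixes u :: "'a::euclidean_space \<Rightarrow> real"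
  assumes x: "0 < norm x" "norm x < R" and "\<delta> > 0"
    and ae: "AE l in lborel. 1 < l \<and> l < R / norm x \<longrightarrow> \<delta> \<le> \<bar>u (l *\<^sub>R x)\<bar>"
  shows "ray_lhs u x = \<infinity>"
proof -
  let ?r = "norm x"
  \<comment> \<open>A lower bound for \<open>(l * ?r) powr (- \<alpha>)\<close>, whatever the sign of \<open>\<alpha>\<close>.\<close>
  define m where "m = min (?r powr (- \<alpha>)) (R powr (- \<alpha>))"
  have m: "m > 0" using x R by (simp add: m_def)
  define K where "K = \<delta> powr p * m"
  have K: "K > 0" using \<open>\<delta> > 0\<close> m by (simp add: K_def)
  have "AE l in lborel. 1 < l \<and> l < R / ?r \<longrightarrow>
      ennreal (K / s (l * ?r)) \<le> ennreal (lhs_density u (l *\<^sub>R x)) * indicator (ball 0 R) (l *\<^sub>R x)"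
    using ae
  proof eventually_elim
    case (elim l)
    show ?case
    proof
      assume l: "1 < l \<and> l < R / ?r"
      have lr: "?r \<le> l * ?r" "l * ?r < R"
        using l x mult_right_mono[of 1 l ?r] by (auto simp: field_simps)
      have s: "0 < s (l * ?r)" using lr x by (intro s_pos) auto
      have "\<delta> powr p \<le> \<bar>u (l *\<^sub>R x)\<bar> powr p"
        using elim l p \<open>\<delta> > 0\<close> by (intro powr_mono2) auto
      moreover have "m \<le> (l * ?r) powr (- \<alpha>)"
        unfolding m_def using x lr by (intro powr_ge_min) auto
      moreover have "s (l * ?r) powr (- 1) \<le> s (l * ?r) powr (- \<beta>)"
        using s s_le_1[of "l * ?r"] \<beta> by (intro powr_mono') auto
      then have "1 / s (l * ?r) \<le> s (l * ?r) powr (- \<beta>)"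
        using s by (simp add: powr_minus_divide)
      ultimately have "\<delta> powr p * (m * (1 / s (l * ?r))) \<le> \<bar>u (l *\<^sub>R x)\<bar> powr p * ((l * ?r) powr (- \<alpha>) * s (l * ?r) powr (- \<beta>))"
        using m s by (intro mult_mono) auto
      then have "K / s (l * ?r) \<le> lhs_density u (l *\<^sub>R x)"
        using l by (simp add: K_def lhs_density_def)
      then show "ennreal (K / s (l * ?r)) \<le> ennreal (lhs_density u (l *\<^sub>R x)) * indicator (ball 0 R) (l *\<^sub>R x)"
        using l lr by (auto intro!: ennreal_leI)
    qed
  qed
  then show ?thesis
    by (rule ray_integral_infinite[OF x K])
qed

text \<open>
  For almost every \<open>x\<close>, \<open>|u x| \<le> |u (l x)| + ray g x\<close> for almost every \<open>l\<close>. If the claim failed at such an \<open>x\<close>, then \<open>|u|\<close>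
  would be bounded below by a positive number along the ray, contradicting the
  finiteness of the left-hand side.
\<close>

lemma weak_radial_dominated:
  fixes u g :: "'a::euclidean_space \<Rightarrow> real"
  assumes dim: "DIM('a) \<ge> 2" and W: "weak_radial R u g"
    and fin: "lhs_integral u < \<infinity>"
  shows "AE x in lborel. norm x < R \<longrightarrow> ennreal \<bar>u x\<bar> \<le> ray g x"
proof -
  have [measurable]: "u \<in> borel_measurable borel" "g \<in> borel_measurable borel"
    using W by (auto simp: weak_radial_def)
  have [measurable]: "lhs_density u \<in> borel_measurable borel"
    unfolding lhs_density_def[abs_def] by measurable
  have [measurable]: "ray g \<in> borel_measurable borel"
    unfolding ray_def[abs_def] by measurable
  define P where "P x l \<longleftrightarrow> (1 < l \<and> l * norm x < R \<longrightarrow> ennreal \<bar>u x\<bar> \<le> ennreal \<bar>u (l *\<^sub>R x)\<bar> + ray g x)" for x l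
  have step: "AE x in lborel. P x l" for l
  proof (cases "1 < l")
    case True
    have "AE x in lborel. x \<noteq> 0"
      by (rule AE_lborel_singleton)
    then show ?thesis
      using radial_difference[OF R True W]
    proof eventually_elim
      case (elim x)
      show ?case
        unfolding P_def
      proof
        assume "1 < l \<and> l * norm x < R"
        then have eq: "u (l *\<^sub>R x) - u x = increment l g x"
          using elim by (simp add: field_simps)
        have "ennreal \<bar>increment l g x\<bar> \<le> (\<integral>\<^sup>+t. ennreal (norm (indicator {1..l} t * (g (t *\<^sub>R x) / t))) \<partial>lborel)"
          using integral_norm_bound_ennreal[of lborel "\<lambda>t. indicator {1..l} t * (g (t *\<^sub>R x) / t)"]
          by (cases "integrable lborel (\<lambda>t. indicator {1..l} t * (g (t *\<^sub>R x) / t))")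
             (auto simp: increment_def not_integrable_integral_eq)
        also have "\<dots> \<le> ray g x"
          unfolding ray_def
        proof (rule nn_integral_mono_AE)
          show "AE t in lborel. ennreal (norm (indicator {1..l} t * (g (t *\<^sub>R x) / t))) \<le> ennreal (\<bar>g (t *\<^sub>R x)\<bar> / t) * indicator {1<..} t"
            using AE_lborel_singleton[of 1] by eventually_elim (auto split: split_indicator)
        qed
        finally have "ennreal \<bar>u (l *\<^sub>R x)\<bar> + ennreal \<bar>increment l g x\<bar> \<le> ennreal \<bar>u (l *\<^sub>R x)\<bar> + ray g x"
          by (rule add_left_mono)
        moreover have "ennreal \<bar>u x\<bar> \<le> ennreal \<bar>u (l *\<^sub>R x)\<bar> + ennreal \<bar>increment l g x\<bar>"
        proof -
          have "\<bar>u x\<bar> \<le> \<bar>u (l *\<^sub>R x)\<bar> + \<bar>increment l g x\<bar>"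
            unfolding eq[symmetric] by linarith
          then show ?thesis by (simp add: ennreal_leI flip: ennreal_plus)
        qed
        ultimately show "ennreal \<bar>u x\<bar> \<le> ennreal \<bar>u (l *\<^sub>R x)\<bar> + ray g x" by (rule order_trans[rotated])
      qed
    qed
  qed (simp add: P_def)
  have "AE x in lborel. AE l in lborel. P x l"
  proof (subst lborel_pair.AE_commute)
    show "{z \<in> space (lborel \<Otimes>\<^sub>M lborel). P (fst z) (snd z)} \<in> sets (lborel \<Otimes>\<^sub>M lborel)"
      unfolding P_def by measurable
    show "AE l in lborel. AE x in lborel. P x l" using step by simp
  qed
  moreover have "AE x in lborel. ray_lhs u x < \<infinity>"
    using fin dim by (intro AE_ray_integral_finite) auto
  ultimately show ?thesis
    using AE_lborel_singleton[of 0]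
  proof eventually_elim
    case (elim x)
    show ?case
    proof (intro impI, rule ccontr)
      assume xR: "norm x < R" and "\<not> ennreal \<bar>u x\<bar> \<le> ray g x"
      then have less: "ray g x < ennreal \<bar>u x\<bar>" by simp
      then obtain \<rho> where \<rho>: "ray g x = ennreal \<rho>" "0 \<le> \<rho>"
        by (cases "ray g x" rule: ennreal_cases) (auto simp: top_unique)
      with less have "\<rho> < \<bar>u x\<bar>" by (simp add: ennreal_less_iff)
      have "AE l in lborel. 1 < l \<and> l < R / norm x \<longrightarrow> \<bar>u x\<bar> - \<rho> \<le> \<bar>u (l *\<^sub>R x)\<bar>"
        using elim(1)
      proof eventually_elim
        case (elim l)
        show ?case
        proof
          assume "1 < l \<and> l < R / norm x"
          then have "ennreal \<bar>u x\<bar> \<le> ennreal \<bar>u (l *\<^sub>R x)\<bar> + ennreal \<rho>"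
            using elim \<open>x \<noteq> 0\<close> by (simp add: P_def \<rho> field_simps)
          then have "\<bar>u x\<bar> \<le> \<bar>u (l *\<^sub>R x)\<bar> + \<rho>"
            using \<rho>(2) by (simp flip: ennreal_plus)
          then show "\<bar>u x\<bar> - \<rho> \<le> \<bar>u (l *\<^sub>R x)\<bar>" by simp
        qed
      qed
      then have "ray_lhs u x = \<infinity>"
        using \<open>\<rho> < \<bar>u x\<bar>\<close> elim(3) xR by (intro ray_lhs_infinite) auto
      then show False using elim(2) by simp
    qed
  qed
qed

theorem Hardy_constant_not_attained:
  assumes dim: "DIM('a::euclidean_space) = dim" "dim \<ge> 2" and strict: "p > 1 \<or> c < e"
  shows "hardy_not_attained TYPE('a) (c powr p) R p \<alpha> \<beta> \<gamma>"
  unfolding hardy_not_attained_def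
proof (intro allI impI notI)
  fix u :: "'a \<Rightarrow> real" and G
  assume "has_weak_gradient_on u G (ball 0 R - {0}) \<and> \<not> (AE x in lebesgue. x \<in> ball 0 R \<longrightarrow> u x = 0) \<and> hardy_rhs R p \<alpha> \<beta> \<gamma> G < \<infinity>"
  then have W: "has_weak_gradient_on u G (ball 0 R - {0})" and nz: "\<not> (AE x in lebesgue. x \<in> ball 0 R \<longrightarrow> u x = 0)"
    and fin: "hardy_rhs R p \<alpha> \<beta> \<gamma> G < \<infinity>" by auto
  assume eq: "ennreal (c powr p) * hardy_lhs R p \<alpha> \<beta> \<gamma> u = hardy_rhs R p \<alpha> \<beta> \<gamma> G"
  obtain u' g' where W': "weak_radial R u' g'"
    and u': "AE x in lborel. x \<in> ball 0 R - {0} \<longrightarrow> u x = u' x"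
    and g': "AE x in lborel. x \<in> ball 0 R - {0} \<longrightarrow> G x \<bullet> x = g' x"
    by (rule weak_gradient_radial_representative[OF R W])
  have [measurable]: "u' \<in> borel_measurable borel" "g' \<in> borel_measurable borel" and g0: "\<And>y. R \<le> norm y \<Longrightarrow> g' y = 0"
    using W' by (auto simp: weak_radial_def)
  have lhs: "hardy_lhs R p \<alpha> \<beta> \<gamma> u = lhs_integral u'"
    unfolding hardy_lhs_eq
  proof (rule nn_integral_cong_AE)
    show "AE x in lborel. ennreal (lhs_density u x) * indicator (ball 0 R) x = ennreal (lhs_density u' x) * indicator (ball 0 R) x"
      using u' AE_lborel_singleton[of 0] by eventually_elim (auto simp: lhs_density_def split: split_indicator)
  qed
  have rhs: "hardy_rhs R p \<alpha> \<beta> \<gamma> G = rhs_integral g'"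
    unfolding hardy_rhs_eq
  proof (rule nn_integral_cong_AE)
    show "AE x in lborel. ennreal (rhs_density (\<lambda>x. G x \<bullet> x) x) * indicator (ball 0 R) x = ennreal (rhs_density g' x) * indicator (ball 0 R) x"
      using g' AE_lborel_singleton[of 0] by eventually_elim (auto simp: rhs_density_def split: split_indicator)
  qed
  have "ennreal (c powr p) * hardy_lhs R p \<alpha> \<beta> \<gamma> u < \<infinity>"
    using fin eq by simp
  then have "hardy_lhs R p \<alpha> \<beta> \<gamma> u < \<infinity>"
    using c_pos by (auto simp: ennreal_mult_less_top less_top[symmetric])
  then have dom: "AE x in lborel. norm x < R \<longrightarrow> ennreal \<bar>u' x\<bar> \<le> ray g' x"
    unfolding lhs using dim by (intro weak_radial_dominated[OF _ W']) auto
  have "AE x in lborel. norm x < R \<longrightarrow> u' x = 0"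
    using fin eq unfolding lhs rhs by (intro Hardy_strict[OF dim(1) _ g0 _ dom strict dim(2)]) auto
  then have "AE x in lborel. x \<in> ball 0 R \<longrightarrow> u x = 0"
    using u' AE_lborel_singleton[of 0] by eventually_elim auto
  then show False using nz by (simp add: AE_completion_iff)
qed

end

theorem theorem1:
  fixes R p \<alpha> \<beta> \<gamma> C :: real
  assumes "CARD('n::finite) \<ge> 2" and "R > 0" and "p \<ge> 1" and "\<beta> > 1" and "\<gamma> > 0"
    and "\<alpha> \<le> real CARD('n) - (\<beta> - 1) * \<gamma>"
    and "C = ((\<beta> - 1) / p * \<gamma>) powr p"
  shows "(\<forall>u \<in> C1c (ball (0 :: real ^ 'n) R).
            ennreal C * hardy_lhs R p \<alpha> \<beta> \<gamma> u \<le> hardy_rhs R p \<alpha> \<beta> \<gamma> (gradient u)) \<and>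
         (\<forall>C'>C. \<exists>u \<in> C1c (ball (0 :: real ^ 'n) R).
            \<not> ennreal C' * hardy_lhs R p \<alpha> \<beta> \<gamma> u \<le> hardy_rhs R p \<alpha> \<beta> \<gamma> (gradient u)) \<and>
         (p > 1 \<or> \<alpha> < real CARD('n) - (\<beta> - 1) * \<gamma> \<longrightarrow>
            hardy_not_attained TYPE(real ^ 'n) C R p \<alpha> \<beta> \<gamma>)"
proof -
  interpret hardy_setup "CARD('n)" R p \<alpha> \<beta> \<gamma>
    using assms by unfold_locales auto
  have dim: "DIM(real ^ 'n) = CARD('n)" by simp
  have C: "C = c powr p"
    using assms(7) by (simp add: c_def q_def)
  have strict: "c < e" if "\<alpha> < real CARD('n) - (\<beta> - 1) * \<gamma>"
  proof -
    have "c * p = (\<beta> - 1) * \<gamma>"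
      using assms(3) by (simp add: c_def q_def)
    then show ?thesis using that by (simp add: e_def algebra_simps)
  qed
  show ?thesis
    unfolding C
    using Hardy_C1c[OF dim] Hardy_constant_optimal[OF dim]
      Hardy_constant_not_attained[OF dim assms(1)] strict by blast
qed

end
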